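(* Let $p\ge2$ and $\varepsilon\in(0,1)$. Given a vector $f\in\mathbb{R}^n$ arriving in the distributed streaming model over $k$ servers, there is an algorithm that, at all times, gives an estimate $\widehat{F}$ of $\|f\|_p^p$ satisfying $\mathbb{E}[\widehat F]=(1\pm O(\varepsilon))\cdot\|f\|_p^p$ and $\mathbb{E}[\widehat F^2]=\|f\|_p^{2p}\cdot\mathrm{polylog}(n)$. The algorithm uses $k^{p-1}\cdot\mathrm{polylog}(n)+\frac{\sqrt k}{\varepsilon}\cdot\mathrm{polylog}(n)$ bits of communication and succeeds with probability $1-\frac{1}{\mathrm{poly}(n)}$.
   Context: Distributed monitoring (coordinator) model: $k$ servers and a coordinator with private two-way channels; an insertion-only stream of length $\mathrm{poly}(n)$ of updates, each incrementing one coordinate of $[n]$ at one server; $f$ is the current global frequency vector (sum over servers). Communication cost is the total number of bits sent. $\|f\|_p^p=\sum_i f_i^p$. *)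

theory Defs
  imports "HOL-Probability.Probability"
begin

text \<open>
  Distributed monitoring with a coordinator. Servers are \<open>0, ..., k - 1\<close>; an update \<open>(j, i)\<close>
  increments coordinate \<open>i < n\<close> at server \<open>j < k\<close>.
\<close>

definition valid_stream :: "nat \<Rightarrow> nat \<Rightarrow> (nat \<times> nat) list \<Rightarrow> bool" where
  "valid_stream n k s \<longleftrightarrow> (\<forall>(j, i) \<in> set s. j < k \<and> i < n)"

definition freq :: "nat \<Rightarrow> (nat \<times> nat) list \<Rightarrow> nat \<Rightarrow> real" where
  "freq k s i = (\<Sum>j<k. real (count_list s (j, i)))"

definition moment :: "real \<Rightarrow> nat \<Rightarrow> nat \<Rightarrow> (nat \<times> nat) list \<Rightarrow> real" where
  "moment p n k s = (\<Sum>i<n. freq k s i powr p)"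

text \<open>
  Parties are deterministic functions of their own random seed and their own local history, so
  nothing is shared except through messages: a server sees its updates and the messages it
  received, the coordinator sees the messages it received together with the channel (the server)
  they came from. No party sees a global clock. Keeping whole histories rather than abstract states
  loses no generality, as computation and memory are free in this model.
  The empty message means that nothing is sent.

  Seeds are private: party \<open>j < k\<close> is server \<open>j\<close>, party \<open>k\<close> is the coordinator, and the seeds of
  different parties are independent.
\<close>

datatype server_event = Update nat | Received "bool list"

record protocol =
  seed_dist :: "nat \<Rightarrow> nat pmf"
  server_msg :: "nat \<Rightarrow> nat \<Rightarrow> server_event list \<Rightarrow> bool list"
    \<comment> \<open>server, its seed, its history; evaluated after each event at the server\<close>
  coord_msg :: "nat \<Rightarrow> (nat \<times> bool list) list \<Rightarrow> nat \<Rightarrow> bool list"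
    \<comment> \<open>seed, history, recipient; evaluated initially and after each message received\<close>
  coord_estimate :: "nat \<Rightarrow> (nat \<times> bool list) list \<Rightarrow> real"

definition seeds :: "protocol \<Rightarrow> nat \<Rightarrow> (nat \<Rightarrow> nat) pmf" where
  "seeds P k = Pi_pmf {0..k} 0 (seed_dist P)"

record config =
  server_view :: "nat \<Rightarrow> server_event list"
  coord_view :: "(nat \<times> bool list) list"
  pending :: "(nat \<times> bool list) list" \<comment> \<open>sent to the coordinator, not yet delivered\<close>
  bits :: nat \<comment> \<open>total number of bits sent so far, in both directions\<close>

definition server_step ::
    "protocol \<Rightarrow> (nat \<Rightarrow> nat) \<Rightarrow> nat \<Rightarrow> server_event \<Rightarrow> config \<Rightarrow> config" where
  "server_step P \<omega> j e c =
    (let v = server_view c j @ [e]; m = server_msg P j (\<omega> j) v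
     in c\<lparr>server_view := (server_view c)(j := v),
          pending := pending c @ (if m = [] then [] else [(j, m)]),
          bits := bits c + length m\<rparr>)"

definition coord_step :: "protocol \<Rightarrow> nat \<Rightarrow> (nat \<Rightarrow> nat) \<Rightarrow> config \<Rightarrow> config" where
  "coord_step P k \<omega> c =
    fold (\<lambda>j c'. let m = coord_msg P (\<omega> k) (coord_view c') j
                 in if m = [] then c'
                    else server_step P \<omega> j (Received m) (c'\<lparr>bits := bits c' + length m\<rparr>))
      [0..<k] c"

definition deliver :: "protocol \<Rightarrow> nat \<Rightarrow> (nat \<Rightarrow> nat) \<Rightarrow> config \<Rightarrow> config" where
  "deliver P k \<omega> c =
    (case pending c of
       [] \<Rightarrow> c
     | q # qs \<Rightarrow> coord_step P k \<omega> (c\<lparr>pending := qs, coord_view := coord_view c @ [q]\<rparr>))"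

text \<open>
  Messages are exchanged until none is pending. If that never happens, the result still has
  pending messages, so termination of a run can be read off from \<open>pending\<close>.
\<close>

definition settle :: "protocol \<Rightarrow> nat \<Rightarrow> (nat \<Rightarrow> nat) \<Rightarrow> config \<Rightarrow> config" where
  "settle P k \<omega> c =
    (deliver P k \<omega> ^^ (LEAST r. pending ((deliver P k \<omega> ^^ r) c) = [])) c"

definition initial :: "protocol \<Rightarrow> nat \<Rightarrow> (nat \<Rightarrow> nat) \<Rightarrow> config" where
  "initial P k \<omega> =
    settle P k \<omega> (coord_step P k \<omega>
      \<lparr>server_view = (\<lambda>_. []), coord_view = [], pending = [], bits = 0\<rparr>)"

definition run :: "protocol \<Rightarrow> nat \<Rightarrow> (nat \<Rightarrow> nat) \<Rightarrow> (nat \<times> nat) list \<Rightarrow> config" where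
  "run P k \<omega> s =
    fold (\<lambda>(j, i) c. settle P k \<omega> (server_step P \<omega> j (Update i) c)) s (initial P k \<omega>)"

definition estimate :: "protocol \<Rightarrow> nat \<Rightarrow> (nat \<times> nat) list \<Rightarrow> (nat \<Rightarrow> nat) \<Rightarrow> real" where
  "estimate P k s \<omega> = coord_estimate P (\<omega> k) (coord_view (run P k \<omega> s))"

definition uses_bits :: "protocol \<Rightarrow> nat \<Rightarrow> (nat \<times> nat) list \<Rightarrow> real \<Rightarrow> bool" where
  "uses_bits P k s B \<longleftrightarrow>
    (\<forall>\<omega> \<in> set_pmf (seeds P k).
       pending (run P k \<omega> s) = [] \<and> real (bits (run P k \<omega> s)) \<le> B)"

text \<open>
  The bias is at most \<open>\<beta>\<close> and the second moment at most \<open>v\<close>, relative to \<open>\<parallel>f\<parallel>\<^sub>p\<^sup>p\<close> and its square,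
  conditioned on the success event \<open>G\<close>. Meaningful only if \<open>G\<close> has positive probability (see
  \<open>cond_pmf\<close>).
\<close>

definition moment_estimate ::
    "real \<Rightarrow> nat \<Rightarrow> nat \<Rightarrow> protocol \<Rightarrow> (nat \<times> nat) list \<Rightarrow> (nat \<Rightarrow> nat) set \<Rightarrow> real \<Rightarrow> real \<Rightarrow> bool"
  where
  "moment_estimate p n k P s G \<beta> v \<longleftrightarrow>
    (let D = measure_pmf (cond_pmf (seeds P k) G); X = estimate P k s; F = moment p n k s
     in integrable D X \<and> integrable D (\<lambda>\<omega>. (X \<omega>)\<^sup>2) \<and>
        \<bar>(\<integral>\<omega>. X \<omega> \<partial>D) - F\<bar> \<le> \<beta> * F \<and>
        (\<integral>\<omega>. (X \<omega>)\<^sup>2 \<partial>D) \<le> v * F\<^sup>2)"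

end

theory Submission
  imports Defs
begin

text \<open>
  Give every item \<open>i\<close> a random threshold that \<open>f\<^sub>i\<close> has reached with probability \<open>f\<^sub>i powr p / M\<close>. If
  \<open>F = \<parallel>f\<parallel>\<^sub>p\<^sup>p\<close> is at most \<open>M\<close>, then \<open>M\<close> times the number of items that have reached their threshold is
  an unbiased estimate of \<open>F\<close>, with second moment \<open>O(M\<^sup>2)\<close>. So one monitors all scales \<open>M = 2\<^sup>r\<close> and
  uses a scale within a constant factor of \<open>F\<close>; it is chosen by independent copies of the same
  experiment, so that the choice does not bias the estimate.

  Items near their threshold are found in two phases. First, server \<open>j\<close> reports item \<open>i\<close> at a rate
  proportional to its share of the threshold, unless that share is below \<open>1 / (4 k)\<close>; for \<open>p \<ge> 2\<close> this
  takes about \<open>k powr (p - 1)\<close> reports. Only the logarithmically many items with enough reports are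
  followed further: all servers then report the multiples of \<open>\<epsilon> / sqrt k\<close> (up to logarithms) of the
  threshold, randomly shifted, which their counts pass. The roundings of the \<open>k\<close> servers are
  independent, so that they add up to a relative error of \<open>\<epsilon>\<close> only, at the price of \<open>sqrt k / \<epsilon>\<close>
  messages.

  The analysis uses public coins. They are replaced by the index into a fixed table of polynomially
  many coins that represents their distribution for all streams simultaneously; the coordinator
  draws the index and announces it.
\<close>

section \<open>Concentration and public coins\<close>

text \<open>The obstacle is that nobody knows the true counts: the coordinator holds outdated ones,
  a server only its own. Hence phases, level and estimate are functions of counters whose changes
  are reported, so that outdated and true counts give the same answers. The number of messages is
  analysed for an idealized run: \<open>ideal_cost\<close> depends on coins and stream alone. The
  protocol stops itself at \<open>cap\<close>, which makes the bit bound hold for every seed, and it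
  follows the ideal run if \<open>ideal_cost\<close> is below \<open>cap\<close>; success means that
  the drawn coins are that cheap for the whole stream. Conditioning on success, replacing the coins
  by a table and choosing a wrong scale all cost an additive error: a small probability times the
  largest possible estimate. Estimates are polynomial in \<open>n\<close> and \<open>F >= 1\<close>
  unless the stream is empty, so polynomially small probabilities make these errors relative. The
  power of \<open>k\<close> arises in phase 0: a server's share \<open>w >= 1 / (4 * k)\<close>
  satisfies \<open>w <= (4 * k) powr (p - 1) * w powr p\<close>, and the \<open>p\<close>-th powers
  of the shares sum to at most the \<open>p\<close>-th power of the total.\<close>

lemma Pi_pmf_chernoff:
  fixes X :: "'i \<Rightarrow> 'a \<Rightarrow> real"
  assumes fin: "finite I" and fs: "\<And>i. i \<in> I \<Longrightarrow> finite (set_pmf (p i))"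
    and mgf: "\<And>i. i \<in> I \<Longrightarrow> measure_pmf.expectation (p i) (\<lambda>x. 2 powr X i x) \<le> exp (z i)"
  shows "measure_pmf.prob (Pi_pmf I d p) {\<omega>. a \<le> (\<Sum>i\<in>I. X i (\<omega> i))} \<le> 2 powr (- a) * exp (\<Sum>i\<in>I. z i)"
proof -
  let ?P = "Pi_pmf I d p"
  have fsP: "finite (set_pmf ?P)"
    by (rule finite_subset[OF set_Pi_pmf_subset'[OF fin]]) (use fin fs in auto)
  have e: "(\<Prod>i\<in>I. 2 powr X i (\<omega> i)) = 2 powr (\<Sum>i\<in>I. X i (\<omega> i))" for \<omega>
    by (simp add: powr_sum fin)
  have "measure_pmf.prob ?P {\<omega>. a \<le> (\<Sum>i\<in>I. X i (\<omega> i))}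
      = measure_pmf.prob ?P {\<omega>\<in>space (measure_pmf ?P). (2::real) powr a \<le> (\<Prod>i\<in>I. 2 powr X i (\<omega> i))}"
    by (simp only: e) simp
  also have "\<dots> \<le> measure_pmf.expectation ?P (\<lambda>\<omega>. \<Prod>i\<in>I. 2 powr X i (\<omega> i)) / 2 powr a"
    by (rule integral_Markov_inequality_measure)
       (auto intro!: integrable_measure_pmf_finite fsP prod_nonneg)
  also have "measure_pmf.expectation ?P (\<lambda>\<omega>. \<Prod>i\<in>I. 2 powr X i (\<omega> i))
      = (\<Prod>i\<in>I. measure_pmf.expectation (p i) (\<lambda>x. 2 powr X i x))"
    by (rule expectation_prod_Pi_pmf[OF fin]) (auto intro!: integrable_measure_pmf_finite fs)
  also have "\<dots> \<le> (\<Prod>i\<in>I. exp (z i))"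
    by (intro prod_mono conjI mgf) (auto intro!: Bochner_Integration.integral_nonneg)
  also have "\<dots> = exp (\<Sum>i\<in>I. z i)" by (simp add: exp_sum fin)
  finally show ?thesis by (simp add: powr_minus divide_simps mult.commute divide_right_mono)
qed

text \<open>Chord bounds of convex functions on the unit interval. Base 2 serves for all exponential
  moments: both chords are rational, and optimal constants are not sought.\<close>

lemma two_powr_le_linear:
  fixes x :: real
  assumes "0 \<le> x" "x \<le> 1"
  shows "2 powr x \<le> 1 + x" and "2 powr (- x) \<le> 1 - x / 2"
proof -
  have c: "convex_on UNIV (\<lambda>t. exp (l * t))" for l :: real
    by (rule f''_ge0_imp_convex[where f' = "\<lambda>t. l * exp (l * t)" and f'' = "\<lambda>t. l * l * exp (l * t)"])
       (auto intro!: derivative_eq_intros)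
  have "exp (l * ((1 - x) *\<^sub>R 0 + x *\<^sub>R 1)) \<le> (1 - x) * exp (l * 0) + x * exp (l * 1)" for l :: real
    by (rule convex_onD[OF c]) (use assms in auto)
  then have *: "exp (l * x) \<le> (1 - x) + x * exp l" for l by simp
  show "2 powr x \<le> 1 + x" using *[of "ln 2"] by (simp add: powr_def mult.commute)
  have e: "exp (- ln 2) = (1/2::real)" by (simp add: exp_minus)
  have "2 powr (- x) = exp (- ln 2 * x)" by (simp add: powr_def mult.commute)
  also have "\<dots> \<le> 1 - x + x * (1 / 2)" using *[of "- ln 2"] unfolding e .
  finally show "2 powr (- x) \<le> 1 - x / 2" by simp
qed

lemma mgf_unit_interval:
  fixes X :: "'a \<Rightarrow> real"
  assumes fs: "finite (set_pmf p)" and X: "\<And>x. x \<in> set_pmf p \<Longrightarrow> 0 \<le> X x \<and> X x \<le> 1"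
  shows "measure_pmf.expectation p (\<lambda>x. 2 powr X x) \<le> exp (measure_pmf.expectation p X)"
    and "measure_pmf.expectation p (\<lambda>x. 2 powr (- X x)) \<le> exp (- measure_pmf.expectation p X / 2)"
proof -
  have i: "integrable (measure_pmf p) f" for f :: "'a \<Rightarrow> real"
    by (intro integrable_measure_pmf_finite fs)
  have "measure_pmf.expectation p (\<lambda>x. 2 powr X x) \<le> measure_pmf.expectation p (\<lambda>x. 1 + X x)"
    by (intro integral_mono_AE i AE_pmfI two_powr_le_linear) (use X in auto)
  also have "\<dots> = 1 + measure_pmf.expectation p X"
    by (subst Bochner_Integration.integral_add) (auto intro: i)
  also have "\<dots> \<le> exp (measure_pmf.expectation p X)" by (rule exp_ge_add_one_self)
  finally show "measure_pmf.expectation p (\<lambda>x. 2 powr X x) \<le> exp (measure_pmf.expectation p X)" .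
  have "measure_pmf.expectation p (\<lambda>x. 2 powr (- X x)) \<le> measure_pmf.expectation p (\<lambda>x. 1 - X x / 2)"
    by (intro integral_mono_AE i AE_pmfI two_powr_le_linear) (use X in auto)
  also have "\<dots> = 1 + (- measure_pmf.expectation p X / 2)"
    by (subst Bochner_Integration.integral_diff) (auto intro: i)
  also have "\<dots> \<le> exp (- measure_pmf.expectation p X / 2)" by (rule exp_ge_add_one_self)
  finally show "measure_pmf.expectation p (\<lambda>x. 2 powr (- X x)) \<le> exp (- measure_pmf.expectation p X / 2)" .
qed

text \<open>
  Dithered rounding: for \<open>w\<close> uniform below \<open>m\<close>, \<open>(Z + w) div m\<close> rounds \<open>Z / m\<close> to one of the two
  neighbouring integers without bias.
\<close>

lemma sum_dither:
  fixes h :: "nat \<Rightarrow> real"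
  assumes "m > 0"
  shows "(\<Sum>w<m. h ((Z + w) div m)) = real (m - Z mod m) * h (Z div m) + real (Z mod m) * h (Suc (Z div m))"
proof -
  let ?b = "Z mod m"
  have b: "?b < m" using assms by simp
  have Z: "Z = m * (Z div m) + ?b" by simp
  have d: "(Z + w) div m = (if w < m - ?b then Z div m else Suc (Z div m))" if "w < m" for w
  proof -
    have "(Z + w) div m = (m * (Z div m) + (?b + w)) div m" by (subst Z) (simp add: add.assoc)
    also have "\<dots> = Z div m + (?b + w) div m" using assms by (subst div_mult_self4) auto
    also have "(?b + w) div m = (if w < m - ?b then 0 else 1)"
    proof (cases "w < m - ?b")
      case False
      then have "m \<le> ?b + w" "?b + w - m < m" using that b by linarith+
      then have "(?b + w) div m = 1" using assms by (simp add: le_div_geq)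
      then show ?thesis using False by simp
    qed simp
    finally show ?thesis by simp
  qed
  have "(\<Sum>w<m. h ((Z + w) div m)) = (\<Sum>w<m. if w < m - ?b then h (Z div m) else h (Suc (Z div m)))"
    by (intro sum.cong) (auto simp: d)
  also have "\<dots> = (\<Sum>w\<in>{..<m - ?b}. h (Z div m)) + (\<Sum>w\<in>{m - ?b..<m}. h (Suc (Z div m)))"
  proof -
    have split: "{..<m} = {..<m - ?b} \<union> {m - ?b..<m}" by auto
    show ?thesis
      unfolding split by (subst sum.union_disjoint) (auto intro!: arg_cong2[of _ _ _ _ "(+)"] sum.cong)
  qed
  also have "\<dots> = real (m - ?b) * h (Z div m) + real ?b * h (Suc (Z div m))" using b by simp
  finally show ?thesis .
qed

lemma expectation_pmf_of_lessThan:
  fixes f :: "nat \<Rightarrow> real"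
  assumes "m > 0"
  shows "measure_pmf.expectation (pmf_of_set {..<m}) f = (\<Sum>w<m. f w) / m"
  using assms by (subst integral_pmf_of_set) (auto simp: lessThan_empty_iff)

text \<open>The rounded value may exceed 1, so \<open>mgf_unit_interval\<close> does not apply. Its
  integer part \<open>A\<close> is deterministic, however, and factors out; only the Bernoulli
  variable with mean \<open>\<phi>\<close> needs an exponential moment bound.\<close>

lemma dither:
  fixes m Z :: nat
  assumes "m > 0"
  defines "g \<equiv> \<lambda>w. real ((Z + w) div m)"
  shows expectation_dither: "measure_pmf.expectation (pmf_of_set {..<m}) g = Z / m"
    and mgf_dither_upper: "measure_pmf.expectation (pmf_of_set {..<m}) (\<lambda>w. 2 powr g w) \<le> exp (Z / m)"
    and mgf_dither_lower: "measure_pmf.expectation (pmf_of_set {..<m}) (\<lambda>w. 2 powr (- g w)) \<le> exp (- (Z / m) / 2)"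
proof -
  define A where "A = Z div m"
  define b where "b = Z mod m"
  have b: "b < m" using assms by (simp add: b_def)
  have Z: "real Z = real m * real A + real b"
    unfolding A_def b_def by (metis mult_div_mod_eq of_nat_add of_nat_mult)
  define \<phi> where "\<phi> = real b / real m"
  have \<phi>: "0 \<le> \<phi>" "\<phi> \<le> 1" using b by (auto simp: \<phi>_def)
  have Zm: "real Z / real m = A + \<phi>" using assms(1) by (simp add: Z \<phi>_def field_simps)
  have E: "measure_pmf.expectation (pmf_of_set {..<m}) (\<lambda>w. h ((Z + w) div m)) = (1 - \<phi>) * h A + \<phi> * h (Suc A)"
    for h :: "nat \<Rightarrow> real"
    unfolding expectation_pmf_of_lessThan[OF assms(1)] sum_dither[OF assms(1)] A_def[symmetric] b_def[symmetric]
    using b assms(1) by (simp add: \<phi>_def of_nat_diff field_simps)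
  show "measure_pmf.expectation (pmf_of_set {..<m}) g = Z / m"
    using E[of real] by (simp add: g_def Zm algebra_simps)
  have "measure_pmf.expectation (pmf_of_set {..<m}) (\<lambda>w. 2 powr g w) = (1 + \<phi>) * 2 powr real A"
    using E[of "\<lambda>x. 2 powr real x"] by (simp add: g_def powr_add algebra_simps)
  also have "\<dots> \<le> exp \<phi> * exp A"
  proof (intro mult_mono)
    have "(2::real) powr A \<le> exp 1 powr A"
      by (intro powr_mono2) (use exp_ge_add_one_self[of 1] in auto)
    then show "2 powr real A \<le> exp (real A)" by (simp add: powr_def)
  qed (use \<phi> in auto)
  also have "\<dots> = exp (Z / m)" by (simp add: Zm exp_add mult.commute)
  finally show "measure_pmf.expectation (pmf_of_set {..<m}) (\<lambda>w. 2 powr g w) \<le> exp (Z / m)" .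
  have "measure_pmf.expectation (pmf_of_set {..<m}) (\<lambda>w. 2 powr (- g w)) = (1 - \<phi> / 2) * 2 powr (- real A)"
  proof -
    have "(2::real) powr (- real (Suc A)) = 2 powr (- real A) / 2"
    proof -
      have "- real (Suc A) = - real A - 1" by simp
      then show ?thesis by (simp only: powr_diff) simp
    qed
    then show ?thesis
      using E[of "\<lambda>x. 2 powr (- real x)"] unfolding g_def by (simp only:) (simp add: algebra_simps)
  qed
  also have "\<dots> \<le> exp (- \<phi> / 2) * exp (- real A / 2)"
  proof (intro mult_mono)
    show "1 - \<phi> / 2 \<le> exp (- \<phi> / 2)" using exp_ge_add_one_self[of "- \<phi> / 2"] by simp
    have "1 / 2 \<le> exp (- 1 / 2 :: real)" using exp_ge_add_one_self[of "- 1 / 2 :: real"] by simp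
    then have "(1 / 2 :: real) powr A \<le> exp (- 1 / 2) powr A"
      by (intro powr_mono2) auto
    moreover have "exp (- 1 / 2) powr A = exp (- real A / 2)" by (simp only: exp_powr_real) simp
    moreover have "(1 / 2 :: real) powr A = 2 powr - real A" by (simp add: powr_divide powr_minus_divide)
    ultimately show "2 powr (- real A) \<le> exp (- real A / 2)" by simp
  qed (use \<phi> in auto)
  also have "\<dots> = exp (- (Z / m) / 2)" unfolding Zm exp_add[symmetric] by (simp add: field_simps)
  finally show "measure_pmf.expectation (pmf_of_set {..<m}) (\<lambda>w. 2 powr (- g w)) \<le> exp (- (Z / m) / 2)" .
qed

text \<open>Used with \<open>l\<close> the floors, for the roundings of the servers, whose sum then
  deviates only by about \<open>sqrt k\<close>, and with \<open>l = 0\<close> for averages over the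
  table of coins.\<close>

lemma Pi_pmf_hoeffding:
  fixes X :: "'i \<Rightarrow> 'a \<Rightarrow> real"
  assumes fin: "finite I" "I \<noteq> {}"
    and X: "\<And>i x. i \<in> I \<Longrightarrow> x \<in> set_pmf (p i) \<Longrightarrow> l i \<le> X i x \<and> X i x \<le> l i + 1"
    and "\<tau> \<ge> 0"
  shows "measure_pmf.prob (Pi_pmf I d p)
      {\<omega>. \<tau> \<le> \<bar>(\<Sum>i\<in>I. X i (\<omega> i)) - (\<Sum>i\<in>I. measure_pmf.expectation (p i) (X i))\<bar>} \<le> 2 * exp (- 2 * \<tau>\<^sup>2 / card I)"
proof -
  let ?P = "Pi_pmf I d p"
  have comp: "measure_pmf.expectation ?P (\<lambda>\<omega>. X i (\<omega> i)) = measure_pmf.expectation (p i) (X i)" if "i \<in> I" for i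
  proof -
    have "measure_pmf.expectation (p i) (X i) = measure_pmf.expectation (map_pmf (\<lambda>f. f i) ?P) (X i)"
      using Pi_pmf_component[OF fin(1), of i d p] that by simp
    then show ?thesis by simp
  qed
  interpret Hoeffding_ineq "measure_pmf ?P" I "\<lambda>i \<omega>. X i (\<omega> i)" l "\<lambda>i. l i + 1" "\<Sum>i\<in>I. measure_pmf.expectation ?P (\<lambda>\<omega>. X i (\<omega> i))"
  proof unfold_locales
    show "prob_space.indep_vars (measure_pmf ?P) (\<lambda>_. borel) (\<lambda>i \<omega>. X i (\<omega> i)) I"
      using prob_space.indep_vars_compose2[OF measure_pmf.prob_space_axioms indep_vars_Pi_pmf[OF fin(1)], of X "\<lambda>_. borel"] by auto
    show "AE x in measure_pmf ?P. X i (x i) \<in> {l i..l i + 1}" if "i \<in> I" for i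
      using X[OF that] that set_Pi_pmf[OF fin(1), of d p]
      by (intro AE_pmfI) (auto simp: PiE_dflt_def)
  qed (use fin in auto)
  have "measure_pmf.prob ?P {\<omega>\<in>space (measure_pmf ?P). \<tau> \<le> \<bar>(\<Sum>i\<in>I. X i (\<omega> i)) - (\<Sum>i\<in>I. measure_pmf.expectation ?P (\<lambda>\<omega>. X i (\<omega> i)))\<bar>}
      \<le> 2 * exp (- 2 * \<tau>\<^sup>2 / (\<Sum>i\<in>I. (l i + 1 - l i)\<^sup>2))"
    by (rule Hoeffding_ineq_abs_ge) (use assms in \<open>auto simp: card_gt_0_iff\<close>)
  then show ?thesis by (simp add: comp cong: sum.cong)
qed

text \<open>Newman's argument for replacing public coins by an index into a fixed table.\<close>

lemma representative_sample:
  fixes \<Phi> :: "('a \<Rightarrow> real) set"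
  assumes fin: "finite \<Phi>" and bnd: "\<And>\<phi> x. \<phi> \<in> \<Phi> \<Longrightarrow> x \<in> set_pmf D \<Longrightarrow> 0 \<le> \<phi> x \<and> \<phi> x \<le> 1"
    and S: "S > 0" and \<delta>: "\<delta> \<ge> 0"
    and small: "2 * real (card \<Phi>) * exp (- 2 * S * \<delta>\<^sup>2) < 1"
  obtains \<tau> :: "nat \<Rightarrow> 'a" where "\<And>l. l < S \<Longrightarrow> \<tau> l \<in> set_pmf D"
    and "\<And>\<phi>. \<phi> \<in> \<Phi> \<Longrightarrow> \<bar>(\<Sum>l<S. \<phi> (\<tau> l)) / S - measure_pmf.expectation D \<phi>\<bar> \<le> \<delta>"
proof -
  let ?P = "Pi_pmf {..<S} undefined (\<lambda>_. D)"
  define B where "B = (\<lambda>\<phi>. {\<tau>. S * \<delta> \<le> \<bar>(\<Sum>l<S. \<phi> (\<tau> l)) - (\<Sum>l<S. measure_pmf.expectation D \<phi>)\<bar>})"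
  have "measure_pmf.prob ?P (\<Union>(B ` \<Phi>)) \<le> (\<Sum>\<phi>\<in>\<Phi>. measure_pmf.prob ?P (B \<phi>))"
    by (rule measure_pmf.finite_measure_subadditive_finite) (use fin in auto)
  also have "\<dots> \<le> (\<Sum>\<phi>\<in>\<Phi>. 2 * exp (- 2 * S * \<delta>\<^sup>2))"
  proof (intro sum_mono)
    fix \<phi> assume \<phi>: "\<phi> \<in> \<Phi>"
    have "measure_pmf.prob ?P (B \<phi>) \<le> 2 * exp (- 2 * (S * \<delta>)\<^sup>2 / card {..<S})"
      unfolding B_def by (rule Pi_pmf_hoeffding[where l="\<lambda>_. 0"]) (use S \<delta> bnd[OF \<phi>] in \<open>auto simp: lessThan_empty_iff\<close>)
    also have "- 2 * (S * \<delta>)\<^sup>2 / card {..<S} = - 2 * S * \<delta>\<^sup>2" using S by (simp add: power2_eq_square field_simps)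
    finally show "measure_pmf.prob ?P (B \<phi>) \<le> 2 * exp (- 2 * S * \<delta>\<^sup>2)" .
  qed
  also have "\<dots> < 1" using small by simp
  finally have lt: "measure_pmf.prob ?P (\<Union>(B ` \<Phi>)) < 1" .
  \<comment> \<open>The table is sought inside the support, not merely outside the bad set:
    \<open>est_zero\<close> later needs every entry to be a possible coin.\<close>
  have "\<not> set_pmf ?P \<subseteq> \<Union>(B ` \<Phi>)"
  proof
    assume "set_pmf ?P \<subseteq> \<Union>(B ` \<Phi>)"
    then have "measure_pmf.prob ?P (\<Union>(B ` \<Phi>)) = 1"
      by (subst measure_pmf.prob_eq_1) (auto intro!: AE_pmfI)
    with lt show False by simp
  qed
  then obtain \<tau> where \<tau>: "\<tau> \<in> set_pmf ?P" "\<tau> \<notin> \<Union>(B ` \<Phi>)" by blast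
  show thesis
  proof (rule that)
    show "\<tau> l \<in> set_pmf D" if "l < S" for l
      using \<tau>(1) that by (simp add: set_Pi_pmf PiE_dflt_def)
    show "\<bar>(\<Sum>l<S. \<phi> (\<tau> l)) / S - measure_pmf.expectation D \<phi>\<bar> \<le> \<delta>" if "\<phi> \<in> \<Phi>" for \<phi>
    proof -
      let ?s = "\<Sum>l<S. \<phi> (\<tau> l)" and ?e = "measure_pmf.expectation D \<phi>"
      have "\<bar>?s - S * ?e\<bar> \<le> S * \<delta>" using \<tau>(2) that by (auto simp: B_def)
      moreover have "?s / S - ?e = (?s - S * ?e) / S" using S by (simp add: field_simps)
      ultimately show ?thesis using S by (simp add: abs_divide field_simps)
    qed
  qed
qed

text \<open>All messages get the same positive length, so that bits are \<open>W\<close> times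
  messages and no message looks like silence, which is the empty list.\<close>

lemma fixed_length_code:
  assumes "finite A" "card A \<le> 2 ^ W"
  obtains f :: "'a \<Rightarrow> bool list" where "inj_on f A" "\<And>a. length (f a) = W"
proof -
  let ?B = "{xs :: bool list. set xs \<subseteq> UNIV \<and> length xs = W}"
  have "finite ?B" "card ?B = 2 ^ W"
    using finite_lists_length_eq[of "UNIV :: bool set" W] card_lists_length_eq[of "UNIV :: bool set" W] by auto
  then obtain f where f: "f ` A \<subseteq> ?B" "inj_on f A"
    using card_le_inj[of A ?B] assms by auto
  \<comment> \<open>Padding outside \<open>A\<close> makes the length unconditional: bits can be
    counted without checking that a message is a legal code word.\<close>
  let ?f = "\<lambda>a. if a \<in> A then f a else replicate W True"
  have "inj_on ?f A" using f(2) by (auto simp: inj_on_def)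
  moreover have "length (?f a) = W" for a using f(1) by auto
  ultimately show thesis by (rule that)
qed

section \<open>Monitoring with two phases per item\<close>

definition counts :: "(nat \<times> nat) list \<Rightarrow> nat \<Rightarrow> nat \<Rightarrow> nat" where
  "counts s j i = count_list s (j, i)"

lemma counts_Nil [simp]: "counts [] = (\<lambda>_ _. 0)"
  by (simp add: counts_def fun_eq_iff)

lemma counts_snoc: "counts (s @ [(j, i)]) = (counts s)(j := (counts s j)(i := Suc (counts s j i)))"
  by (auto simp: counts_def fun_eq_iff)

lemma counts_le_length: "counts s j i \<le> length s"
  by (simp add: counts_def count_le_length)

lemma counts_take_le: "a \<le> b \<Longrightarrow> counts (take a s) j i \<le> counts (take b s) j i"
proof -
  assume "a \<le> b"
  then have "take b s = take a s @ take (b - a) (drop a s)" by (metis le_add_diff_inverse take_add)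
  then show ?thesis by (simp add: counts_def)
qed

text \<open>
  A message of the coordinator is either \<open>None\<close>, which silences the servers for good, or
  \<open>Some (i, \<phi>, r)\<close>: the classes of item \<open>i\<close> are in the phases \<open>\<phi>\<close>, and only classes of level at
  least \<open>r\<close> are still monitored.
\<close>

type_synonym 'c announcement = "(nat \<times> ('c \<Rightarrow> nat) \<times> nat) option"

text \<open>Protocols are functions of histories; these states are recovered by folding over a
  history. \<open>srv_out\<close> is the message due after the last event. \<open>srv_ph\<close> and
  \<open>srv_lev\<close> mirror what the coordinator believes, not the truth.\<close>

record 'c server_state =
  srv_coin :: "nat option"
  srv_cnt :: "nat \<Rightarrow> nat"
  srv_ph :: "nat \<Rightarrow> 'c \<Rightarrow> nat"
  srv_lev :: nat
  srv_off :: bool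
  srv_out :: "bool list"

text \<open>\<open>crd_len\<close> counts messages received and \<open>crd_nb\<close> announcements
  of phases, the two numbers tested against the cap. In \<open>crd_out\<close>, the outer
  \<open>None\<close> is silence, while \<open>Some None\<close> stops the servers.\<close>

record 'c coord_state =
  crd_cnt :: "nat \<Rightarrow> nat \<Rightarrow> nat"
  crd_len :: nat
  crd_nb :: nat
  crd_off :: bool
  crd_out :: "'c announcement option"

section \<open>Effect of a coordinator step: silence or broadcast\<close>

lemma coord_step_silent:
  assumes "\<And>j. j < k \<Longrightarrow> coord_msg P (\<omega> k) (coord_view c) j = []"
  shows "coord_step P k \<omega> c = c"
proof -
  have "fold (\<lambda>j c'. let m = coord_msg P (\<omega> k) (coord_view c') j
                 in if m = [] then c'
                    else server_step P \<omega> j (Received m) (c'\<lparr>bits := bits c' + length m\<rparr>)) [0..<q] c = c" if "q \<le> k" for q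
    using that by (induction q) (auto simp: assms)
  then show ?thesis unfolding coord_step_def by blast
qed

text \<open>Replies only join \<open>pending\<close>, so the coordinator's view stays fixed during
  the loop over the recipients and all of them are sent the same message.\<close>

lemma coord_step_broadcast:
  assumes m: "\<And>j. j < k \<Longrightarrow> coord_msg P (\<omega> k) (coord_view c) j = m" "m \<noteq> []"
  defines "reply \<equiv> \<lambda>j. server_msg P j (\<omega> j) (server_view c j @ [Received m])"
  shows "server_view (coord_step P k \<omega> c) = (\<lambda>j. if j < k then server_view c j @ [Received m] else server_view c j)" (is ?A)
    and "coord_view (coord_step P k \<omega> c) = coord_view c" (is ?B)
    and "pending (coord_step P k \<omega> c)
      = pending c @ concat (map (\<lambda>j. if reply j = [] then [] else [(j, reply j)]) [0..<k])" (is ?C)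
    and "bits (coord_step P k \<omega> c) = bits c + k * length m + (\<Sum>j<k. length (reply j))" (is ?D)
proof -
  define f where "f = (\<lambda>j c'. let m = coord_msg P (\<omega> k) (coord_view c') j
                 in if m = [] then c'
                    else server_step P \<omega> j (Received m) (c'\<lparr>bits := bits c' + length m\<rparr>))"
  have "server_view (fold f [0..<q] c) = (\<lambda>j. if j < q then server_view c j @ [Received m] else server_view c j)
    \<and> coord_view (fold f [0..<q] c) = coord_view c
    \<and> pending (fold f [0..<q] c) = pending c @ concat (map (\<lambda>j. if reply j = [] then [] else [(j, reply j)]) [0..<q])
    \<and> bits (fold f [0..<q] c) = bits c + q * length m + (\<Sum>j<q. length (reply j))" if "q \<le> k" for q
    using that
  proof (induction q)
    case (Suc q)
    define d where "d = fold f [0..<q] c"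
    have IH: "server_view d = (\<lambda>j. if j < q then server_view c j @ [Received m] else server_view c j)"
      "coord_view d = coord_view c"
      "pending d = pending c @ concat (map (\<lambda>j. if reply j = [] then [] else [(j, reply j)]) [0..<q])"
      "bits d = bits c + q * length m + (\<Sum>j<q. length (reply j))"
      using Suc by (auto simp: d_def)
    have "fold f [0..<Suc q] c = f q d" by (simp add: d_def)
    also have "\<dots> = server_step P \<omega> q (Received m) (d\<lparr>bits := bits d + length m\<rparr>)"
      using Suc.prems m by (simp add: f_def IH Let_def)
    finally show ?case
      by (auto simp: server_step_def Let_def IH reply_def fun_eq_iff less_Suc_eq)
  qed auto
  from this[of k] show ?A ?B ?C ?D by (auto simp: coord_step_def f_def)
qed

lemma settle_reached:
  assumes "pending ((deliver P k \<omega> ^^ q) c) = []"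
  shows "\<exists>q. settle P k \<omega> c = (deliver P k \<omega> ^^ q) c \<and> pending (settle P k \<omega> c) = []"
  unfolding settle_def using LeastI[of "\<lambda>r. pending ((deliver P k \<omega> ^^ r) c) = []", OF assms] by blast

text \<open>
  The counters of a class are monitored in two phases. In phase \<open>h < 2\<close> server \<open>j\<close> reports item \<open>i\<close>
  whenever its counter \<open>g l c h j i\<close> (a step function of the local count) changes, and the
  phase ends when the sum of the counters reaches \<open>thr h\<close>.
\<close>

locale monitor_base =
  fixes k :: nat and thr :: "nat \<Rightarrow> nat"
    and g :: "'l \<Rightarrow> 'c \<Rightarrow> nat \<Rightarrow> nat \<Rightarrow> nat \<Rightarrow> nat \<Rightarrow> nat"
begin

definition tot :: "'l \<Rightarrow> 'c \<Rightarrow> nat \<Rightarrow> nat \<Rightarrow> (nat \<Rightarrow> nat \<Rightarrow> nat) \<Rightarrow> nat" where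
  "tot l c h i x = (\<Sum>j<k. g l c h j i (x j i))"

text \<open>A function of the counts rather than of the history, so that the phases at true and at
  outdated counts can be compared. A phase may be skipped.\<close>

definition ph :: "'l \<Rightarrow> 'c \<Rightarrow> nat \<Rightarrow> (nat \<Rightarrow> nat \<Rightarrow> nat) \<Rightarrow> nat" where
  "ph l c i x = (if tot l c 0 i x < thr 0 then 0 else if tot l c 1 i x < thr 1 then 1 else 2)"

lemma ph_le: "ph l c i x \<le> 2"
  by (simp add: ph_def)

lemma ph_cong: "(\<And>j. j < k \<Longrightarrow> x j i = y j i) \<Longrightarrow> ph l c i x = ph l c i y"
  by (simp add: ph_def tot_def)

end

text \<open>Classes below the level \<open>rs\<close> are no longer monitored.
  \<open>rs_cong\<close> requires that the classes still monitored determine whether the level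
  moves; otherwise the coordinator could miss a change that nobody reports.\<close>

locale monitor_levels = monitor_base k thr g for k thr and g :: "'l \<Rightarrow> 'c \<Rightarrow> nat \<Rightarrow> nat \<Rightarrow> nat \<Rightarrow> nat \<Rightarrow> nat" +
  fixes n RL :: nat and C :: "'c set" and lev :: "'c \<Rightarrow> nat" and rs :: "'l \<Rightarrow> (nat \<Rightarrow> nat \<Rightarrow> nat) \<Rightarrow> nat"
  assumes finC: "finite C"
    and g_mono: "\<And>l c h j i v v'. v \<le> v' \<Longrightarrow> g l c h j i v \<le> g l c h j i v'"
    and g_two: "\<And>l c j i v. g l c 2 j i v = 0"
    and rs_mono: "\<And>l x y. (\<And>j i. x j i \<le> y j i) \<Longrightarrow> rs l x \<le> rs l y"
    and rs_le: "\<And>l x. rs l x \<le> RL"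
    and rs_cong: "\<And>l x y. (\<And>j i. x j i \<le> y j i) \<Longrightarrow>
        (\<And>c i. c \<in> C \<Longrightarrow> i < n \<Longrightarrow> rs l x \<le> lev c \<Longrightarrow> ph l c i x = ph l c i y) \<Longrightarrow> rs l y = rs l x"
begin

lemma tot_mono: "(\<And>j. x j i \<le> y j i) \<Longrightarrow> tot l c h i x \<le> tot l c h i y"
  unfolding tot_def by (intro sum_mono g_mono)

lemma ph_mono: "(\<And>j. x j i \<le> y j i) \<Longrightarrow> ph l c i x \<le> ph l c i y"
  using tot_mono[of x i y l c 0] tot_mono[of x i y l c 1] by (auto simp: ph_def)

text \<open>Silence is informative: while no counter of the current phase changes, its total stays
  put, and with it the phase, by monotonicity of the totals.\<close>

lemma ph_eq_if_tot_eq: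
  assumes le: "\<And>j. x j i \<le> y j i" and eq: "\<And>j. j < k \<Longrightarrow> g l c (ph l c i x) j i (x j i) = g l c (ph l c i x) j i (y j i)"
  shows "ph l c i y = ph l c i x"
proof -
  have t: "tot l c (ph l c i x) i y = tot l c (ph l c i x) i x"
    unfolding tot_def by (intro sum.cong) (use eq in auto)
  show ?thesis using t tot_mono[of x i y l c 0, OF le] tot_mono[of x i y l c 1, OF le]
    by (auto simp: ph_def split: if_splits)
qed

text \<open>
  What can still be announced about item \<open>i\<close> and classes of level at least \<open>r\<close> when the counts are
  \<open>x\<close> and the coordinator knows \<open>X\<close>.
\<close>

definition rem :: "'l \<Rightarrow> nat \<Rightarrow> nat \<Rightarrow> (nat \<Rightarrow> nat \<Rightarrow> nat) \<Rightarrow> (nat \<Rightarrow> nat \<Rightarrow> nat) \<Rightarrow> nat" where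
  "rem l r i x X = (\<Sum>c | c \<in> C \<and> r \<le> lev c. ph l c i x - ph l c i X) + (rs l x - rs l X)"

text \<open>
  The number of messages due to an update in a run that is never stopped; an announcement accounts
  for \<open>2 * k\<close> of them, since each server answers it.
\<close>

definition inc :: "'l \<Rightarrow> (nat \<times> nat) list \<Rightarrow> nat \<times> nat \<Rightarrow> nat" where
  "inc l s u = (case u of (j, i) \<Rightarrow> let x = counts s in
     (if \<exists>c\<in>C. rs l x \<le> lev c \<and> g l c (ph l c i x) j i (Suc (x j i)) \<noteq> g l c (ph l c i x) j i (x j i) then 1 else 0) +
     2 * k * rem l (rs l x) i (counts (s @ [u])) x)"

text \<open>Independent of any protocol run, so that its distribution over the coins can be studied
  for a fixed stream; \<open>run_good\<close> relates it to actual runs.\<close>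

definition ideal_cost :: "'l \<Rightarrow> (nat \<times> nat) list \<Rightarrow> nat" where
  "ideal_cost l s = (\<Sum>t<length s. inc l (take t s) (s ! t))"

lemma ideal_cost_Nil [simp]: "ideal_cost l [] = 0"
  by (simp add: ideal_cost_def)

lemma ideal_cost_snoc: "ideal_cost l (s @ [u]) = ideal_cost l s + inc l s u"
  by (simp add: ideal_cost_def nth_append)

text \<open>Potential that pays for the messages about one item in one class. The minima express
  that a counter falls silent when its phase ends. The fine counter of phase 1 grows all along but
  is charged only after phase 0, as otherwise every small item would have to pay for it.\<close>

definition pot :: "'l \<Rightarrow> 'c \<Rightarrow> nat \<Rightarrow> (nat \<Rightarrow> nat \<Rightarrow> nat) \<Rightarrow> nat" where
  "pot l c i x = min (tot l c 0 i x) (thr 0) + (if ph l c i x = 0 then 0 else min (tot l c 1 i x) (thr 1)) + 2 * k * ph l c i x"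

lemma pot_mono:
  assumes "\<And>j. x j i \<le> y j i"
  shows "pot l c i x \<le> pot l c i y"
proof -
  have "min (tot l c h i x) (thr h) \<le> min (tot l c h i y) (thr h)" for h
    using tot_mono[of x i y l c h, OF assms] by linarith
  moreover have "ph l c i x \<le> ph l c i y" by (rule ph_mono) (rule assms)
  ultimately show ?thesis unfolding pot_def
    by (intro add_mono mult_le_mono2) (auto intro: add_mono)
qed

lemma pot_step:
  assumes x: "x' = x(j := (x j)(i := Suc (x j i)))" and j: "j < k"
  shows "pot l c i x + 2 * k * (ph l c i x' - ph l c i x) +
    (if g l c (ph l c i x) j i (Suc (x j i)) \<noteq> g l c (ph l c i x) j i (x j i) then 1 else 0) \<le> pot l c i x'"
proof -
  have le: "x j' i \<le> x' j' i" for j' by (simp add: x)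
  have phm: "ph l c i x \<le> ph l c i x'" by (rule ph_mono) (rule le)
  have t: "tot l c h i x \<le> tot l c h i x'" for h by (rule tot_mono) (rule le)
  have ts: "tot l c h i x < tot l c h i x'" if "g l c h j i (Suc (x j i)) \<noteq> g l c h j i (x j i)" for h
  proof -
    have "g l c h j i (x j i) < g l c h j i (x' j i)" using that g_mono[of "x j i" "Suc (x j i)" l c h j i] by (simp add: x)
    then show ?thesis unfolding tot_def by (intro sum_strict_mono_ex1) (auto intro!: g_mono le j)
  qed
  have e: "2 * k * ph l c i x + 2 * k * (ph l c i x' - ph l c i x) = 2 * k * ph l c i x'"
    using phm by (simp add: add_mult_distrib2[symmetric])
  let ?s = "g l c (ph l c i x) j i (Suc (x j i)) \<noteq> g l c (ph l c i x) j i (x j i)"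
  \<comment> \<open>Before the last phase the current total is still below its threshold, so a
    changed counter strictly raises the minimum in \<open>pot\<close>; in phase 2 no counter
    changes.\<close>
  consider "ph l c i x = 0" "tot l c 0 i x < thr 0" | "ph l c i x = 1" "tot l c 1 i x < thr 1" | "ph l c i x = 2"
    by (cases "tot l c 0 i x < thr 0"; cases "tot l c 1 i x < thr 1") (auto simp: ph_def)
  then have "min (tot l c 0 i x) (thr 0) + (if ph l c i x = 0 then 0 else min (tot l c 1 i x) (thr 1)) + (if ?s then 1 else 0)
    \<le> min (tot l c 0 i x') (thr 0) + (if ph l c i x' = 0 then 0 else min (tot l c 1 i x') (thr 1))"
  proof cases
    case 1
    then show ?thesis using ts[of 0] t[of 0] by auto
  next
    case 2
    then show ?thesis using ts[of 1] t[of 1] t[of 0] phm by auto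
  next
    case 3
    then show ?thesis using t[of 1] t[of 0] phm by (auto simp: g_two)
  qed
  moreover define a where "a x = min (tot l c 0 i x) (thr 0) + (if ph l c i x = 0 then 0 else min (tot l c 1 i x) (thr 1))" for x
  ultimately have "a x + (if ?s then 1 else 0) \<le> a x'" unfolding a_def by blast
  moreover have "pot l c i x = a x + 2 * k * ph l c i x" "pot l c i x' = a x' + 2 * k * ph l c i x'"
    by (simp_all add: pot_def a_def)
  ultimately show ?thesis using e by linarith
qed

text \<open>Classes below the level send nothing, so their potential may be taken at any monotone
  counts \<open>y c\<close>, in particular at frozen ones. This keeps classes of small scale from
  being charged for the whole stream.\<close>

lemma inc_le:
  assumes u: "j < k" "i < n" and x: "x = counts s" "x' = counts (s @ [(j, i)])"
    and y: "\<And>c. c \<in> C \<Longrightarrow> rs l x \<le> lev c \<Longrightarrow> y c = x \<and> y' c = x'"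
    and yy: "\<And>c j i. y c j i \<le> y' c j i"
  shows "inc l s (j, i) + (\<Sum>c\<in>C. \<Sum>i<n. pot l c i (y c)) + 2 * k * rs l x \<le> (\<Sum>c\<in>C. \<Sum>i<n. pot l c i (y' c)) + 2 * k * rs l x'"
proof -
  have x': "x' = x(j := (x j)(i := Suc (x j i)))" by (simp add: x counts_snoc)
  define A where "A = {c \<in> C. rs l x \<le> lev c}"
  define sg where "sg c = (if c \<in> A \<and> g l c (ph l c i x) j i (Suc (x j i)) \<noteq> g l c (ph l c i x) j i (x j i) then 1 else 0::nat)" for c
  define d where "d c = (if c \<in> A then ph l c i x' - ph l c i x else 0)" for c
  have "rs l x \<le> rs l x'" by (rule rs_mono) (simp add: x')
  then have rsd: "2 * k * rs l x + 2 * k * (rs l x' - rs l x) = 2 * k * rs l x'"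
    by (simp add: add_mult_distrib2[symmetric])
  have 1: "(\<Sum>i<n. pot l c i (y c)) + 2 * k * d c + sg c \<le> (\<Sum>i<n. pot l c i (y' c))" if c: "c \<in> C" for c
  proof (cases "c \<in> A")
    case True
    then have yc: "y c = x" "y' c = x'" using y c by (auto simp: A_def)
    have "(\<Sum>i<n. pot l c i x) = pot l c i x + (\<Sum>i'\<in>{..<n}-{i}. pot l c i' x)"
      using u by (subst sum.remove[of _ i]) auto
    moreover have "(\<Sum>i<n. pot l c i x') = pot l c i x' + (\<Sum>i'\<in>{..<n}-{i}. pot l c i' x')"
      using u by (subst sum.remove[of _ i]) auto
    moreover have "(\<Sum>i'\<in>{..<n}-{i}. pot l c i' x) \<le> (\<Sum>i'\<in>{..<n}-{i}. pot l c i' x')"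
      by (intro sum_mono pot_mono) (simp add: x')
    ultimately show ?thesis using pot_step[OF x' u(1), of l c] True by (simp add: yc d_def sg_def)
  next
    case False
    then show ?thesis by (simp add: d_def sg_def sum_mono pot_mono yy)
  qed
  have "(\<Sum>c\<in>C. \<Sum>i<n. pot l c i (y c)) + 2 * k * (\<Sum>c\<in>C. d c) + (\<Sum>c\<in>C. sg c) \<le> (\<Sum>c\<in>C. \<Sum>i<n. pot l c i (y' c))"
    unfolding sum_distrib_left sum.distrib[symmetric] by (rule sum_mono) (rule 1)
  moreover have "(\<Sum>c\<in>C. d c) = (\<Sum>c | c \<in> C \<and> rs l x \<le> lev c. ph l c i x' - ph l c i x)"
    unfolding d_def A_def[symmetric] using finC by (subst sum.inter_restrict[symmetric]) (auto simp: A_def Int_def intro!: sum.cong)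
  moreover have "(if \<exists>c\<in>C. rs l x \<le> lev c \<and> g l c (ph l c i x) j i (Suc (x j i)) \<noteq> g l c (ph l c i x) j i (x j i) then 1 else 0)
     \<le> (\<Sum>c\<in>C. sg c)"
  proof (cases "\<exists>c\<in>C. rs l x \<le> lev c \<and> g l c (ph l c i x) j i (Suc (x j i)) \<noteq> g l c (ph l c i x) j i (x j i)")
    case True
    then obtain c where "c \<in> C" "sg c = 1" by (auto simp: sg_def A_def)
    then show ?thesis using member_le_sum[of c C sg] finC by auto
  next
    case False
    show ?thesis unfolding if_not_P[OF False] by (rule le0)
  qed
  ultimately show ?thesis using rsd
    by (simp add: inc_def rem_def Let_def x[symmetric] add_mult_distrib2)
qed

text \<open>\<open>T c\<close> is a time from which class \<open>c\<close> is not monitored; its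
  counts are frozen there and the increments telescope.\<close>

lemma ideal_cost_le:
  assumes s: "valid_stream n k s" and T: "\<And>c t. c \<in> C \<Longrightarrow> t < length s \<Longrightarrow> rs l (counts (take t s)) \<le> lev c \<Longrightarrow> t < T c"
  shows "ideal_cost l s \<le> (\<Sum>c\<in>C. \<Sum>i<n. pot l c i (counts (take (T c) s))) + 2 * k * RL"
proof -
  have "t \<le> length s \<Longrightarrow> ideal_cost l (take t s)
     \<le> (\<Sum>c\<in>C. \<Sum>i<n. pot l c i (counts (take (min t (T c)) s))) + 2 * k * rs l (counts (take t s))" for t
  proof (induction t)
    case (Suc t)
    obtain j i where u: "s ! t = (j, i)" by force
    have "(j, i) \<in> set s" using Suc.prems u by (metis Suc_le_lessD nth_mem)
    then have ji: "j < k" "i < n" using s by (auto simp: valid_stream_def)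
    have tk: "take (Suc t) s = take t s @ [(j, i)]" using Suc.prems u by (simp add: take_Suc_conv_app_nth)
    have "inc l (take t s) (j, i) + (\<Sum>c\<in>C. \<Sum>i<n. pot l c i (counts (take (min t (T c)) s))) + 2 * k * rs l (counts (take t s))
      \<le> (\<Sum>c\<in>C. \<Sum>i<n. pot l c i (counts (take (min (Suc t) (T c)) s))) + 2 * k * rs l (counts (take (Suc t) s))"
    proof (rule inc_le[OF ji refl])
      fix c assume c: "c \<in> C" "rs l (counts (take t s)) \<le> lev c"
      then have "t < T c" using T Suc.prems by simp
      then show "counts (take (min t (T c)) s) = counts (take t s) \<and>
          counts (take (min (Suc t) (T c)) s) = counts (take (Suc t) s)" by (simp add: min_def)
    qed (use tk in \<open>auto intro!: counts_take_le\<close>)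
    then show ?case using Suc unfolding tk ideal_cost_snoc by simp
  qed simp
  from this[of "length s"] have "ideal_cost l s \<le> (\<Sum>c\<in>C. \<Sum>i<n. pot l c i (counts (take (min (length s) (T c)) s))) + 2 * k * rs l (counts s)"
    by simp
  also have "\<dots> \<le> (\<Sum>c\<in>C. \<Sum>i<n. pot l c i (counts (take (T c) s))) + 2 * k * RL"
    using rs_le by (intro add_mono sum_mono pot_mono counts_take_le mult_le_mono2) auto
  finally show ?thesis .
qed

text \<open>Separates the cheap reports of all items from the few items that leave phase 0. Each of
  these costs at most \<open>thr 1\<close> reports and two phase changes, hence
  \<open>4 * k\<close>.\<close>

lemma sum_pot_le:
  "(\<Sum>i<n. pot l c i x) \<le> (\<Sum>i<n. min (tot l c 0 i x) (thr 0)) + (thr 1 + 4 * k) * card {i. i < n \<and> ph l c i x \<noteq> 0}"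
proof -
  have "pot l c i x \<le> min (tot l c 0 i x) (thr 0) + (if ph l c i x \<noteq> 0 then thr 1 + 4 * k else 0)" for i
  proof -
    have *: "2 * k * ph l c i x \<le> 4 * k" using mult_le_mono2[OF ph_le, of "2 * k" l c i x] by linarith
    have "(if ph l c i x = 0 then 0 else min (tot l c 1 i x) (thr 1)) + 2 * k * ph l c i x
      \<le> (if ph l c i x \<noteq> 0 then thr 1 + 4 * k else 0)"
    proof (cases "ph l c i x = 0")
      case False
      have "min (tot l c 1 i x) (thr 1) + 2 * k * ph l c i x \<le> thr 1 + 4 * k"
        using * by (intro add_mono) auto
      then show ?thesis using False by presburger
    qed simp
    then show ?thesis unfolding pot_def add.assoc by (rule add_left_mono)
  qed
  then have "(\<Sum>i<n. pot l c i x) \<le> (\<Sum>i<n. min (tot l c 0 i x) (thr 0) + (if ph l c i x \<noteq> 0 then thr 1 + 4 * k else 0))"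
    by (rule sum_mono)
  also have "\<dots> = (\<Sum>i<n. min (tot l c 0 i x) (thr 0)) + (thr 1 + 4 * k) * card {i. i < n \<and> ph l c i x \<noteq> 0}"
    by (simp add: sum.distrib sum.If_cases Int_def lessThan_def mult.commute)
  finally show ?thesis .
qed

end

text \<open>The first argument of \<open>g\<close>, \<open>rs\<close> and \<open>est\<close> is now
  an index below \<open>S\<close> into a table of coins. \<open>est_cong\<close> lets the estimate
  use only what reports keep up to date: the level, and the phases and current counters of the
  classes still monitored.\<close>

locale monitor = monitor_levels k thr g n RL C lev rs
  for k thr and g :: "nat \<Rightarrow> 'c \<Rightarrow> nat \<Rightarrow> nat \<Rightarrow> nat \<Rightarrow> nat \<Rightarrow> nat" and n RL C lev rs +
  fixes N S W cap :: nat and est :: "nat \<Rightarrow> (nat \<Rightarrow> nat \<Rightarrow> nat) \<Rightarrow> real"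
    and encL :: "nat \<Rightarrow> bool list" and encR :: "nat \<times> nat \<Rightarrow> bool list" and encB :: "'c announcement \<Rightarrow> bool list"
  assumes k: "k \<ge> 1" and S: "S > 0" and W: "W > 0"
    and encL: "inj_on encL {..<S}" "\<And>l. length (encL l) = W"
    and encR: "inj_on encR ({..<n} \<times> {..N})" "\<And>u. length (encR u) = W"
    and encB: "inj_on encB (insert None (Some ` ({..<n} \<times> (C \<rightarrow>\<^sub>E {..2}) \<times> {..RL})))" "\<And>w. length (encB w) = W"
    and est_cong: "\<And>l x s. valid_stream n k s \<Longrightarrow> length s \<le> N \<Longrightarrow> (\<And>j i. x j i \<le> counts s j i) \<Longrightarrow>
        rs l x = rs l (counts s) \<Longrightarrow>
        (\<And>c i. c \<in> C \<Longrightarrow> i < n \<Longrightarrow> rs l x \<le> lev c \<Longrightarrow> ph l c i x = ph l c i (counts s) \<and>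
           (\<forall>j<k. g l c (ph l c i x) j i (x j i) = g l c (ph l c i x) j i (counts s j i))) \<Longrightarrow>
        est l x = est l (counts s)"
begin

abbreviation "Z0 \<equiv> \<lambda>(_::nat) (_::nat). 0::nat"

definition "words = insert None (Some ` ({..<n} \<times> (C \<rightarrow>\<^sub>E {..2}) \<times> {..RL}))"

definition "decL = inv_into {..<S} encL"
definition "decR = inv_into ({..<n} \<times> {..N}) encR"
definition "decB = inv_into words encB"

text \<open>One report of the exact count serves all classes. The first message received is the
  coin. An announcement of phases is always answered, because the counters of a newly entered phase
  were not reported before and the coordinator's counts may disagree with them.\<close>

definition sstep :: "nat \<Rightarrow> server_event \<Rightarrow> 'c server_state \<Rightarrow> 'c server_state" where
  "sstep j e st = (case e of
     Update i \<Rightarrow>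
       let v = srv_cnt st i; v' = Suc v; l = the (srv_coin st) in
       st\<lparr>srv_cnt := (srv_cnt st)(i := v'),
          srv_out :=
            (if \<not> srv_off st \<and> (\<exists>c\<in>C. srv_lev st \<le> lev c \<and>
                  g l c (srv_ph st i c) j i v' \<noteq> g l c (srv_ph st i c) j i v)
             then encR (i, v') else [])\<rparr>
   | Received m \<Rightarrow>
       (case srv_coin st of
          None \<Rightarrow> st\<lparr>srv_coin := Some (decL m), srv_ph := (\<lambda>i c. ph (decL m) c i Z0), srv_lev := rs (decL m) Z0, srv_out := []\<rparr>
        | Some l \<Rightarrow>
            (case decB m of
               None \<Rightarrow> st\<lparr>srv_off := True, srv_out := []\<rparr>
             | Some (i, \<phi>, r) \<Rightarrow>
                 st\<lparr>srv_ph := (srv_ph st)(i := \<phi>), srv_lev := r, srv_out := encR (i, srv_cnt st i)\<rparr>)))"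

definition sst :: "nat \<Rightarrow> server_event list \<Rightarrow> 'c server_state" where
  "sst j v = fold (sstep j) v
     \<lparr>srv_coin = None, srv_cnt = (\<lambda>_. 0), srv_ph = (\<lambda>_ _. 0), srv_lev = 0, srv_off = False, srv_out = []\<rparr>"

text \<open>The cap is tested before an announcement is made, which bounds the communication for
  every seed. \<open>restrict\<close> makes the announced phases an extensional function, so that
  only finitely many words need codes.\<close>

definition cstep :: "nat \<Rightarrow> nat \<times> bool list \<Rightarrow> 'c coord_state \<Rightarrow> 'c coord_state" where
  "cstep l q st = (case q of (j, m) \<Rightarrow> case decR m of (i, v) \<Rightarrow>
     let x = crd_cnt st; x' = x(j := (x j)(i := v)); st' = st\<lparr>crd_cnt := x', crd_len := Suc (crd_len st)\<rparr> in
     if crd_off st then st'\<lparr>crd_out := None\<rparr>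
     else if cap \<le> Suc (crd_len st) + k * crd_nb st then st'\<lparr>crd_off := True, crd_out := Some None\<rparr>
     else if rs l x' \<noteq> rs l x \<or> (\<exists>c\<in>C. rs l x \<le> lev c \<and> ph l c i x' \<noteq> ph l c i x)
       then st'\<lparr>crd_nb := Suc (crd_nb st), crd_out := Some (Some (i, restrict (\<lambda>c. ph l c i x') C, rs l x'))\<rparr>
     else st'\<lparr>crd_out := None\<rparr>)"

definition cst :: "nat \<Rightarrow> (nat \<times> bool list) list \<Rightarrow> 'c coord_state" where
  "cst l H = fold (cstep l) H \<lparr>crd_cnt = Z0, crd_len = 0, crd_nb = 0, crd_off = False, crd_out = None\<rparr>"

text \<open>The coordinator's view is empty only at its initial evaluation, which serves to
  broadcast the index of the coin. Servers draw nothing.\<close>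

definition proto :: protocol where
  "proto =
     \<lparr>seed_dist = (\<lambda>j. if j = k then pmf_of_set {..<S} else return_pmf 0),
      server_msg = (\<lambda>j _ v. srv_out (sst j v)),
      coord_msg = (\<lambda>l H _. if H = [] then encL l else (case crd_out (cst l H) of None \<Rightarrow> [] | Some w \<Rightarrow> encB w)),
      coord_estimate = (\<lambda>l H. est l (crd_cnt (cst l H)))\<rparr>"

lemma sst_snoc: "sst j (v @ [e]) = sstep j e (sst j v)"
  by (simp add: sst_def)

lemma cst_snoc: "cst l (H @ [q]) = cstep l q (cst l H)"
  by (simp add: cst_def)

lemma decL: "l < S \<Longrightarrow> decL (encL l) = l"
  unfolding decL_def by (rule inv_into_f_f) (use encL in auto)

lemma decR: "i < n \<Longrightarrow> v \<le> N \<Longrightarrow> decR (encR (i, v)) = (i, v)"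
  unfolding decR_def by (rule inv_into_f_f) (use encR in auto)

lemma decB: "w \<in> words \<Longrightarrow> decB (encB w) = w"
  unfolding decB_def words_def by (rule inv_into_f_f) (use encB in auto)

lemma enc_nonempty [simp]: "encL l \<noteq> []" "encR u \<noteq> []" "encB w \<noteq> []"
  using encL(2)[of l] encR(2)[of u] encB(2)[of w] W by auto

definition agree :: "nat \<Rightarrow> (nat \<Rightarrow> nat \<Rightarrow> nat) \<Rightarrow> (nat \<Rightarrow> nat \<Rightarrow> nat) \<Rightarrow> nat \<Rightarrow> nat \<Rightarrow> bool" where
  "agree l X x j i \<longleftrightarrow> (\<forall>c\<in>C. rs l X \<le> lev c \<longrightarrow> g l c (ph l c i X) j i (X j i) = g l c (ph l c i X) j i (x j i))"

definition srv_ok :: "nat \<Rightarrow> (nat \<Rightarrow> nat \<Rightarrow> nat) \<Rightarrow> bool \<Rightarrow> (nat \<Rightarrow> nat) \<Rightarrow> 'c server_state \<Rightarrow> bool" where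
  "srv_ok l X off xj \<sigma> \<longleftrightarrow> srv_coin \<sigma> = Some l \<and> srv_cnt \<sigma> = xj \<and> srv_off \<sigma> = off \<and>
     (\<not> off \<longrightarrow> srv_lev \<sigma> = rs l X \<and> (\<forall>i<n. \<forall>c\<in>C. rs l X \<le> lev c \<longrightarrow> srv_ph \<sigma> i c = ph l c i X))"

text \<open>
  The coordinator's outdated counts \<open>X\<close> are harmless as long as they \<open>agree\<close> with the true counts \<open>x\<close>
  on the counters of the current phases; where they do not, a report of the true count is pending.
\<close>

definition inv_run :: "nat \<Rightarrow> (nat \<Rightarrow> nat \<Rightarrow> nat) \<Rightarrow> config \<Rightarrow> bool" where
  "inv_run l x c \<longleftrightarrow> (let st = cst l (coord_view c); X = crd_cnt st; off = crd_off st; q = length (pending c) in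
     (\<forall>j<k. srv_ok l X off (x j) (sst j (server_view c j))) \<and>
     (\<forall>j m. (j, m) \<in> set (pending c) \<longrightarrow> j < k \<and> (\<exists>i<n. m = encR (i, x j i))) \<and>
     bits c = W * (k + crd_len st + q + k * crd_nb st + (if off then k else 0)) \<and>
     crd_len st + q + k * crd_nb st \<le> 2 * cap + 2 * k + 2 \<and>
     (\<not> off \<longrightarrow> crd_len st + k * crd_nb st < cap + k \<and> q \<le> 1 + k * crd_nb st \<and>
        (\<forall>j<k. \<forall>i<n. (j, encR (i, x j i)) \<in> set (pending c) \<or> agree l X x j i)) \<and>
     (\<forall>j i. X j i \<le> x j i) \<and> (\<forall>j i. x j i \<le> N))"

definition off :: "nat \<Rightarrow> config \<Rightarrow> bool" where "off l c = crd_off (cst l (coord_view c))"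
definition known :: "nat \<Rightarrow> config \<Rightarrow> nat \<Rightarrow> nat \<Rightarrow> nat" where "known l c = crd_cnt (cst l (coord_view c))"
definition cost :: "nat \<Rightarrow> config \<Rightarrow> nat" where
  "cost l c = crd_len (cst l (coord_view c)) + length (pending c) + k * crd_nb (cst l (coord_view c))"

end

section \<open>Invariants under single events of a run\<close>

lemma deliver_Nil: "pending c = [] \<Longrightarrow> deliver P k \<omega> c = c"
  by (simp add: deliver_def)

lemma settle_Nil: "pending c = [] \<Longrightarrow> settle P k \<omega> c = c"
  unfolding settle_def by (subst Least_eq_0) auto

context monitor
begin

lemma proto_simps [simp]:
  "server_msg proto j w v = srv_out (sst j v)"
  "coord_msg proto l [] j = encL l"
  "H \<noteq> [] \<Longrightarrow> coord_msg proto l H j = (case crd_out (cst l H) of None \<Rightarrow> [] | Some w \<Rightarrow> encB w)"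
  "coord_estimate proto l H = est l (crd_cnt (cst l H))"
  by (auto simp: proto_def)

lemma cst_Nil: "cst l [] = \<lparr>crd_cnt = Z0, crd_len = 0, crd_nb = 0, crd_off = False, crd_out = None\<rparr>"
  by (simp add: cst_def)

lemma initial_run:
  assumes l: "\<omega> k = l" "l < S"
  defines "c \<equiv> initial proto k \<omega>"
  shows "inv_run l Z0 c" "pending c = []" "\<not> off l c" "cost l c = 0" "known l c = Z0"
proof -
  let ?c0 = "\<lparr>server_view = (\<lambda>_. []), coord_view = [], pending = [], bits = 0\<rparr>"
  have s: "sst j [Received (encL l)] = \<lparr>srv_coin = Some l, srv_cnt = (\<lambda>_. 0), srv_ph = (\<lambda>i c. ph l c i Z0),
     srv_lev = rs l Z0, srv_off = False, srv_out = []\<rparr>" for j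
    using l by (simp add: sst_def sstep_def decL)
  have m: "coord_msg proto (\<omega> k) (coord_view ?c0) j = encL l" for j using l by simp
  let ?c1 = "coord_step proto k \<omega> ?c0"
  have c1: "server_view ?c1 = (\<lambda>j. if j < k then [Received (encL l)] else [])" "coord_view ?c1 = []"
    "pending ?c1 = []" "bits ?c1 = k * W"
    using coord_step_broadcast[of k proto \<omega> ?c0 "encL l", OF m] by (auto simp add: s encL fun_eq_iff)
  have c: "c = ?c1" unfolding c_def initial_def by (simp add: settle_Nil c1)
  show "pending c = []" "\<not> off l c" "cost l c = 0" "known l c = Z0"
    by (simp_all add: c c1 off_def cost_def known_def cst_Nil)
  show "inv_run l Z0 c"
    using k by (simp add: c inv_run_def c1 cst_Nil Let_def srv_ok_def s agree_def)
qed

text \<open>Only the count at \<open>(j, i)\<close> moves. Either a monitored counter changed there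
  and the report just queued covers the disagreement, or none did and the coordinator's old count
  still agrees.\<close>

lemma update_run:
  fixes \<omega> :: "nat \<Rightarrow> nat"
  assumes inv: "inv_run l x c" and p: "pending c = []" and j: "j < k" and i: "i < n" and N: "x j i < N"
  defines "x' \<equiv> x(j := (x j)(i := Suc (x j i)))"
  defines "c' \<equiv> server_step proto \<omega> j (Update i) c" and "X \<equiv> known l c"
  shows "inv_run l x' c'" "off l c' = off l c" "known l c' = X"
    "\<not> off l c \<Longrightarrow> cost l c' = cost l c +
       (if \<exists>c\<in>C. rs l X \<le> lev c \<and> g l c (ph l c i X) j i (Suc (x j i)) \<noteq> g l c (ph l c i X) j i (x j i) then 1 else 0)"
    "off l c \<Longrightarrow> pending c' = []"
    "\<And>q. q \<in> set (pending c') \<Longrightarrow> \<exists>j' v. q = (j', encR (i, v)) \<and> v \<le> N"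
proof -
  define st where "st = cst l (coord_view c)"
  define \<sigma> where "\<sigma> j = sst j (server_view c j)" for j
  define sig where "sig \<longleftrightarrow> \<not> crd_off st \<and> (\<exists>c\<in>C. rs l X \<le> lev c \<and> g l c (ph l c i X) j i (Suc (x j i)) \<noteq> g l c (ph l c i X) j i (x j i))"
  have X: "X = crd_cnt st" by (simp add: X_def known_def st_def)
  have I: "\<And>j. j < k \<Longrightarrow> srv_ok l X (crd_off st) (x j) (\<sigma> j)"
    "bits c = W * (k + crd_len st + k * crd_nb st + (if crd_off st then k else 0))"
    "crd_len st + k * crd_nb st \<le> 2 * cap + 2 * k + 2"
    "\<not> crd_off st \<Longrightarrow> crd_len st + k * crd_nb st < cap + k"
    "\<And>j i. \<not> crd_off st \<Longrightarrow> j < k \<Longrightarrow> i < n \<Longrightarrow> agree l X x j i"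
    "\<And>j i. X j i \<le> x j i" "\<And>j i. x j i \<le> N"
    using inv p unfolding inv_run_def Let_def st_def[symmetric] \<sigma>_def[symmetric] X[symmetric] by auto
  have ok: "srv_coin (\<sigma> j) = Some l" "srv_cnt (\<sigma> j) = x j" "srv_off (\<sigma> j) = crd_off st"
    "\<not> crd_off st \<Longrightarrow> srv_lev (\<sigma> j) = rs l X"
    "\<And>i c. \<not> crd_off st \<Longrightarrow> i < n \<Longrightarrow> c \<in> C \<Longrightarrow> rs l X \<le> lev c \<Longrightarrow> srv_ph (\<sigma> j) i c = ph l c i X"
    using I(1)[OF j] by (auto simp: srv_ok_def)
  define \<sigma>' where "\<sigma>' = sstep j (Update i) (\<sigma> j)"
  have out: "srv_out \<sigma>' = (if sig then encR (i, Suc (x j i)) else [])"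
    unfolding \<sigma>'_def sig_def sstep_def by (auto simp: ok i Let_def)
  have ok': "srv_ok l X (crd_off st) (x' j) \<sigma>'"
    using I(1)[OF j] by (auto simp: srv_ok_def \<sigma>'_def sstep_def Let_def x'_def)
  have s': "sst j (server_view c j @ [Update i]) = \<sigma>'" by (simp add: sst_snoc \<sigma>'_def \<sigma>_def)
  have c': "server_view c' = (server_view c)(j := server_view c j @ [Update i])" "coord_view c' = coord_view c"
    "pending c' = (if sig then [(j, encR (i, Suc (x j i)))] else [])" "bits c' = bits c + (if sig then W else 0)"
    unfolding c'_def server_step_def Let_def by (auto simp: s' out p encR)
  show "off l c' = off l c" "known l c' = X" by (simp_all add: off_def known_def c' X_def)
  show "\<not> off l c \<Longrightarrow> cost l c' = cost l c +
       (if \<exists>c\<in>C. rs l X \<le> lev c \<and> g l c (ph l c i X) j i (Suc (x j i)) \<noteq> g l c (ph l c i X) j i (x j i) then 1 else 0)"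
    by (auto simp: cost_def c' p off_def st_def[symmetric] sig_def)
  show "off l c \<Longrightarrow> pending c' = []" by (auto simp: c' off_def sig_def st_def)
  show "\<exists>j' v. q = (j', encR (i, v)) \<and> v \<le> N" if "q \<in> set (pending c')" for q
    using that N by (auto simp: c' split: if_splits)
  have x'N: "x' j' i' \<le> N" for j' i' using I(7)[of j' i'] N by (auto simp: x'_def)
  have Xx': "X j' i' \<le> x' j' i'" for j' i' using I(6)[of j' i'] by (auto simp: x'_def)
  have srv: "srv_ok l X (crd_off st) (x' j') (sst j' (server_view c' j'))" if "j' < k" for j'
    using I(1)[OF that] ok' by (auto simp: c' s' \<sigma>_def x'_def)
  have ag: "(j', encR (i', x' j' i')) \<in> set (pending c') \<or> agree l X x' j' i'" if "\<not> crd_off st" "j' < k" "i' < n" for j' i'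
  proof (cases "j' = j \<and> i' = i")
    case True
    then show ?thesis using I(5)[OF that] that by (auto simp: c' sig_def agree_def x'_def)
  next
    case False
    then have "x' j' i' = x j' i'" by (auto simp: x'_def)
    then show ?thesis using I(5)[OF that] by (simp add: agree_def)
  qed
  have q: "length (pending c') = (if sig then 1 else 0)" "\<And>j' m. (j', m) \<in> set (pending c') \<Longrightarrow> j' = j \<and> m = encR (i, x' j i)"
    by (auto simp: c' x'_def split: if_splits)
  have q': "\<exists>i'<n. m = encR (i', x' j' i')" if "(j', m) \<in> set (pending c')" for j' m
    using q(2)[OF that] i by blast
  show "inv_run l x' c'"
    unfolding inv_run_def Let_def c'(2) st_def[symmetric] X[symmetric]
  proof (intro conjI allI impI)
    show "bits c' = W * (k + crd_len st + length (pending c') + k * crd_nb st + (if crd_off st then k else 0))"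
      by (simp add: c'(4) I(2) q algebra_simps)
    show "crd_len st + length (pending c') + k * crd_nb st \<le> 2 * cap + 2 * k + 2"
    proof (cases "crd_off st")
      case True then show ?thesis using I(3) by (simp add: q sig_def)
    next
      case False then show ?thesis using I(4) by (simp add: q)
    qed
    show "length (pending c') \<le> 1 + k * crd_nb st" by (simp add: q)
  qed (use srv ag q q' j i I(4) Xx' x'N in auto)
qed

text \<open>A delivery without announcement merely turns a pending message into a received one, so
  the cost is unchanged. It grows by \<open>2 * k\<close> only together with a change of phase or
  level, which pays for it in \<open>good_deliver\<close>.\<close>

lemma deliver_run:
  assumes inv: "inv_run l x c" and l: "\<omega> k = l" and p: "pending c = q # qs"
  defines "c' \<equiv> deliver proto k \<omega> c" and "X \<equiv> known l c" and "X' \<equiv> known l (deliver proto k \<omega> c)"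
  shows "inv_run l x c'" "crd_len (cst l (coord_view c')) = Suc (crd_len (cst l (coord_view c)))"
    "off l c \<Longrightarrow> off l c' \<and> pending c' = qs"
    "\<lbrakk>\<not> off l c; cost l c < cap\<rbrakk> \<Longrightarrow> \<not> off l c' \<and>
       (\<exists>j i. q = (j, encR (i, x j i)) \<and> i < n \<and> X' = X(j := (X j)(i := x j i)) \<and>
         (\<forall>q'\<in>set (pending c'). q' \<in> set qs \<or> (\<exists>j'. q' = (j', encR (i, x j' i)))) \<and>
         (cost l c' = cost l c \<or>
          cost l c' = cost l c + 2 * k \<and> (rs l X' \<noteq> rs l X \<or> (\<exists>c\<in>C. rs l X \<le> lev c \<and> ph l c i X' \<noteq> ph l c i X))))"
proof -
  define st where "st = cst l (coord_view c)"
  define \<sigma> where "\<sigma> j = sst j (server_view c j)" for j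
  have X: "X = crd_cnt st" by (simp add: X_def known_def st_def)
  have I: "\<And>j. j < k \<Longrightarrow> srv_ok l X (crd_off st) (x j) (\<sigma> j)"
    "\<And>j m. (j, m) \<in> set (pending c) \<Longrightarrow> j < k \<and> (\<exists>i<n. m = encR (i, x j i))"
    "bits c = W * (k + crd_len st + length (pending c) + k * crd_nb st + (if crd_off st then k else 0))"
    "crd_len st + length (pending c) + k * crd_nb st \<le> 2 * cap + 2 * k + 2"
    "\<not> crd_off st \<Longrightarrow> crd_len st + k * crd_nb st < cap + k"
    "\<not> crd_off st \<Longrightarrow> length (pending c) \<le> 1 + k * crd_nb st"
    "\<And>j i. \<not> crd_off st \<Longrightarrow> j < k \<Longrightarrow> i < n \<Longrightarrow> (j, encR (i, x j i)) \<in> set (pending c) \<or> agree l X x j i"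
    "\<And>j i. X j i \<le> x j i" "\<And>j i. x j i \<le> N"
    using inv unfolding inv_run_def Let_def st_def[symmetric] \<sigma>_def[symmetric] X[symmetric] by auto
  obtain j i where q: "q = (j, encR (i, x j i))" "j < k" "i < n"
    using I(2)[of "fst q" "snd q"] p by (metis list.set_intros(1) prod.collapse)
  have len: "length (pending c) = Suc (length qs)" by (simp add: p)
  have Iq: "j < k" "\<exists>i<n. m = encR (i, x j i)" if "(j, m) \<in> set qs" for j m
    using I(2)[of j m] that p by auto
  define Y where "Y = X(j := (X j)(i := x j i))"
  define H where "H = coord_view c @ [q]"
  define st' where "st' = cst l H"
  define c1 where "c1 = c\<lparr>pending := qs, coord_view := H\<rparr>"
  have c1: "server_view c1 = server_view c" "coord_view c1 = H" "pending c1 = qs" "bits c1 = bits c"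
    by (simp_all add: c1_def)
  have c'1: "c' = coord_step proto k \<omega> c1" by (simp add: c'_def deliver_def p c1_def H_def)
  have Hne: "H \<noteq> []" by (simp add: H_def)
  have st'_step: "st' = cstep l q st" by (simp add: st'_def H_def cst_snoc st_def)
  have dec: "decR (encR (i, x j i)) = (i, x j i)" by (rule decR) (use q I(9) in auto)
  have Y: "crd_cnt st' = Y" "crd_len st' = Suc (crd_len st)"
    unfolding st'_step cstep_def q(1) by (auto simp: dec Let_def X Y_def)
  have Ymono: "X j' i' \<le> Y j' i'" "Y j' i' \<le> x j' i'" for j' i' using I(8)[of j' i'] by (auto simp: Y_def)
  have Yi: "i' \<noteq> i \<Longrightarrow> Y j' i' = X j' i'" for j' i' by (simp add: Y_def)
  have phYi: "i' \<noteq> i \<Longrightarrow> ph l cc i' Y = ph l cc i' X" for cc i' by (rule ph_cong) (simp add: Yi)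
  have rsY: "rs l X \<le> rs l Y" by (rule rs_mono) (rule Ymono)
  define chg where "chg \<longleftrightarrow> rs l Y \<noteq> rs l X \<or> (\<exists>c\<in>C. rs l X \<le> lev c \<and> ph l c i Y \<noteq> ph l c i X)"
  have msg: "coord_msg proto (\<omega> k) (coord_view c1) j' = (case crd_out st' of None \<Rightarrow> [] | Some w \<Rightarrow> encB w)" for j'
    using Hne l by (simp add: c1 st'_def)
  consider (off) "crd_off st" | (stop) "\<not> crd_off st" "cap \<le> Suc (crd_len st) + k * crd_nb st"
    | (quiet) "\<not> crd_off st" "\<not> cap \<le> Suc (crd_len st) + k * crd_nb st" "\<not> chg"
    | (announce) "\<not> crd_off st" "\<not> cap \<le> Suc (crd_len st) + k * crd_nb st" chg by blast
  then have "inv_run l x c' \<and> coord_view c' = H \<and> (off l c \<longrightarrow> off l c' \<and> pending c' = qs) \<and>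
    (\<not> off l c \<and> cost l c < cap \<longrightarrow> \<not> off l c' \<and>
         (\<forall>q'\<in>set (pending c'). q' \<in> set qs \<or> (\<exists>j'. q' = (j', encR (i, x j' i)))) \<and>
         (cost l c' = cost l c \<or> cost l c' = cost l c + 2 * k \<and> chg))"
  proof cases
    case off
    then have s': "crd_off st'" "crd_out st' = None" "crd_nb st' = crd_nb st"
      unfolding st'_step cstep_def q(1) by (auto simp: dec Let_def)
    have c': "c' = c1" unfolding c'1 by (rule coord_step_silent) (simp add: msg s')
    have "inv_run l x c'"
      unfolding inv_run_def Let_def c' c1 st'_def[symmetric] Y s' \<sigma>_def[symmetric]
      using I(1,3,4) Iq I(9) off Ymono(2) by (auto simp: s' p srv_ok_def \<sigma>_def[symmetric])
    then show ?thesis using off by (simp add: off_def c' c1 st_def[symmetric] st'_def[symmetric] s')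
  next
    case stop
    then have s': "crd_off st'" "crd_out st' = Some None" "crd_nb st' = crd_nb st"
      unfolding st'_step cstep_def q(1) by (auto simp: dec Let_def)
    have m: "coord_msg proto (\<omega> k) (coord_view c1) j' = encB None" for j' by (simp add: msg s')
    have sv: "sst j' (server_view c1 j' @ [Received (encB None)]) = (\<sigma> j')\<lparr>srv_off := True, srv_out := []\<rparr>" if "j' < k" for j'
      using I(1)[OF that] by (simp add: sst_snoc \<sigma>_def[symmetric] c1 sstep_def srv_ok_def decB words_def)
    have rep: "concat (map (\<lambda>j'. if server_msg proto j' (\<omega> j') (server_view c1 j' @ [Received (encB None)]) = [] then []
        else [(j', server_msg proto j' (\<omega> j') (server_view c1 j' @ [Received (encB None)]))]) [0..<k]) = []"
      by (auto simp: sv)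
    have c': "server_view c' = (\<lambda>j'. if j' < k then server_view c j' @ [Received (encB None)] else server_view c j')"
      "coord_view c' = H" "pending c' = qs" "bits c' = bits c + k * W"
      using coord_step_broadcast[of k proto \<omega> c1 "encB None", OF m] unfolding c'1 rep
      by (auto simp add: c1 encB(2) sv[unfolded c1] fun_eq_iff)
    have "inv_run l x c'"
      unfolding inv_run_def Let_def c'(2) st'_def[symmetric] Y s'
      using I(1,3,4) Iq I(9) stop Ymono(2) sv by (auto simp: s' p srv_ok_def \<sigma>_def[symmetric] c' c1 algebra_simps)
    moreover have "\<not> cost l c < cap" using stop by (simp add: cost_def st_def[symmetric] len)
    ultimately show ?thesis using stop by (simp add: off_def c' st_def[symmetric])
  next
    case quiet
    then have s': "\<not> crd_off st'" "crd_out st' = None" "crd_nb st' = crd_nb st"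
      unfolding st'_step cstep_def q(1) by (auto simp: dec Let_def chg_def X[symmetric] Y_def[symmetric])
    have c': "c' = c1" unfolding c'1 by (rule coord_step_silent) (simp add: msg s')
    have phY: "ph l cc i' Y = ph l cc i' X" if "cc \<in> C" "rs l X \<le> lev cc" for cc i'
      using quiet(3) that phYi[of i' cc] by (cases "i' = i") (auto simp: chg_def)
    have rsYX: "rs l Y = rs l X" using quiet(3) by (auto simp: chg_def)
    \<comment> \<open>The delivered entry has become exact. Elsewhere the coordinator's counts are
      the old ones, and the unchanged phases and level ask for agreement on the same counters as
      before.\<close>
    have ag: "(j', encR (i', x j' i')) \<in> set qs \<or> agree l Y x j' i'" if "j' < k" "i' < n" for j' i'
    proof (cases "j' = j \<and> i' = i")
      case True
      then show ?thesis by (simp add: agree_def Y_def)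
    next
      case False
      then have Yx: "Y j' i' = X j' i'" by (auto simp: Y_def)
      show ?thesis
      proof (cases "(j', encR (i', x j' i')) = q")
        case True
        then have "encR (i', x j' i') = encR (i, x j i)" using q by auto
        then have "i' = i" using dec decR[of i' "x j' i'"] that I(9) by simp
        with True q False show ?thesis by auto
      next
        case neq: False
        then show ?thesis using I(7)[OF quiet(1) that] Yx by (auto simp: p agree_def phY rsYX)
      qed
    qed
    have "inv_run l x c'"
      unfolding inv_run_def Let_def c' c1 st'_def[symmetric] Y s' \<sigma>_def[symmetric]
      using I(1,3,4,5,6) Iq I(9) quiet Ymono(2) ag by (auto simp: s' p srv_ok_def \<sigma>_def[symmetric] phY rsYX)
    then show ?thesis using quiet s' by (auto simp: off_def c' c1 st_def[symmetric] st'_def[symmetric] cost_def Y len)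
  next
    case announce
    define w where "w = (i, restrict (\<lambda>c. ph l c i Y) C, rs l Y)"
    have s': "\<not> crd_off st'" "crd_out st' = Some (Some w)" "crd_nb st' = Suc (crd_nb st)"
      using announce unfolding st'_step cstep_def q(1)
      by (auto simp: dec Let_def chg_def X[symmetric] Y_def[symmetric] w_def)
    have w: "Some w \<in> words" using q rs_le[of l Y] ph_le by (auto simp: w_def words_def)
    let ?m = "encB (Some w)"
    have m: "coord_msg proto (\<omega> k) (coord_view c1) j' = ?m" for j' by (simp add: msg s')
    have sv: "sst j' (server_view c1 j' @ [Received ?m])
        = (\<sigma> j')\<lparr>srv_ph := (srv_ph (\<sigma> j'))(i := restrict (\<lambda>c. ph l c i Y) C), srv_lev := rs l Y, srv_out := encR (i, x j' i)\<rparr>"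
      if "j' < k" for j'
      using I(1)[OF that] by (simp add: sst_snoc \<sigma>_def[symmetric] c1 sstep_def srv_ok_def decB[OF w]) (simp add: w_def)
    have rep: "map (\<lambda>j'. if server_msg proto j' (\<omega> j') (server_view c1 j' @ [Received ?m]) = [] then []
        else [(j', server_msg proto j' (\<omega> j') (server_view c1 j' @ [Received ?m]))]) [0..<k]
        = map (\<lambda>j'. [(j', encR (i, x j' i))]) [0..<k]"
      by (auto simp: sv)
    have c': "server_view c' = (\<lambda>j'. if j' < k then server_view c j' @ [Received ?m] else server_view c j')"
      "coord_view c' = H" "pending c' = qs @ map (\<lambda>j'. (j', encR (i, x j' i))) [0..<k]" "bits c' = bits c + k * W + k * W"
      using coord_step_broadcast[of k proto \<omega> c1 ?m, OF m] unfolding c'1 rep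
      by (auto simp add: c1 encB(2) encR(2) sv[unfolded c1] concat_map_singleton fun_eq_iff)
    have ok: "srv_ok l Y False (x j') (sst j' (server_view c' j'))" if "j' < k" for j'
      using I(1)[OF that] that announce(1) rsY phYi by (auto simp: c' sv[unfolded c1] srv_ok_def)
    \<comment> \<open>New phases may spoil the agreement on item \<open>i\<close> at all servers,
      but each of them has just queued its exact count. For other items the phases are the same, and
      a higher level only reduces the set of classes to agree on.\<close>
    have ag: "(j', encR (i', x j' i')) \<in> set (pending c') \<or> agree l Y x j' i'" if "j' < k" "i' < n" for j' i'
    proof (cases "i' = i")
      case True
      then show ?thesis using that by (auto simp: c')
    next
      case False
      then have Yx: "Y j' i' = X j' i'" by (auto simp: Y_def)
      have "(j', encR (i', x j' i')) \<noteq> q"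
      proof
        assume "(j', encR (i', x j' i')) = q"
        then have "encR (i', x j' i') = encR (i, x j i)" using q by auto
        then have "i' = i" using dec decR[of i' "x j' i'"] that I(9) by simp
        with False show False by simp
      qed
      then show ?thesis using I(7)[OF announce(1) that] Yx rsY by (auto simp: p c' agree_def phYi[OF False])
    qed
    have pend: "j' < k \<and> (\<exists>i<n. m = encR (i, x j' i))" if "(j', m) \<in> set (pending c')" for j' m
      using that I(2)[of j' m] q(3) by (auto simp: c' p)
    have "inv_run l x c'"
      unfolding inv_run_def Let_def c'(2) st'_def[symmetric] Y s'
    proof (intro conjI allI impI)
      show "bits c' = W * (k + Suc (crd_len st) + length (pending c') + k * Suc (crd_nb st) + (if crd_off st' then k else 0))"
        using s' announce(1) by (simp add: c' I(3) len algebra_simps)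
      \<comment> \<open>Both \<open>crd_len\<close> with the old announcements and the old queue, at
        most \<open>1 + k * crd_nb\<close>, are within \<open>cap\<close> by the failed stop test;
        this gives \<open>2 * cap\<close>. The broadcast and its replies add
        \<open>2 * k\<close>.\<close>
      show "Suc (crd_len st) + length (pending c') + k * Suc (crd_nb st) \<le> 2 * cap + 2 * k + 2"
        using announce I(5,6) by (simp add: c' len)
      show "Suc (crd_len st) + k * Suc (crd_nb st) < cap + k" using announce by simp
      show "length (pending c') \<le> 1 + k * Suc (crd_nb st)" using announce I(6) by (simp add: c' len)
    qed (use s' ok ag pend I(9) Ymono(2) in auto)
    then show ?thesis using announce s' by (auto simp: off_def c' st_def[symmetric] st'_def[symmetric] cost_def Y len)
  qed
  then have main: "inv_run l x c'" "coord_view c' = H" "off l c \<longrightarrow> off l c' \<and> pending c' = qs"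
    "\<not> off l c \<and> cost l c < cap \<longrightarrow> \<not> off l c' \<and>
         (\<forall>q'\<in>set (pending c'). q' \<in> set qs \<or> (\<exists>j'. q' = (j', encR (i, x j' i)))) \<and>
         (cost l c' = cost l c \<or> cost l c' = cost l c + 2 * k \<and> chg)" by blast+
  have X': "X' = Y" unfolding X'_def c'_def[symmetric] known_def main(2) st'_def[symmetric] by (rule Y)
  show "inv_run l x c'" by (rule main)
  show "crd_len (cst l (coord_view c')) = Suc (crd_len (cst l (coord_view c)))"
    by (simp add: main(2) st'_def[symmetric] st_def[symmetric] Y)
  show "off l c \<Longrightarrow> off l c' \<and> pending c' = qs" using main(3) by blast
  show "\<not> off l c' \<and>
       (\<exists>j i. q = (j, encR (i, x j i)) \<and> i < n \<and> X' = X(j := (X j)(i := x j i)) \<and>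
         (\<forall>q'\<in>set (pending c'). q' \<in> set qs \<or> (\<exists>j'. q' = (j', encR (i, x j' i)))) \<and>
         (cost l c' = cost l c \<or>
          cost l c' = cost l c + 2 * k \<and> (rs l X' \<noteq> rs l X \<or> (\<exists>c\<in>C. rs l X \<le> lev c \<and> ph l c i X' \<noteq> ph l c i X))))"
    if "\<not> off l c" "cost l c < cap"
    using main(4) that q(1,3) X' unfolding Y_def[symmetric] chg_def by (intro conjI exI[of _ j] exI[of _ i]) (auto simp: Y_def)
qed

end

section \<open>Termination, cost and correctness of whole runs\<close>

context monitor
begin

lemma inv_run_iterate:
  assumes "inv_run l x c" "\<omega> k = l"
  shows "inv_run l x ((deliver proto k \<omega> ^^ q) c)"
proof (induction q)
  case (Suc q)
  let ?c = "(deliver proto k \<omega> ^^ q) c"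
  show ?case
  proof (cases "pending ?c")
    case Nil
    then show ?thesis using Suc by (simp add: deliver_Nil)
  next
    case (Cons a as)
    then show ?thesis using deliver_run(1)[where ?\<omega> = \<omega>, OF Suc assms(2) Cons] by simp
  qed
qed (use assms in simp)

lemma drain_off:
  assumes "inv_run l x c" "\<omega> k = l" "off l c"
  shows "\<exists>q. pending ((deliver proto k \<omega> ^^ q) c) = []"
  using assms
proof (induction "length (pending c)" arbitrary: c)
  case 0
  then show ?case by (intro exI[of _ 0]) simp
next
  case (Suc m)
  then obtain a as where p: "pending c = a # as" by (cases "pending c") auto
  note d = deliver_run[where ?\<omega> = \<omega>, OF Suc.prems(1,2) p]
  have "\<exists>q. pending ((deliver proto k \<omega> ^^ q) (deliver proto k \<omega> c)) = []"
    by (rule Suc.hyps(1)) (use d Suc p in auto)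
  then show ?case by (metis funpow_Suc_right o_apply)
qed

text \<open>Each delivery raises \<open>crd_len\<close>, which stays below \<open>cap + k\<close>
  while the coordinator is on. Once off, it is silent for good and the queue only shrinks.\<close>

lemma drain:
  assumes "inv_run l x c" "\<omega> k = l"
  shows "\<exists>q. pending ((deliver proto k \<omega> ^^ q) c) = []"
  using assms
proof (induction "cap + k - crd_len (cst l (coord_view c))" arbitrary: c rule: less_induct)
  case less
  show ?case
  proof (cases "off l c \<or> pending c = []")
    case True
    then show ?thesis using drain_off[where ?\<omega> = \<omega>, OF less.prems] by (auto intro: exI[of _ 0])
  next
    case False
    then obtain a as where p: "pending c = a # as" by (cases "pending c") auto
    note d = deliver_run[where ?\<omega> = \<omega>, OF less.prems p]
    have "crd_len (cst l (coord_view c)) + k * crd_nb (cst l (coord_view c)) < cap + k"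
      using less.prems(1) False by (simp add: inv_run_def Let_def off_def)
    then have "\<exists>q. pending ((deliver proto k \<omega> ^^ q) (deliver proto k \<omega> c)) = []"
      by (intro less.hyps) (use d less.prems in auto)
    then show ?thesis by (metis funpow_Suc_right o_apply)
  qed
qed

lemma settle_run:
  assumes "inv_run l x c" "\<omega> k = l"
  shows "inv_run l x (settle proto k \<omega> c)" "pending (settle proto k \<omega> c) = []"
    "\<exists>q. settle proto k \<omega> c = (deliver proto k \<omega> ^^ q) c"
proof -
  obtain q where "pending ((deliver proto k \<omega> ^^ q) c) = []" using drain[where ?\<omega> = \<omega>, OF assms] by blast
  from settle_reached[OF this] show "pending (settle proto k \<omega> c) = []"
    "\<exists>q. settle proto k \<omega> c = (deliver proto k \<omega> ^^ q) c" by blast+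
  then show "inv_run l x (settle proto k \<omega> c)" using inv_run_iterate[where ?\<omega> = \<omega>, OF assms] by auto
qed

lemma run_snoc: "run P k \<omega> (s @ [(j, i)]) = settle P k \<omega> (server_step P \<omega> j (Update i) (run P k \<omega> s))"
  by (simp add: run_def)

lemma run_invariant:
  assumes "\<omega> k = l" "l < S"
  shows "valid_stream n k s \<Longrightarrow> length s \<le> N \<Longrightarrow> inv_run l (counts s) (run proto k \<omega> s) \<and> pending (run proto k \<omega> s) = []"
proof (induction s rule: rev_induct)
  case Nil
  then show ?case using initial_run[where ?\<omega> = \<omega>, OF assms] by (simp add: run_def)
next
  case (snoc u s)
  obtain j i where u: "u = (j, i)" by force
  have v: "valid_stream n k s" "j < k" "i < n" "length s < N" using snoc.prems by (auto simp: valid_stream_def u)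
  have IH: "inv_run l (counts s) (run proto k \<omega> s)" "pending (run proto k \<omega> s) = []" using snoc v by auto
  have "counts s j i < N" using counts_le_length[of s j i] v by simp
  from update_run(1)[OF IH v(2,3) this]
  have "inv_run l (counts (s @ [(j, i)])) (server_step proto \<omega> j (Update i) (run proto k \<omega> s))"
    by (simp add: counts_snoc)
  from settle_run[where ?\<omega> = \<omega>, OF this assms(1)] show ?case by (simp add: u run_snoc)
qed

text \<open>The invariant while an update of item \<open>i\<close> settles: announcements still
  possible are paid in advance through \<open>rem\<close>. The level \<open>r\<close> from before
  the update is kept, so that \<open>rem\<close> sums over a fixed set of classes.\<close>

definition good :: "nat \<Rightarrow> nat \<Rightarrow> nat \<Rightarrow> nat \<Rightarrow> (nat \<Rightarrow> nat \<Rightarrow> nat) \<Rightarrow> config \<Rightarrow> bool" where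
  "good l r i B x c \<longleftrightarrow> \<not> off l c \<and> r \<le> rs l (known l c) \<and>
     (\<forall>q\<in>set (pending c). \<exists>j. q = (j, encR (i, x j i))) \<and> cost l c + 2 * k * rem l r i x (known l c) \<le> B"

lemma known_le: "inv_run l x c \<Longrightarrow> known l c j i \<le> x j i"
  by (simp add: inv_run_def Let_def known_def)

text \<open>All pending reports concern item \<open>i\<close>, hence so does any announcement. It
  advances a phase or the level, so \<open>rem\<close> drops by at least 1 and releases the
  \<open>2 * k\<close> messages needed; \<open>B < cap\<close> rules out the stop.\<close>

lemma good_deliver:
  assumes inv: "inv_run l x c" and l: "\<omega> k = l" and i: "i < n" and g: "good l r i B x c" and B: "B < cap"
  shows "good l r i B x (deliver proto k \<omega> c)"
proof (cases "pending c")
  case Nil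
  then show ?thesis using g by (simp add: deliver_Nil)
next
  case (Cons q qs)
  let ?c' = "deliver proto k \<omega> c"
  define X where "X = known l c"
  define X' where "X' = known l ?c'"
  have N: "x j i \<le> N" for j i using inv by (simp add: inv_run_def Let_def)
  have no: "\<not> off l c" "cost l c < cap" using g B by (auto simp: good_def)
  from deliver_run(4)[where ?\<omega> = \<omega>, OF inv l Cons no]
  obtain j i' where d: "\<not> off l ?c'" "q = (j, encR (i', x j i'))" "i' < n" "X' = X(j := (X j)(i' := x j i'))"
    "\<forall>q'\<in>set (pending ?c'). q' \<in> set qs \<or> (\<exists>j'. q' = (j', encR (i', x j' i')))"
    "cost l ?c' = cost l c \<or>
     cost l ?c' = cost l c + 2 * k \<and> (rs l X' \<noteq> rs l X \<or> (\<exists>c\<in>C. rs l X \<le> lev c \<and> ph l c i' X' \<noteq> ph l c i' X))"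
    unfolding X_def X'_def by blast
  obtain j' where "q = (j', encR (i, x j' i))" using g Cons by (auto simp: good_def)
  then have i': "i' = i" using decR[OF d(3) N] decR[OF i N] d(2) by (metis fst_conv snd_conv)
  have XX': "X j i \<le> X' j i" for j i using known_le[OF inv] by (auto simp: d(4) X_def)
  have X'x: "X' j i \<le> x j i" for j i using known_le[OF inv] by (auto simp: d(4) X_def)
  have phm: "ph l c i X \<le> ph l c i X'" "ph l c i X' \<le> ph l c i x" for c by (intro ph_mono XX' X'x)+
  have rsm: "rs l X \<le> rs l X'" "rs l X' \<le> rs l x" by (intro rs_mono XX' X'x)+
  have fin: "finite {c \<in> C. r \<le> lev c}" using finC by simp
  have r: "r \<le> rs l X" using g by (simp add: good_def X_def)
  have rem_le: "rem l r i x X' \<le> rem l r i x X"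
    unfolding rem_def using phm rsm by (intro add_mono sum_mono diff_le_mono2) auto
  have rem_less: "rem l r i x X' < rem l r i x X" if "rs l X' \<noteq> rs l X \<or> (\<exists>c\<in>C. rs l X \<le> lev c \<and> ph l c i X' \<noteq> ph l c i X)"
    using that
  proof
    assume "rs l X' \<noteq> rs l X"
    then have "rs l x - rs l X' < rs l x - rs l X" using rsm by linarith
    then show ?thesis unfolding rem_def using phm by (intro add_le_less_mono sum_mono diff_le_mono2) auto
  next
    assume "\<exists>c\<in>C. rs l X \<le> lev c \<and> ph l c i X' \<noteq> ph l c i X"
    then obtain c where c: "c \<in> C" "rs l X \<le> lev c" "ph l c i X' \<noteq> ph l c i X" by blast
    then have "ph l c i x - ph l c i X' < ph l c i x - ph l c i X" using phm[of c] by linarith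
    then have "(\<Sum>c | c \<in> C \<and> r \<le> lev c. ph l c i x - ph l c i X') < (\<Sum>c | c \<in> C \<and> r \<le> lev c. ph l c i x - ph l c i X)"
      using phm c r by (intro sum_strict_mono_ex1 fin ballI bexI[of _ c] diff_le_mono2) auto
    then show ?thesis unfolding rem_def using rsm by (intro add_less_le_mono diff_le_mono2) auto
  qed
  have gB: "cost l c + 2 * k * rem l r i x X \<le> B" using g by (simp add: good_def X_def)
  have "cost l ?c' + 2 * k * rem l r i x X' \<le> B"
    using d(6)
  proof
    assume "cost l ?c' = cost l c"
    moreover have "2 * k * rem l r i x X' \<le> 2 * k * rem l r i x X" using rem_le by (rule mult_le_mono2)
    ultimately show ?thesis using gB by linarith
  next
    assume *: "cost l ?c' = cost l c + 2 * k \<and> (rs l X' \<noteq> rs l X \<or> (\<exists>c\<in>C. rs l X \<le> lev c \<and> ph l c i' X' \<noteq> ph l c i' X))"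
    then have "Suc (rem l r i x X') \<le> rem l r i x X" using rem_less i' by auto
    then have "2 * k * Suc (rem l r i x X') \<le> 2 * k * rem l r i x X" by (rule mult_le_mono2)
    then show ?thesis using gB * by simp
  qed
  then show ?thesis
    using d(1,5) r rsm(1) g Cons i' by (auto simp: good_def X'_def[symmetric])
qed

lemma good_settle:
  assumes inv: "inv_run l x c" and l: "\<omega> k = l" and i: "i < n" and g: "good l r i B x c" and B: "B < cap"
  shows "good l r i B x (settle proto k \<omega> c)"
proof -
  have "good l r i B x ((deliver proto k \<omega> ^^ q) c)" for q
    using g by (induction q) (auto intro!: good_deliver inv_run_iterate inv l i B)
  then show ?thesis using settle_run(3)[where ?\<omega> = \<omega>, OF inv l] by auto
qed

text \<open>With nothing pending, no counter of a current phase differs from what the coordinator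
  knows. \<open>ph_eq_if_tot_eq\<close> transfers the phases to the true counts, and
  \<open>rs_cong\<close> then the level.\<close>

lemma settled_agree:
  assumes inv: "inv_run l x c" and p: "pending c = []" and on: "\<not> off l c"
  defines "X \<equiv> known l c"
  shows "rs l x = rs l X"
    "\<And>i c. i < n \<Longrightarrow> c \<in> C \<Longrightarrow> rs l X \<le> lev c \<Longrightarrow> ph l c i x = ph l c i X \<and>
       (\<forall>j<k. g l c (ph l c i X) j i (X j i) = g l c (ph l c i X) j i (x j i))"
proof -
  have ag: "agree l X x j i" if "j < k" "i < n" for j i
    using inv p on that by (auto simp: inv_run_def Let_def off_def X_def known_def)
  have le: "X j i \<le> x j i" for j i using known_le[OF inv] by (simp add: X_def)
  show *: "ph l c i x = ph l c i X \<and> (\<forall>j<k. g l c (ph l c i X) j i (X j i) = g l c (ph l c i X) j i (x j i))"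
    if "i < n" "c \<in> C" "rs l X \<le> lev c" for i c
  proof -
    have e: "\<forall>j<k. g l c (ph l c i X) j i (X j i) = g l c (ph l c i X) j i (x j i)"
      using ag that by (auto simp: agree_def)
    moreover have "ph l c i x = ph l c i X"
      by (rule ph_eq_if_tot_eq) (use le e in auto)
    ultimately show ?thesis by blast
  qed
  show "rs l x = rs l X" by (rule rs_cong) (use le * in auto)
qed

lemma inv_run_pending: "inv_run l x c \<Longrightarrow> (j, m) \<in> set (pending c) \<Longrightarrow> j < k \<and> (\<exists>i<n. m = encR (i, x j i))"
  unfolding inv_run_def Let_def by simp

text \<open>Cost and cap depend on each other: the run is ideal only while it has not stopped, and
  has not stopped only because its cost is ideal. Induction on the stream proves both
  together.\<close>

lemma run_good:
  assumes l: "\<omega> k = l" "l < S"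
  shows "valid_stream n k s \<Longrightarrow> length s \<le> N \<Longrightarrow> ideal_cost l s < cap \<Longrightarrow>
    \<not> off l (run proto k \<omega> s) \<and> cost l (run proto k \<omega> s) \<le> ideal_cost l s"
proof (induction s rule: rev_induct)
  case Nil
  then show ?case using initial_run[where ?\<omega> = \<omega>, OF l] by (simp add: run_def)
next
  case (snoc u s)
  obtain j i where u: "u = (j, i)" by force
  have v: "valid_stream n k s" "j < k" "i < n" "length s < N" using snoc.prems by (auto simp: valid_stream_def u)
  let ?c = "run proto k \<omega> s"
  let ?x = "counts s" and ?x' = "counts (s @ [u])"
  define X where "X = known l ?c"
  have IH: "\<not> off l ?c" "cost l ?c \<le> ideal_cost l s" using snoc v by (auto simp: ideal_cost_snoc)
  have inv: "inv_run l ?x ?c" "pending ?c = []" using run_invariant[where ?\<omega> = \<omega>, OF l] v by auto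
  note sa = settled_agree[OF inv IH(1), folded X_def]
  have xN: "?x j i < N" using counts_le_length[of s j i] v by simp
  let ?c1 = "server_step proto \<omega> j (Update i) ?c"
  note up = update_run[where ?\<omega> = \<omega>, OF inv v(2,3) xN, folded X_def]
  have inv1: "inv_run l ?x' ?c1" using up(1) by (simp add: u counts_snoc)
  have x': "?x j' i' \<le> ?x' j' i'" for j' i' by (auto simp: u counts_snoc)
  have pend: "\<exists>j'. q = (j', encR (i, ?x' j' i))" if "q \<in> set (pending ?c1)" for q
  proof -
    obtain j' v' where q: "q = (j', encR (i, v'))" "v' \<le> N" using up(6) \<open>q \<in> _\<close> by blast
    have x'N: "?x' a b \<le> N" for a b using inv1 by (simp add: inv_run_def Let_def)
    obtain i' where i': "i' < n" "encR (i, v') = encR (i', ?x' j' i')"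
      using inv_run_pending[OF inv1] \<open>q \<in> _\<close> unfolding q by blast
    then have "i' = i" "v' = ?x' j' i'" using decR[OF v(3) q(2)] decR[OF i'(1) x'N] by (metis fst_conv snd_conv)+
    then show ?thesis using q by blast
  qed
  have ex: "(\<exists>c\<in>C. rs l X \<le> lev c \<and> g l c (ph l c i X) j i (Suc (?x j i)) \<noteq> g l c (ph l c i X) j i (?x j i))
     \<longleftrightarrow> (\<exists>c\<in>C. rs l ?x \<le> lev c \<and> g l c (ph l c i ?x) j i (Suc (?x j i)) \<noteq> g l c (ph l c i ?x) j i (?x j i))"
    using sa(2)[OF v(3)] by (intro bex_cong refl) (auto simp: sa(1))
  have "cost l ?c1 + 2 * k * rem l (rs l ?x) i ?x' X \<le> ideal_cost l (s @ [u])"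
  proof -
    have "rem l (rs l ?x) i ?x' X = rem l (rs l ?x) i ?x' ?x"
      unfolding rem_def using sa(2)[OF v(3)] by (intro arg_cong2[of _ _ _ _ "(+)"] sum.cong) (auto simp: sa(1))
    then show ?thesis using IH up(4) by (simp add: ideal_cost_snoc inc_def u Let_def ex)
  qed
  then have "good l (rs l ?x) i (ideal_cost l (s @ [u])) ?x' ?c1"
    using IH(1) pend by (auto simp: good_def up(2,3) sa(1))
  from good_settle[where ?\<omega> = \<omega>, OF inv1 l(1) v(3) this snoc.prems(3)]
  show ?case by (simp add: good_def u run_snoc)
qed

lemma run_estimate:
  assumes l: "\<omega> k = l" "l < S" and s: "valid_stream n k s" "length s \<le> N" "ideal_cost l s < cap"
  shows "estimate proto k s \<omega> = est l (counts s)"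
proof -
  have inv: "inv_run l (counts s) (run proto k \<omega> s)" "pending (run proto k \<omega> s) = []"
    using run_invariant[where ?\<omega> = \<omega>, OF l s(1,2)] by auto
  have on: "\<not> off l (run proto k \<omega> s)" using run_good[where ?\<omega> = \<omega>, OF l s] by blast
  note sa = settled_agree[OF inv on]
  have "est l (known l (run proto k \<omega> s)) = est l (counts s)"
    by (rule est_cong[OF s(1,2)]) (use known_le[OF inv(1)] sa in auto)
  then show ?thesis by (simp add: estimate_def l known_def)
qed

text \<open>Besides the \<open>2 * cap + 2 * k + 2\<close> messages of the invariant,
  \<open>k\<close> messages carry the coin and at most \<open>k\<close> the stop signal.\<close>

lemma run_uses_bits: "valid_stream n k s \<Longrightarrow> length s \<le> N \<Longrightarrow> uses_bits proto k s (real (W * (2 * cap + 4 * k + 2)))"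
  unfolding uses_bits_def
proof (intro ballI)
  fix \<omega> assume "\<omega> \<in> set_pmf (seeds proto k)" and s: "valid_stream n k s" "length s \<le> N"
  then have l: "\<omega> k < S"
    using S by (auto simp: seeds_def set_Pi_pmf PiE_dflt_def proto_def set_pmf_of_set lessThan_empty_iff dest!: spec[of _ k])
  let ?c = "run proto k \<omega> s" and ?st = "cst (\<omega> k) (coord_view (run proto k \<omega> s))"
  have inv: "inv_run (\<omega> k) (counts s) ?c" "pending ?c = []" using run_invariant[where ?\<omega> = \<omega>, OF refl l s] by auto
  then have b: "bits ?c = W * (k + crd_len ?st + k * crd_nb ?st + (if crd_off ?st then k else 0))"
    "crd_len ?st + k * crd_nb ?st \<le> 2 * cap + 2 * k + 2" by (auto simp: inv_run_def Let_def)
  have "bits ?c \<le> W * (2 * cap + 4 * k + 2)" unfolding b(1) using b(2) by (intro mult_le_mono2) auto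
  then show "pending ?c = [] \<and> real (bits ?c) \<le> real (W * (2 * cap + 4 * k + 2))" using inv(2) by linarith
qed

lemma seeds_coord: "map_pmf (\<lambda>\<omega>. \<omega> k) (seeds proto k) = pmf_of_set {..<S}"
  by (simp add: seeds_def Pi_pmf_component proto_def)

end

section \<open>Random thresholds\<close>

text \<open>Each term satisfies \<open>a powr p = a * a powr (p - 1)\<close>, and the second factor
  is at most that of the whole sum. Needed over the servers in \<open>mean_phase0\<close> and over
  the items to bound the moment by the stream length.\<close>

lemma sum_powr_le_powr_sum:
  fixes a :: "'a \<Rightarrow> real"
  assumes "finite A" "\<And>x. x \<in> A \<Longrightarrow> 0 \<le> a x" "p \<ge> 1"
  shows "(\<Sum>x\<in>A. a x powr p) \<le> (\<Sum>x\<in>A. a x) powr p"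
proof -
  let ?S = "\<Sum>x\<in>A. a x"
  have S0: "0 \<le> ?S" by (rule sum_nonneg) (use assms in auto)
  have s: "b powr p = b * b powr (p - 1)" if "0 \<le> b" for b :: real
    using that by (simp add: powr_mult_base)
  have "(\<Sum>x\<in>A. a x powr p) \<le> (\<Sum>x\<in>A. a x * ?S powr (p - 1))"
  proof (rule sum_mono)
    fix x assume x: "x \<in> A"
    then have "a x \<le> ?S" by (intro member_le_sum) (use assms in auto)
    then show "a x powr p \<le> a x * ?S powr (p - 1)"
      using assms x by (subst s) (auto intro!: mult_left_mono powr_mono2)
  qed
  also have "\<dots> = ?S powr p" unfolding s[OF S0] by (simp add: sum_distrib_right)
  finally show ?thesis .
qed

lemma card_le_threshold:
  fixes w :: real
  assumes "0 \<le> w"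
  shows "real (card {z \<in> {1..m}. real z \<le> w * m}) \<le> w * m"
    and "min 1 w * m - 1 \<le> real (card {z \<in> {1..m}. real z \<le> w * m})"
proof -
  have "{z \<in> {1..m}. real z \<le> w * m} \<subseteq> {1..nat \<lfloor>w * m\<rfloor>}" by (auto simp: le_nat_floor)
  then have "card {z \<in> {1..m}. real z \<le> w * m} \<le> nat \<lfloor>w * m\<rfloor>"
    using card_mono[of "{1..nat \<lfloor>w * m\<rfloor>}"] by fastforce
  moreover have "real (nat \<lfloor>w * m\<rfloor>) \<le> w * m" using assms by (simp add: of_nat_floor)
  ultimately show "real (card {z \<in> {1..m}. real z \<le> w * m}) \<le> w * m" by linarith
  let ?c = "nat \<lfloor>min 1 w * m\<rfloor>"
  have w0: "0 \<le> min 1 w * m" using assms by simp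
  have c: "real ?c \<le> min 1 w * m" using w0 by (simp add: of_nat_floor)
  have "min 1 w * m \<le> 1 * real m" "min 1 w * m \<le> w * m" by (intro mult_right_mono; simp)+
  with c have c': "real ?c \<le> real m" "real ?c \<le> w * m" by linarith+
  have "{1..?c} \<subseteq> {z \<in> {1..m}. real z \<le> w * m}"
  proof
    fix z assume "z \<in> {1..?c}"
    then have "1 \<le> z" "z \<le> ?c" by auto
    moreover then have "real z \<le> real ?c" by linarith
    ultimately show "z \<in> {z \<in> {1..m}. real z \<le> w * m}" using c' by simp
  qed
  then have "card {1..?c} \<le> card {z \<in> {1..m}. real z \<le> w * m}" by (intro card_mono) auto
  moreover have "min 1 w * m - 1 \<le> real ?c" using w0 by linarith
  ultimately show "min 1 w * m - 1 \<le> real (card {z \<in> {1..m}. real z \<le> w * m})" by simp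
qed

text \<open>
  A coin of a class of scale \<open>M\<close> and an item is a random threshold \<open>thresh z M\<close> for the frequency
  \<open>f\<close> of the item, such that \<open>f\<close> exceeds it with probability about \<open>f powr p / M\<close>, together with a
  dither for each server. Phase 0 compares \<open>f\<close> with the threshold up to a constant factor, ignoring
  the servers whose share is below \<open>1 / (4 k)\<close> of the threshold; phase 1 decides whether \<open>f\<close> has
  reached the threshold.
\<close>

locale sketch =
  fixes p :: real and k m m' R Lam :: nat
  assumes p: "p \<ge> 2" and k: "k \<ge> 1" and m: "m \<ge> 1" and m': "k \<le> m'" and R: "R \<ge> 1" and Lam: "Lam \<ge> 1"
begin

definition thresh :: "nat \<Rightarrow> real \<Rightarrow> real" where
  "thresh z M = (real z * M / m) powr (1 / p)"

text \<open>Fixed-point numbers with denominator \<open>m'\<close>, rounded in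
  \<open>counter\<close>. Phase 0 aims at \<open>4 * R\<close> reports when \<open>f\<close> reaches
  the threshold; the ignored servers hold less than a quarter of the threshold together and so lose
  at most \<open>R\<close>, which leaves \<open>R\<close> reports as a safe signal.\<close>

definition scaled :: "nat \<Rightarrow> real \<Rightarrow> nat \<Rightarrow> nat \<Rightarrow> nat" where
  "scaled z M h v =
     (if h = 0 then if 4 * k * real v < thresh z M then 0 else nat \<lfloor>m' * (4 * real R) * v / thresh z M\<rfloor>
      else nat \<lfloor>m' * real Lam * v / thresh z M\<rfloor>)"

definition counter :: "real \<Rightarrow> nat \<times> (nat \<Rightarrow> nat) \<Rightarrow> nat \<Rightarrow> nat \<Rightarrow> nat \<Rightarrow> nat" where
  "counter M u h j v = (if h \<ge> 2 then 0 else (scaled (fst u) M h v + snd u j) div m')"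

definition ctot :: "real \<Rightarrow> nat \<times> (nat \<Rightarrow> nat) \<Rightarrow> nat \<Rightarrow> (nat \<Rightarrow> nat) \<Rightarrow> nat" where
  "ctot M u h x = (\<Sum>j<k. counter M u h j (x j))"

definition thr :: "nat \<Rightarrow> nat" where "thr h = (if h = 0 then R else Lam)"

definition cph :: "real \<Rightarrow> nat \<times> (nat \<Rightarrow> nat) \<Rightarrow> (nat \<Rightarrow> nat) \<Rightarrow> nat" where
  "cph M u x = (if ctot M u 0 x < R then 0 else if ctot M u 1 x < Lam then 1 else 2)"

definition dithers :: "(nat \<Rightarrow> nat) pmf" where
  "dithers = Pi_pmf {..<k} 0 (\<lambda>_. pmf_of_set {..<m'})"

definition unit_coin :: "(nat \<times> (nat \<Rightarrow> nat)) pmf" where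
  "unit_coin = pair_pmf (pmf_of_set {1..m}) dithers"

lemma m'0: "m' > 0" using k m' by simp

lemma thresh_nonneg: "0 \<le> thresh z M" by (simp add: thresh_def)

lemma thresh_pos: "z \<ge> 1 \<Longrightarrow> M > 0 \<Longrightarrow> 0 < thresh z M" using m by (simp add: thresh_def)

lemma scaled_mono: "v \<le> v' \<Longrightarrow> scaled z M h v \<le> scaled z M h v'"
proof -
  assume v: "v \<le> v'"
  have a: "nat \<lfloor>c * v / thresh z M\<rfloor> \<le> nat \<lfloor>c * v' / thresh z M\<rfloor>" if "0 \<le> c" for c :: real
    using that v thresh_nonneg[of z M] by (intro nat_mono floor_mono divide_right_mono mult_left_mono) auto
  have "4 * k * real v \<le> 4 * k * real v'" using v by (intro mult_left_mono) auto
  then show ?thesis using a[of "m' * (4 * real R)"] a[of "m' * real Lam"] by (auto simp: scaled_def)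
qed

lemma counter_mono: "v \<le> v' \<Longrightarrow> counter M u h j v \<le> counter M u h j v'"
  by (simp add: counter_def scaled_mono div_le_mono)

lemma finite_set_dithers: "finite (set_pmf dithers)"
  unfolding dithers_def
  by (rule finite_subset[OF set_Pi_pmf_subset']) (use m'0 in \<open>auto simp: set_pmf_of_set lessThan_empty_iff\<close>)

lemma finite_set_unit_coin: "finite (set_pmf unit_coin)"
  unfolding unit_coin_def using finite_set_dithers m by (simp add: set_pmf_of_set)

lemma dithers_less: "\<theta> \<in> set_pmf dithers \<Longrightarrow> \<theta> j < m'"
  using m'0 by (cases "j < k") (auto simp: dithers_def set_Pi_pmf PiE_dflt_def set_pmf_of_set lessThan_empty_iff dest: spec[of _ j])

lemma unit_coin_set: "u \<in> set_pmf unit_coin \<Longrightarrow> fst u \<ge> 1 \<and> snd u j < m'"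
  using m dithers_less by (auto simp: unit_coin_def set_pmf_of_set)

lemma counter_0: "u \<in> set_pmf unit_coin \<Longrightarrow> counter M u h j 0 = 0"
  using unit_coin_set[of u j] by (simp add: counter_def scaled_def)

lemma expectation_unit_coin:
  "measure_pmf.expectation unit_coin f = (\<Sum>z=1..m. measure_pmf.expectation dithers (\<lambda>\<theta>. f (z, \<theta>) :: real)) / m"
proof -
  have "measure_pmf.expectation unit_coin f
      = measure_pmf.expectation (pmf_of_set {1..m} \<bind> (\<lambda>z. map_pmf (\<lambda>\<theta>. (z, \<theta>)) dithers)) f"
    by (simp add: unit_coin_def pair_pmf_def map_pmf_def)
  also have "\<dots> = (\<Sum>z\<in>{1..m}. pmf (pmf_of_set {1..m}) z *\<^sub>R measure_pmf.expectation (map_pmf (\<lambda>\<theta>. (z, \<theta>)) dithers) f)"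
    by (rule pmf_expectation_bind) (use finite_set_dithers m in \<open>auto simp: set_pmf_of_set\<close>)
  also have "\<dots> = (\<Sum>z=1..m. measure_pmf.expectation dithers (\<lambda>\<theta>. f (z, \<theta>))) / m"
    using m by (simp add: sum_divide_distrib)
  finally show ?thesis .
qed

lemma prob_unit_coin:
  "measure_pmf.prob unit_coin A = (\<Sum>z=1..m. measure_pmf.prob dithers {\<theta>. (z, \<theta>) \<in> A}) / m"
proof -
  have "measure_pmf.prob unit_coin A = measure_pmf.expectation unit_coin (indicator A)" by simp
  also have "\<dots> = (\<Sum>z=1..m. measure_pmf.expectation dithers (\<lambda>\<theta>. indicator A (z, \<theta>))) / m"
    by (rule expectation_unit_coin)
  also have "\<dots> = (\<Sum>z=1..m. measure_pmf.prob dithers {\<theta>. (z, \<theta>) \<in> A}) / m"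
  proof -
    have "(\<lambda>\<theta>. indicator A (z, \<theta>)) = (indicator {\<theta>. (z, \<theta>) \<in> A} :: _ \<Rightarrow> real)" for z
      by (auto simp: indicator_def)
    then show ?thesis by simp
  qed
  finally show ?thesis .
qed

text \<open>Reduces a probability over coins to fixed thresholds: with \<open>z\<close> uniform on
  \<open>{1..m}\<close>, the test \<open>z <= w * m\<close> succeeds with probability at most
  \<open>w\<close>, and \<open>q\<close> is the error due to the dithers.\<close>

lemma prob_unit_coin_le:
  fixes w q :: real
  assumes "\<And>z. z \<in> {1..m} \<Longrightarrow> measure_pmf.prob dithers {\<theta>. (z, \<theta>) \<in> A} \<le> (if real z \<le> w * m then 1 else 0) + q" and w: "0 \<le> w"
  shows "measure_pmf.prob unit_coin A \<le> w + q"
proof -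
  have "(\<Sum>z=1..m. measure_pmf.prob dithers {\<theta>. (z, \<theta>) \<in> A}) \<le> (\<Sum>z=1..m. (if real z \<le> w * m then 1 else 0) + q)"
    by (rule sum_mono) (rule assms)
  also have "\<dots> = real (card {z \<in> {1..m}. real z \<le> w * m}) + m * q"
    by (simp add: sum.distrib sum.If_cases Int_def)
  also have "\<dots> \<le> w * m + m * q" using card_le_threshold(1)[OF w, of m] by simp
  also have "\<dots> = (w + q) * m" by (simp add: algebra_simps)
  finally show ?thesis unfolding prob_unit_coin using m by (simp add: divide_le_eq)
qed

lemma prob_unit_coin_ge:
  fixes w q :: real
  assumes "\<And>z. z \<in> {1..m} \<Longrightarrow> (if real z \<le> w * m then 1 else 0) - q \<le> measure_pmf.prob dithers {\<theta>. (z, \<theta>) \<in> A}" and w: "0 \<le> w"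
  shows "min 1 w - 1 / m - q \<le> measure_pmf.prob unit_coin A"
proof -
  have "(min 1 w - 1 / m - q) * m = min 1 w * m - 1 - m * q" using m by (simp add: field_simps)
  also have "\<dots> \<le> real (card {z \<in> {1..m}. real z \<le> w * m}) - m * q" using card_le_threshold(2)[OF w, of m] by simp
  also have "\<dots> = (\<Sum>z=1..m. (if real z \<le> w * m then 1 else 0) - q)"
    by (simp add: sum_subtractf sum.If_cases Int_def)
  also have "\<dots> \<le> (\<Sum>z=1..m. measure_pmf.prob dithers {\<theta>. (z, \<theta>) \<in> A})"
    by (rule sum_mono) (rule assms)
  finally show ?thesis unfolding prob_unit_coin using m by (simp add: le_divide_eq)
qed

lemma thresh_le_iff:
  assumes "z \<ge> 1" "M > 0" "lam > 0" "f \<ge> 0"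
  shows "lam * thresh z M \<le> f \<longleftrightarrow> real z \<le> f powr p / M / lam powr p * m"
proof -
  have p0: "p > 0" using p by simp
  have T: "thresh z M powr p = real z * M / m" using assms p m by (simp add: thresh_def powr_powr)
  have "lam * thresh z M \<le> f \<longleftrightarrow> (lam * thresh z M) powr p \<le> f powr p"
    using powr_mono2[of p "lam * thresh z M" f] powr_less_mono2[of p f "lam * thresh z M"] thresh_nonneg[of z M] assms p0
    by (smt (verit) mult_nonneg_nonneg)
  also have "(lam * thresh z M) powr p = lam powr p * (real z * M / m)"
    using thresh_nonneg assms by (simp add: powr_mult T)
  also have "lam powr p * (real z * M / m) \<le> f powr p \<longleftrightarrow> real z \<le> f powr p / M / lam powr p * m"
    using assms m by (simp add: field_simps)
  finally show ?thesis .
qed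

section \<open>Both phases for one item and a fixed threshold\<close>

context
  fixes z :: nat and M :: real and x :: "nat \<Rightarrow> nat"
  assumes z: "z \<ge> 1" and M: "M > 0"
begin

definition "y = (\<Sum>j<k. real (x j)) / thresh z M"

lemma T0: "0 < thresh z M" using thresh_pos z M by simp

text \<open>Flooring loses \<open>1 / m'\<close> per server, at most 1 in all; ignored servers lose
  \<open>R / k\<close> each. For the last bound, a server that is not ignored has
  \<open>4 * k * w >= 1\<close>, so inserting the factor \<open>(4 * k * w) powr (p - 1)\<close>
  only increases its share.\<close>

lemma mean_phase0:
  defines "\<mu> \<equiv> \<Sum>j<k. real (scaled z M 0 (x j)) / m'"
  shows "\<mu> \<le> 4 * R * y" "4 * R * y - R - 1 \<le> \<mu>" "\<mu> \<le> 4 * R * (4 * k) powr (p - 1) * y powr p"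
proof -
  define w where "w j = real (x j) / thresh z M" for j
  have w0: "0 \<le> w j" for j using T0 by (simp add: w_def)
  have y: "y = (\<Sum>j<k. w j)" by (simp add: y_def w_def sum_divide_distrib)
  have cond: "4 * k * real (x j) < thresh z M \<longleftrightarrow> w j < 1 / (4 * k)" for j
    using T0 k by (simp add: w_def field_simps)
  have sc: "scaled z M 0 (x j) = (if w j < 1 / (4 * k) then 0 else nat \<lfloor>m' * (4 * real R * w j)\<rfloor>)" for j
    by (simp only: scaled_def cond) (simp add: w_def mult.assoc)
  have fl: "real (nat \<lfloor>m' * (4 * real R * w j)\<rfloor>) \<le> m' * (4 * real R * w j)" "m' * (4 * real R * w j) - 1 \<le> real (nat \<lfloor>m' * (4 * real R * w j)\<rfloor>)" for j
    using w0[of j] by (simp_all add: of_nat_floor)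
  have up: "real (nat \<lfloor>m' * (4 * real R * w j)\<rfloor>) / m' \<le> 4 * real R * w j" for j
    using fl(1)[of j] m'0 by (simp add: divide_le_eq mult.commute)
  have lo: "4 * real R * w j - 1 / m' \<le> real (nat \<lfloor>m' * (4 * real R * w j)\<rfloor>) / m'" for j
    using divide_right_mono[OF fl(2)[of j], of "real m'"] m'0 by (simp add: diff_divide_distrib)
  have "real (scaled z M 0 (x j)) / m' \<le> 4 * real R * w j" for j
    using up[of j] w0[of j] by (simp add: sc)
  then have "\<mu> \<le> (\<Sum>j<k. 4 * real R * w j)" unfolding \<mu>_def by (rule sum_mono)
  then show "\<mu> \<le> 4 * R * y" by (simp add: y sum_distrib_left)
  have "4 * real R * w j - real R / k - 1 / m' \<le> real (scaled z M 0 (x j)) / m'" for j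
  proof (cases "w j < 1 / (4 * k)")
    case True
    then have "4 * real R * w j \<le> 4 * real R * (1 / (4 * k))" by (intro mult_left_mono) auto
    then have "4 * real R * w j - real R / k \<le> 0" by simp
    moreover have "0 \<le> 1 / real m'" by simp
    ultimately have "4 * real R * w j - real R / k - 1 / m' \<le> 0" by linarith
    then show ?thesis using True by (simp add: sc)
  next
    case False
    have "0 \<le> real R / k" by simp
    then show ?thesis using lo[of j] unfolding sc if_not_P[OF False] by linarith
  qed
  then have "(\<Sum>j<k. 4 * real R * w j - real R / k - 1 / m') \<le> \<mu>" unfolding \<mu>_def by (rule sum_mono)
  moreover have "(\<Sum>j<k. 4 * real R * w j - real R / k - 1 / m') = 4 * R * y - R - k / m'"
    using k by (simp add: sum_subtractf y sum_distrib_left)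
  moreover have "k / real m' \<le> 1" using m' m'0 by simp
  ultimately show "4 * R * y - R - 1 \<le> \<mu>" by linarith
  have "real (scaled z M 0 (x j)) / m' \<le> 4 * real R * (4 * k) powr (p - 1) * w j powr p" for j
  proof (cases "w j < 1 / (4 * k)")
    case True
    then show ?thesis by (simp add: sc)
  next
    case False
    then have w: "1 \<le> 4 * k * w j" using k by (simp add: field_simps)
    have "w j * 1 \<le> w j * (4 * k * w j) powr (p - 1)"
      using w p by (intro mult_left_mono w0 ge_one_powr_ge_zero) auto
    also have "\<dots> = (4 * k) powr (p - 1) * (w j * w j powr (p - 1))" using w0[of j] by (simp add: powr_mult)
    also have "w j * w j powr (p - 1) = w j powr p" using w0[of j] by (simp add: powr_mult_base)
    finally have "4 * real R * w j \<le> 4 * real R * ((4 * k) powr (p - 1) * w j powr p)" by (intro mult_left_mono) auto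
    then show ?thesis using up[of j] False by (simp add: sc mult.assoc)
  qed
  then have "\<mu> \<le> (\<Sum>j<k. 4 * real R * (4 * k) powr (p - 1) * w j powr p)" unfolding \<mu>_def by (rule sum_mono)
  also have "\<dots> = 4 * real R * (4 * k) powr (p - 1) * (\<Sum>j<k. w j powr p)" by (simp add: sum_distrib_left)
  also have "\<dots> \<le> 4 * real R * (4 * k) powr (p - 1) * y powr p"
    unfolding y using p by (intro mult_left_mono sum_powr_le_powr_sum w0) auto
  finally show "\<mu> \<le> 4 * R * (4 * k) powr (p - 1) * y powr p" by simp
qed

lemma mean_phase1: "\<bar>(\<Sum>j<k. real (scaled z M 1 (x j)) / m') - Lam * y\<bar> \<le> 1"
proof -
  define w where "w j = real (x j) / thresh z M" for j
  have w0: "0 \<le> w j" for j using T0 by (simp add: w_def)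
  have y: "y = (\<Sum>j<k. w j)" by (simp add: y_def w_def sum_divide_distrib)
  have sc: "scaled z M 1 (x j) = nat \<lfloor>m' * (Lam * w j)\<rfloor>" for j
    by (simp add: scaled_def w_def mult.assoc)
  have "\<bar>real (scaled z M 1 (x j)) / m' - Lam * w j\<bar> \<le> 1 / m'" for j
  proof -
    have "0 \<le> m' * (Lam * w j)" using w0[of j] by simp
    then have "\<bar>real (nat \<lfloor>m' * (Lam * w j)\<rfloor>) - m' * (Lam * w j)\<bar> \<le> 1" by linarith
    then have "\<bar>real (nat \<lfloor>m' * (Lam * w j)\<rfloor>) - m' * (Lam * w j)\<bar> / m' \<le> 1 / m'" by (rule divide_right_mono) simp
    moreover have "\<bar>real (nat \<lfloor>m' * (Lam * w j)\<rfloor>) - m' * (Lam * w j)\<bar> / m'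
        = \<bar>(real (nat \<lfloor>m' * (Lam * w j)\<rfloor>) - m' * (Lam * w j)) / m'\<bar>" by simp
    ultimately show ?thesis using m'0 unfolding sc by (simp add: diff_divide_distrib)
  qed
  then have "(\<Sum>j<k. \<bar>real (scaled z M 1 (x j)) / m' - Lam * w j\<bar>) \<le> (\<Sum>j<k. 1 / m')" by (rule sum_mono)
  then have "(\<Sum>j<k. \<bar>real (scaled z M 1 (x j)) / m' - Lam * w j\<bar>) \<le> k / m'" by simp
  then have "\<bar>\<Sum>j<k. real (scaled z M 1 (x j)) / m' - Lam * w j\<bar> \<le> k / m'" by (rule order_trans[OF sum_abs])
  moreover have "k / real m' \<le> 1" using m' m'0 by simp
  ultimately show ?thesis by (simp add: sum_subtractf y sum_distrib_left)
qed

lemma ctot_eq: "h < 2 \<Longrightarrow> real (ctot M (z, \<theta>) h x) = (\<Sum>j<k. real ((scaled z M h (x j) + \<theta> j) div m'))"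
  by (simp add: ctot_def counter_def)

lemma phase_one_less: "(1::nat) < 2" by simp

lemma finite_dither: "finite (set_pmf (pmf_of_set {..<m'}))"
  using m'0 by (simp add: set_pmf_of_set lessThan_empty_iff)

text \<open>The mean is at least \<open>3 * R - 1\<close>, far enough above \<open>R\<close> for the
  lower tail; the leading 2 absorbs \<open>exp (1 / 2)\<close>.\<close>

lemma phase0_not_missed:
  assumes "1 \<le> y"
  shows "measure_pmf.prob dithers {\<theta>. ctot M (z, \<theta>) 0 x < R} \<le> 2 * exp (- real R / 3)"
proof -
  let ?\<mu> = "\<Sum>j<k. real (scaled z M 0 (x j)) / m'"
  have "measure_pmf.prob dithers {\<theta>. ctot M (z, \<theta>) 0 x < R}
    \<le> measure_pmf.prob dithers {\<theta>. - real R \<le> (\<Sum>j<k. - real ((scaled z M 0 (x j) + \<theta> j) div m'))}"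
    by (intro measure_pmf.finite_measure_mono) (auto simp: sum_negf ctot_eq[symmetric])
  also have "\<dots> \<le> 2 powr (- (- real R)) * exp (\<Sum>j<k. - (real (scaled z M 0 (x j)) / m') / 2)"
    unfolding dithers_def by (rule Pi_pmf_chernoff) (use mgf_dither_lower[OF m'0] finite_dither in auto)
  also have "(\<Sum>j<k. - (real (scaled z M 0 (x j)) / m') / 2) = - ?\<mu> / 2"
    by (simp only: sum_negf sum_divide_distrib[symmetric] minus_divide_left)
  also have "2 powr (- (- real R)) \<le> exp (real R)"
    using ln_2_less_1 by (simp add: powr_def mult_left_le)
  also have "exp (real R) * exp (- ?\<mu> / 2) \<le> 2 * exp (- real R / 3)"
  proof -
    have "4 * real R * 1 \<le> 4 * real R * y" using assms by (intro mult_left_mono) auto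
    then have "real R + (- ?\<mu> / 2) \<le> 1 / 2 + (- real R / 3)" using mean_phase0(2) by linarith
    then have "exp (real R + (- ?\<mu> / 2)) \<le> exp (1 / 2 + (- real R / 3))" by simp
    also have "\<dots> = exp (1/2) * exp (- real R / 3)" by (simp add: exp_add[symmetric])
    also have "\<dots> \<le> 2 * exp (- real R / 3)"
      using exp_bound_half[of "1/2 :: real"] by (intro mult_right_mono) auto
    finally show ?thesis by (simp only: exp_add)
  qed
  finally show ?thesis by (simp add: mult_right_mono)
qed

text \<open>The mean is at most \<open>R / 4\<close>, against which
  \<open>2 powr (- R) <= exp (- 2 * R / 3)\<close> leaves more than \<open>R / 3\<close> in the
  exponent.\<close>

lemma phase0_not_early:
  assumes "y \<le> 1 / 16"
  shows "measure_pmf.prob dithers {\<theta>. R \<le> ctot M (z, \<theta>) 0 x} \<le> 2 * exp (- real R / 3)"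
proof -
  let ?\<mu> = "\<Sum>j<k. real (scaled z M 0 (x j)) / m'"
  have "measure_pmf.prob dithers {\<theta>. R \<le> ctot M (z, \<theta>) 0 x}
    \<le> measure_pmf.prob dithers {\<theta>. real R \<le> (\<Sum>j<k. real ((scaled z M 0 (x j) + \<theta> j) div m'))}"
    by (intro measure_pmf.finite_measure_mono) (auto simp: ctot_eq[symmetric])
  also have "\<dots> \<le> 2 powr (- real R) * exp ?\<mu>"
    unfolding dithers_def by (rule Pi_pmf_chernoff) (use mgf_dither_upper[OF m'0] finite_dither in auto)
  also have "2 powr (- real R) \<le> exp (- real R * (2 / 3))"
    using mult_left_mono[OF ln2_ge_two_thirds, of "real R"] by (simp add: powr_def)
  also have "exp (- real R * (2 / 3)) * exp ?\<mu> \<le> 2 * exp (- real R / 3)"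
  proof -
    have "4 * real R * y \<le> 4 * real R * (1 / 16)" using assms by (intro mult_left_mono) auto
    then have "- real R * (2 / 3) + ?\<mu> \<le> - real R / 3" using mean_phase0(1) by linarith
    then have "exp (- real R * (2 / 3) + ?\<mu>) \<le> exp (- real R / 3)" by simp
    then show ?thesis using exp_ge_zero[of "- real R / 3"] unfolding exp_add by linarith
  qed
  finally show ?thesis by (simp add: mult_right_mono)
qed

lemma phase0_expectation:
  "measure_pmf.expectation dithers (\<lambda>\<theta>. real (ctot M (z, \<theta>) 0 x)) \<le> 4 * R * (4 * k) powr (p - 1) * y powr p"
proof -
  have "measure_pmf.expectation dithers (\<lambda>\<theta>. real (ctot M (z, \<theta>) 0 x))
     = (\<Sum>j<k. measure_pmf.expectation dithers (\<lambda>\<theta>. real ((scaled z M 0 (x j) + \<theta> j) div m')))"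
    unfolding ctot_eq[of 0, simplified]
    by (rule Bochner_Integration.integral_sum) (intro integrable_measure_pmf_finite finite_set_dithers)
  also have "\<dots> = (\<Sum>j<k. real (scaled z M 0 (x j)) / m')"
  proof (rule sum.cong)
    fix j assume j: "j \<in> {..<k}"
    have "measure_pmf.expectation (map_pmf (\<lambda>\<theta>. \<theta> j) dithers) (\<lambda>w. real ((scaled z M 0 (x j) + w) div m')) = real (scaled z M 0 (x j)) / m'"
      using j unfolding dithers_def by (subst Pi_pmf_component) (auto simp: expectation_dither[OF m'0])
    then show "measure_pmf.expectation dithers (\<lambda>\<theta>. real ((scaled z M 0 (x j) + \<theta> j) div m')) = real (scaled z M 0 (x j)) / m'" by simp
  qed simp
  finally show ?thesis using mean_phase0(3) by simp
qed

text \<open>Each server's rounding ranges over an interval of length 1, so Hoeffding's bound applies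
  with \<open>k\<close> terms. The added 1 covers the flooring in \<open>scaled\<close>.\<close>

lemma phase1_deviation:
  assumes "\<tau> \<ge> 0"
  shows "measure_pmf.prob dithers {\<theta>. \<tau> + 1 \<le> \<bar>real (ctot M (z, \<theta>) 1 x) - Lam * y\<bar>} \<le> 2 * exp (- 2 * \<tau>\<^sup>2 / k)"
proof -
  let ?X = "\<lambda>j w. real ((scaled z M 1 (x j) + w) div m')"
  have "measure_pmf.prob dithers {\<theta>. \<tau> + 1 \<le> \<bar>real (ctot M (z, \<theta>) 1 x) - Lam * y\<bar>}
    \<le> measure_pmf.prob dithers {\<theta>. \<tau> \<le> \<bar>(\<Sum>j<k. ?X j (\<theta> j)) - (\<Sum>j<k. measure_pmf.expectation (pmf_of_set {..<m'}) (?X j))\<bar>}"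
  proof (intro measure_pmf.finite_measure_mono subsetI CollectI)
    fix \<theta> assume "\<theta> \<in> {\<theta>. \<tau> + 1 \<le> \<bar>real (ctot M (z, \<theta>) 1 x) - Lam * y\<bar>}"
    then have "\<tau> + 1 \<le> \<bar>real (ctot M (z, \<theta>) 1 x) - Lam * y\<bar>" by blast
    then show "\<tau> \<le> \<bar>(\<Sum>j<k. ?X j (\<theta> j)) - (\<Sum>j<k. measure_pmf.expectation (pmf_of_set {..<m'}) (?X j))\<bar>"
      using mean_phase1 unfolding ctot_eq[OF phase_one_less] expectation_dither[OF m'0] by linarith
  qed simp
  also have "\<dots> \<le> 2 * exp (- 2 * \<tau>\<^sup>2 / card {..<k})"
    unfolding dithers_def
  proof (rule Pi_pmf_hoeffding[where l = "\<lambda>j. real (scaled z M 1 (x j) div m')"])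
    fix j w assume "w \<in> set_pmf (pmf_of_set {..<m'})"
    then have w: "w < m'" using m'0 by (simp add: set_pmf_of_set lessThan_empty_iff)
    let ?Z = "scaled z M 1 (x j)"
    have "?Z div m' \<le> (?Z + w) div m'" by (rule div_le_mono) simp
    moreover have "(?Z + w) div m' \<le> (?Z + m') div m'" using w by (intro div_le_mono) simp
    moreover have "(?Z + m') div m' = Suc (?Z div m')" using m'0 by simp
    ultimately show "real (?Z div m') \<le> ?X j w \<and> ?X j w \<le> real (?Z div m') + 1" by linarith
  qed (use k assms in \<open>auto simp: lessThan_empty_iff\<close>)
  finally show ?thesis by simp
qed

end

end

text \<open>Sums over some of the coordinates are treated as sums over all of them with zero terms,
  since judges and single classes see only part of the coins.\<close>

lemma Pi_pmf_tails:
  fixes X :: "'i \<Rightarrow> 'a \<Rightarrow> real"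
  assumes fin: "finite I" and J: "J \<subseteq> I" and fs: "finite (set_pmf p)"
    and X: "\<And>i x. i \<in> J \<Longrightarrow> x \<in> set_pmf p \<Longrightarrow> 0 \<le> X i x \<and> X i x \<le> 1"
  shows Pi_pmf_upper_tail: "(\<Sum>i\<in>J. measure_pmf.expectation p (X i)) \<le> \<mu> \<Longrightarrow>
      measure_pmf.prob (Pi_pmf I d (\<lambda>_. p)) {\<omega>. a \<le> (\<Sum>i\<in>J. X i (\<omega> i))} \<le> 2 powr (- a) * exp \<mu>"
    and Pi_pmf_lower_tail: "\<mu> \<le> (\<Sum>i\<in>J. measure_pmf.expectation p (X i)) \<Longrightarrow>
      measure_pmf.prob (Pi_pmf I d (\<lambda>_. p)) {\<omega>. (\<Sum>i\<in>J. X i (\<omega> i)) \<le> a} \<le> 2 powr a * exp (- \<mu> / 2)"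
proof -
  have s: "(\<Sum>i\<in>I. if i \<in> J then h i else 0) = (\<Sum>i\<in>J. h i)" for h :: "'i \<Rightarrow> real"
    using fin J by (simp add: sum.inter_restrict[symmetric] Int_absorb1)
  show "measure_pmf.prob (Pi_pmf I d (\<lambda>_. p)) {\<omega>. a \<le> (\<Sum>i\<in>J. X i (\<omega> i))} \<le> 2 powr (- a) * exp \<mu>"
    if \<mu>: "(\<Sum>i\<in>J. measure_pmf.expectation p (X i)) \<le> \<mu>"
  proof -
    have "measure_pmf.prob (Pi_pmf I d (\<lambda>_. p)) {\<omega>. a \<le> (\<Sum>i\<in>I. if i \<in> J then X i (\<omega> i) else 0)}
      \<le> 2 powr (- a) * exp (\<Sum>i\<in>I. if i \<in> J then measure_pmf.expectation p (X i) else 0)"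
      by (rule Pi_pmf_chernoff[where X = "\<lambda>i x. if i \<in> J then X i x else 0"])
         (use fin fs mgf_unit_interval(1)[OF fs X] in auto)
    also have "\<dots> \<le> 2 powr (- a) * exp \<mu>" using \<mu> by (simp add: s)
    finally show ?thesis by (simp add: s)
  qed
  show "measure_pmf.prob (Pi_pmf I d (\<lambda>_. p)) {\<omega>. (\<Sum>i\<in>J. X i (\<omega> i)) \<le> a} \<le> 2 powr a * exp (- \<mu> / 2)"
    if \<mu>: "\<mu> \<le> (\<Sum>i\<in>J. measure_pmf.expectation p (X i))"
  proof -
    have "measure_pmf.prob (Pi_pmf I d (\<lambda>_. p)) {\<omega>. - a \<le> (\<Sum>i\<in>I. if i \<in> J then - X i (\<omega> i) else 0)}
      \<le> 2 powr (- (- a)) * exp (\<Sum>i\<in>I. if i \<in> J then - measure_pmf.expectation p (X i) / 2 else 0)"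
      by (rule Pi_pmf_chernoff[where X = "\<lambda>i x. if i \<in> J then - X i x else 0"])
         (use fin fs mgf_unit_interval(2)[OF fs X] in auto)
    also have "(\<Sum>i\<in>I. if i \<in> J then - measure_pmf.expectation p (X i) / 2 else 0) = - (\<Sum>i\<in>J. measure_pmf.expectation p (X i)) / 2"
      unfolding s by (simp only: sum_negf sum_divide_distrib[symmetric] minus_divide_left)
    also have "2 powr (- (- a)) * exp (- (\<Sum>i\<in>J. measure_pmf.expectation p (X i)) / 2) \<le> 2 powr a * exp (- \<mu> / 2)"
      using \<mu> by simp
    finally show ?thesis by (simp add: s sum_negf)
  qed
qed

text \<open>\<open>e * Lam\<close> is the tolerated error of the phase 1 total; \<open>acc\<close>
  makes it exceed the fluctuation of \<open>k\<close> independent roundings. This is the origin of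
  \<open>sqrt k / \<epsilon>\<close>.\<close>

locale sketch_accuracy = sketch +
  fixes e :: real
  assumes e: "0 < e" "e \<le> 1 / 2" and acc: "2 * sqrt (real k * R) \<le> e * Lam"
begin

definition fail :: real where "fail = 2 * exp (- real R / 3)"

lemma fail_nonneg: "0 \<le> fail" by (simp add: fail_def)

definition fr :: "(nat \<Rightarrow> nat) \<Rightarrow> real" where "fr x = (\<Sum>j<k. real (x j))"

lemma fr_nonneg: "0 \<le> fr x" by (simp add: fr_def sum_nonneg)

lemma y_ge_iff:
  assumes "z \<ge> 1" "M > 0" "lam > 0"
  shows "lam \<le> y z M x \<longleftrightarrow> real z \<le> fr x powr p / M / lam powr p * m"
proof -
  have "lam \<le> y z M x \<longleftrightarrow> lam * thresh z M \<le> fr x"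
    using thresh_pos[OF assms(1,2)] by (simp add: y_def[OF assms(1,2)] fr_def le_divide_eq)
  then show ?thesis using thresh_le_iff[OF assms fr_nonneg] by simp
qed

lemma deviation:
  assumes "z \<ge> 1" "M > 0"
  shows "measure_pmf.prob dithers {\<theta>. e * Lam \<le> \<bar>real (ctot M (z, \<theta>) 1 x) - Lam * y z M x\<bar>} \<le> fail"
proof -
  \<comment> \<open>Gives Hoeffding's exponent the value \<open>R / 3\<close> of phase 0. One half
    of \<open>acc\<close> pays for \<open>\<tau>\<close>, the other for the 1 lost by
    flooring.\<close>
  define \<tau> where "\<tau> = sqrt (real k * R / 6)"
  have kR: "1 \<le> real k * R" using mult_mono[of 1 "real k" 1 "real R"] k R by simp
  have "\<tau> \<le> sqrt (real k * R)" unfolding \<tau>_def by (rule real_sqrt_le_mono) (use kR in simp)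
  moreover have "1 \<le> sqrt (real k * R)" using kR by simp
  ultimately have \<tau>: "\<tau> + 1 \<le> e * Lam" using acc by linarith
  have "measure_pmf.prob dithers {\<theta>. e * Lam \<le> \<bar>real (ctot M (z, \<theta>) 1 x) - Lam * y z M x\<bar>}
    \<le> measure_pmf.prob dithers {\<theta>. \<tau> + 1 \<le> \<bar>real (ctot M (z, \<theta>) 1 x) - Lam * y z M x\<bar>}"
    by (intro measure_pmf.finite_measure_mono subsetI CollectI) (use \<tau> in auto)
  also have "\<dots> \<le> 2 * exp (- 2 * \<tau>\<^sup>2 / k)" by (rule phase1_deviation[OF assms]) (simp add: \<tau>_def)
  also have "- 2 * \<tau>\<^sup>2 / k = - real R / 3" using k by (simp add: \<tau>_def)
  finally show ?thesis by (simp add: fail_def)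
qed

text \<open>Below \<open>1 - e\<close> times the threshold, detection requires a deviation of at
  least \<open>e * Lam\<close>. Moving the threshold by this factor changes the probability by its
  \<open>p\<close>-th power.\<close>

lemma prob_detected_le:
  assumes M: "M > 0"
  shows "measure_pmf.prob unit_coin {u. cph M u x = 2} \<le> fr x powr p / M / (1 - e) powr p + fail"
proof (rule prob_unit_coin_le)
  fix z assume "z \<in> {1..m}"
  then have z: "z \<ge> 1" by simp
  show "measure_pmf.prob dithers {\<theta>. (z, \<theta>) \<in> {u. cph M u x = 2}}
      \<le> (if real z \<le> fr x powr p / M / (1 - e) powr p * m then 1 else 0) + fail"
  proof (cases "real z \<le> fr x powr p / M / (1 - e) powr p * m")
    case True
    have "measure_pmf.prob dithers A \<le> 1" for A by simp
    then show ?thesis using True fail_nonneg by (smt (verit))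
  next
    case False
    then have "y z M x < 1 - e" using y_ge_iff[OF z M, of "1 - e" x] e by simp
    then have yl: "Lam * y z M x \<le> Lam * (1 - e)" by (intro mult_left_mono) auto
    have "measure_pmf.prob dithers {\<theta>. (z, \<theta>) \<in> {u. cph M u x = 2}}
      \<le> measure_pmf.prob dithers {\<theta>. e * Lam \<le> \<bar>real (ctot M (z, \<theta>) 1 x) - Lam * y z M x\<bar>}"
    proof (intro measure_pmf.finite_measure_mono subsetI CollectI)
      fix \<theta> assume "\<theta> \<in> {\<theta>. (z, \<theta>) \<in> {u. cph M u x = 2}}"
      then have "cph M (z, \<theta>) x = 2" by simp
      then have "Lam \<le> ctot M (z, \<theta>) 1 x" by (auto simp: cph_def split: if_splits)
      then have "real Lam \<le> real (ctot M (z, \<theta>) 1 x)" by (simp only: of_nat_le_iff)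
      then show "e * Lam \<le> \<bar>real (ctot M (z, \<theta>) 1 x) - Lam * y z M x\<bar>"
        using yl by (simp only: right_diff_distrib mult.commute[of e] mult_1_right)
    qed simp
    also have "\<dots> \<le> fail" by (rule deviation[OF z M])
    finally show ?thesis using False by simp
  qed
qed (use M in simp)

lemma prob_detected_ge:
  assumes M: "M > 0"
  shows "min 1 (fr x powr p / M / (1 + e) powr p) - 1 / m - 2 * fail \<le> measure_pmf.prob unit_coin {u. cph M u x = 2}"
proof (rule prob_unit_coin_ge)
  fix z assume "z \<in> {1..m}"
  then have z: "z \<ge> 1" by simp
  show "(if real z \<le> fr x powr p / M / (1 + e) powr p * m then 1 else 0) - 2 * fail
      \<le> measure_pmf.prob dithers {\<theta>. (z, \<theta>) \<in> {u. cph M u x = 2}}"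
  proof (cases "real z \<le> fr x powr p / M / (1 + e) powr p * m")
    case False
    have "0 \<le> measure_pmf.prob dithers A" for A by simp
    then show ?thesis using False fail_nonneg by (smt (verit))
  next
    case True
    then have y: "1 + e \<le> y z M x" using y_ge_iff[OF z M, of "1 + e" x] e by simp
    then have yl: "Lam * (1 + e) \<le> Lam * y z M x" by (intro mult_left_mono) auto
    let ?A = "{\<theta>. ctot M (z, \<theta>) 0 x < R}" and ?B = "{\<theta>. e * Lam \<le> \<bar>real (ctot M (z, \<theta>) 1 x) - Lam * y z M x\<bar>}"
    \<comment> \<open>A miss happens in phase 0 or in phase 1, hence
      \<open>2 * fail\<close>.\<close>
    have "- {\<theta>. (z, \<theta>) \<in> {u. cph M u x = 2}} \<subseteq> ?A \<union> ?B"
    proof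
      fix \<theta> assume "\<theta> \<in> - {\<theta>. (z, \<theta>) \<in> {u. cph M u x = 2}}"
      then consider "ctot M (z, \<theta>) 0 x < R" | "ctot M (z, \<theta>) 1 x < Lam" by (auto simp: cph_def split: if_splits)
      then show "\<theta> \<in> ?A \<union> ?B"
      proof cases
        case 2
        then have "real (ctot M (z, \<theta>) 1 x) \<le> real Lam" by (simp only: of_nat_le_iff less_imp_le)
        then have "e * Lam \<le> \<bar>real (ctot M (z, \<theta>) 1 x) - Lam * y z M x\<bar>"
          using yl by (simp only: distrib_left mult.commute[of e] mult_1_right)
        then show ?thesis by blast
      qed simp
    qed
    then have "measure_pmf.prob dithers (- {\<theta>. (z, \<theta>) \<in> {u. cph M u x = 2}}) \<le> measure_pmf.prob dithers (?A \<union> ?B)"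
      by (intro measure_pmf.finite_measure_mono) auto
    also have "\<dots> \<le> measure_pmf.prob dithers ?A + measure_pmf.prob dithers ?B" by (rule measure_Un_le) auto
    also have "\<dots> \<le> fail + fail"
      using phase0_not_missed[OF z M, of x] y e deviation[OF z M, of x] by (intro add_mono) (auto simp: fail_def)
    finally have "measure_pmf.prob dithers (- {\<theta>. (z, \<theta>) \<in> {u. cph M u x = 2}}) \<le> 2 * fail" by simp
    then show ?thesis using True measure_pmf.prob_compl[of "{\<theta>. (z, \<theta>) \<in> {u. cph M u x = 2}}" dithers]
      by (simp add: Compl_eq_Diff_UNIV)
  qed
qed (use M in simp)

text \<open>\<open>16 powr p\<close> stems from phase 0 being unlikely to end before
  \<open>1 / 16\<close> of the threshold.\<close>

lemma prob_tracked_le: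
  assumes M: "M > 0"
  shows "measure_pmf.prob unit_coin {u. cph M u x \<noteq> 0} \<le> 16 powr p * (fr x powr p / M) + fail"
proof -
  have "measure_pmf.prob unit_coin {u. cph M u x \<noteq> 0} \<le> fr x powr p / M / (1 / 16) powr p + fail"
  proof (rule prob_unit_coin_le)
    fix z assume "z \<in> {1..m}"
    then have z: "z \<ge> 1" by simp
    show "measure_pmf.prob dithers {\<theta>. (z, \<theta>) \<in> {u. cph M u x \<noteq> 0}}
        \<le> (if real z \<le> fr x powr p / M / (1 / 16) powr p * m then 1 else 0) + fail"
    proof (cases "real z \<le> fr x powr p / M / (1 / 16) powr p * m")
      case True
      have "measure_pmf.prob dithers A \<le> 1" for A by simp
      then show ?thesis using True fail_nonneg by (smt (verit))
    next
      case False
      then have "y z M x \<le> 1 / 16" using y_ge_iff[OF z M, of "1 / 16" x] by simp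
      moreover have "{\<theta>. (z, \<theta>) \<in> {u. cph M u x \<noteq> 0}} = {\<theta>. R \<le> ctot M (z, \<theta>) 0 x}"
        by (auto simp: cph_def)
      ultimately show ?thesis using phase0_not_early[OF z M, of x] False by (simp add: fail_def)
    qed
  qed (use M in simp)
  then show ?thesis by (simp add: powr_divide mult.commute)
qed

text \<open>For fixed \<open>z\<close> the bound involves \<open>y powr p\<close>, which is
  inversely proportional to \<open>z\<close>; averaging gives a harmonic sum, so small thresholds
  cost only a logarithm. Division by \<open>R\<close> makes the variable fit the Chernoff
  bounds.\<close>

lemma expectation_reports_le:
  assumes M: "M > 0"
  shows "measure_pmf.expectation unit_coin (\<lambda>u. real (min (ctot M u 0 x) R) / R)
    \<le> 4 * (4 * k) powr (p - 1) * (\<Sum>z=1..m. 1 / real z) * (fr x powr p / M)"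
proof -
  have "measure_pmf.expectation dithers (\<lambda>\<theta>. real (min (ctot M (z, \<theta>) 0 x) R) / R)
     \<le> 4 * (4 * k) powr (p - 1) * (fr x powr p / M * m / z)" if "z \<in> {1..m}" for z
  proof -
    have z: "z \<ge> 1" using that by simp
    have T: "thresh z M powr p = real z * M / m" using M p m by (simp add: thresh_def powr_powr)
    have yp: "y z M x powr p = fr x powr p / M * m / z"
      using fr_nonneg[of x] thresh_nonneg[of z M] unfolding y_def[OF z M] fr_def[symmetric]
      by (simp add: powr_divide T)
    have "measure_pmf.expectation dithers (\<lambda>\<theta>. real (min (ctot M (z, \<theta>) 0 x) R) / R)
      \<le> measure_pmf.expectation dithers (\<lambda>\<theta>. real (ctot M (z, \<theta>) 0 x) / R)"
      by (intro integral_mono integrable_measure_pmf_finite finite_set_dithers divide_right_mono) auto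
    also have "\<dots> = measure_pmf.expectation dithers (\<lambda>\<theta>. real (ctot M (z, \<theta>) 0 x)) / R" by simp
    also have "\<dots> \<le> 4 * R * (4 * k) powr (p - 1) * y z M x powr p / R"
      by (intro divide_right_mono phase0_expectation[OF z M]) simp
    also have "\<dots> = 4 * (4 * k) powr (p - 1) * y z M x powr p" using R by simp
    finally show ?thesis by (simp add: yp)
  qed
  then have "measure_pmf.expectation unit_coin (\<lambda>u. real (min (ctot M u 0 x) R) / R)
    \<le> (\<Sum>z=1..m. 4 * (4 * k) powr (p - 1) * (fr x powr p / M * m / z)) / m"
    unfolding expectation_unit_coin by (intro divide_right_mono sum_mono) auto
  also have "\<dots> = 4 * (4 * k) powr (p - 1) * (\<Sum>z=1..m. 1 / real z) * (fr x powr p / M)"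
    using m by (simp add: sum_divide_distrib sum_distrib_left sum_distrib_right mult_ac)
  finally show ?thesis .
qed

end

text \<open>Capping each probability at 1 does no harm to a lower bound of 1 on their sum: a single
  term that is capped already suffices.\<close>

lemma min_one_sum_le:
  fixes a :: "'a \<Rightarrow> real"
  assumes "finite A" "\<And>x. x \<in> A \<Longrightarrow> 0 \<le> a x"
  shows "min 1 (\<Sum>x\<in>A. a x) \<le> (\<Sum>x\<in>A. min 1 (a x))"
proof (cases "\<exists>x\<in>A. 1 \<le> a x")
  case True
  then obtain x where x: "x \<in> A" "1 \<le> a x" by blast
  then have "min 1 (a x) \<le> (\<Sum>x\<in>A. min 1 (a x))" by (intro member_le_sum) (use assms in auto)
  then show ?thesis using x by linarith
next
  case False
  then have "(\<Sum>x\<in>A. min 1 (a x)) = (\<Sum>x\<in>A. a x)" by (intro sum.cong) (auto simp: min_def)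
  then show ?thesis by simp
qed

lemma two_powr_exp_le: fixes x :: real shows "0 \<le> x \<Longrightarrow> 2 powr x \<le> exp x"
  using ln_2_less_1 by (simp add: powr_def mult_left_le)

lemma two_powr_neg_le: fixes x :: real shows "0 \<le> x \<Longrightarrow> 2 powr (- x) \<le> exp (- x * (2 / 3))"
  using mult_left_mono[OF ln2_ge_two_thirds, of x] by (simp add: powr_def)

context sketch
begin

lemma ctot_mono: "(\<And>j. x j \<le> x' j) \<Longrightarrow> ctot M u h x \<le> ctot M u h x'"
  unfolding ctot_def by (intro sum_mono counter_mono)

lemma cph_mono: "(\<And>j. x j \<le> x' j) \<Longrightarrow> cph M u x \<le> cph M u x'"
  using ctot_mono[of x x' M u 0] ctot_mono[of x x' M u 1] by (auto simp: cph_def)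

lemma cph_le: "cph M u x \<le> 2"
  by (simp add: cph_def)

end

section \<open>All scales\<close>

text \<open>
  Class \<open>(r, 0)\<close> provides the estimate at level \<open>r\<close>, the classes \<open>(r, q)\<close> with \<open>q \<ge> 1\<close> only judge whether
  level \<open>r\<close> has been passed. The level in use is the first one not yet passed; the factor \<open>2 powr p\<close> in
  the scale of \<open>(r, 0)\<close> ensures that the scale is then still above \<open>F x\<close>.
\<close>

locale sketch_levels = sketch_accuracy +
  fixes n L :: nat
  assumes small: "real n * (1 / m + 2 * fail) \<le> e / 16"
begin

definition classes :: "(nat \<times> nat) set" where "classes = {..L} \<times> {..4 * R}"

definition scale :: "nat \<times> nat \<Rightarrow> real" where
  "scale c = (if snd c = 0 then 2 powr p else 1) * 2 ^ fst c"

definition coins :: "((nat \<times> nat) \<times> nat \<Rightarrow> nat \<times> (nat \<Rightarrow> nat)) pmf" where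
  "coins = Pi_pmf (classes \<times> {..<n}) (1, \<lambda>_. 0) (\<lambda>_. unit_coin)"

definition gF :: "((nat \<times> nat) \<times> nat \<Rightarrow> nat \<times> (nat \<Rightarrow> nat)) \<Rightarrow> nat \<times> nat \<Rightarrow> nat \<Rightarrow> nat \<Rightarrow> nat \<Rightarrow> nat \<Rightarrow> nat" where
  "gF \<omega> c h j i v = counter (scale c) (\<omega> (c, i)) h j v"

sublocale monitor_base k thr gF .

lemma tot_eq: "tot \<omega> c h i x = ctot (scale c) (\<omega> (c, i)) h (\<lambda>j. x j i)"
  by (simp add: tot_def ctot_def gF_def)

lemma ph_eq: "ph \<omega> c i x = cph (scale c) (\<omega> (c, i)) (\<lambda>j. x j i)"
  by (simp add: ph_def cph_def tot_eq thr_def)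

definition judges :: "nat \<Rightarrow> ((nat \<times> nat) \<times> nat) set" where
  "judges r = (Pair r ` {1..4 * R}) \<times> {..<n}"

text \<open>There are \<open>4 * R\<close> judging classes per level. The expected number of
  detections is at least \<open>3 * R\<close> or at most \<open>R / 4\<close> once
  \<open>F x\<close> is well above or well below the scale; \<open>R\<close> lies in
  between.\<close>

definition passed :: "((nat \<times> nat) \<times> nat \<Rightarrow> nat \<times> (nat \<Rightarrow> nat)) \<Rightarrow> nat \<Rightarrow> (nat \<Rightarrow> nat \<Rightarrow> nat) \<Rightarrow> bool" where
  "passed \<omega> r x \<longleftrightarrow> R \<le> card {a \<in> judges r. ph \<omega> (fst a) (snd a) x = 2}"

definition rs :: "((nat \<times> nat) \<times> nat \<Rightarrow> nat \<times> (nat \<Rightarrow> nat)) \<Rightarrow> (nat \<Rightarrow> nat \<Rightarrow> nat) \<Rightarrow> nat" where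
  "rs \<omega> x = (LEAST r. L < r \<or> \<not> passed \<omega> r x)"

definition hits :: "((nat \<times> nat) \<times> nat \<Rightarrow> nat \<times> (nat \<Rightarrow> nat)) \<Rightarrow> nat \<Rightarrow> (nat \<Rightarrow> nat \<Rightarrow> nat) \<Rightarrow> nat" where
  "hits \<omega> r x = card {i. i < n \<and> ph \<omega> (r, 0) i x = 2}"

definition est :: "((nat \<times> nat) \<times> nat \<Rightarrow> nat \<times> (nat \<Rightarrow> nat)) \<Rightarrow> (nat \<Rightarrow> nat \<Rightarrow> nat) \<Rightarrow> real" where
  "est \<omega> x = (if rs \<omega> x \<le> L then scale (rs \<omega> x, 0) * hits \<omega> (rs \<omega> x) x else 0)"

lemma scale_pos: "0 < scale c" by (simp add: scale_def)

lemma finite_judges: "finite (judges r)" by (simp add: judges_def)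

lemma finite_classes: "finite classes" by (simp add: classes_def)

lemma judges_subset: "r \<le> L \<Longrightarrow> judges r \<subseteq> classes \<times> {..<n}"
  by (auto simp: judges_def classes_def)

lemma passed_mono: "(\<And>j i. x j i \<le> x' j i) \<Longrightarrow> passed \<omega> r x \<Longrightarrow> passed \<omega> r x'"
proof -
  assume le: "\<And>j i. x j i \<le> x' j i" and "passed \<omega> r x"
  moreover have "ph \<omega> c i x' = 2" if "ph \<omega> c i x = 2" for c i
    using cph_mono[of "\<lambda>j. x j i" "\<lambda>j. x' j i" "scale c" "\<omega> (c, i)"] cph_le[of "scale c" "\<omega> (c, i)" "\<lambda>j. x' j i"] that le
    by (simp add: ph_eq)
  then have "card {a \<in> judges r. ph \<omega> (fst a) (snd a) x = 2} \<le> card {a \<in> judges r. ph \<omega> (fst a) (snd a) x' = 2}"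
    by (intro card_mono) (auto simp: finite_judges)
  ultimately show ?thesis by (simp add: passed_def)
qed

lemma rs_props: "rs \<omega> x \<le> Suc L" "L < rs \<omega> x \<or> \<not> passed \<omega> (rs \<omega> x) x" "r < rs \<omega> x \<Longrightarrow> r \<le> L \<and> passed \<omega> r x"
proof -
  show "rs \<omega> x \<le> Suc L" unfolding rs_def by (rule Least_le) simp
  show "L < rs \<omega> x \<or> \<not> passed \<omega> (rs \<omega> x) x" unfolding rs_def by (rule LeastI[of _ "Suc L"]) simp
  show "r < rs \<omega> x \<Longrightarrow> r \<le> L \<and> passed \<omega> r x" unfolding rs_def using not_less_Least by fastforce
qed

text \<open>For \<open>rs_cong\<close>, levels already passed remain passed by monotonicity, so only
  the judges of the current level matter, and these are still monitored.\<close>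

sublocale monitor_levels k thr gF n "Suc L" classes fst rs
proof
  show rm: "rs l x \<le> rs l y" if "\<And>j i. x j i \<le> y j i" for l x y
    unfolding rs_def[of l x]
    by (rule Least_le) (use rs_props(2)[of l y] passed_mono[of x y l "rs l y"] that in blast)
  show "rs l y = rs l x" if le: "\<And>j i. x j i \<le> y j i"
    and eq: "\<And>c i. c \<in> classes \<Longrightarrow> i < n \<Longrightarrow> rs l x \<le> fst c \<Longrightarrow> ph l c i x = ph l c i y" for l x y
  proof (rule antisym)
    have "L < rs l x \<or> \<not> passed l (rs l x) y"
    proof (cases "L < rs l x")
      case False
      then have "ph l (fst a) (snd a) x = ph l (fst a) (snd a) y" if "a \<in> judges (rs l x)" for a
        using that by (intro eq) (auto simp: judges_def classes_def)
      then have "{a \<in> judges (rs l x). ph l (fst a) (snd a) x = 2} = {a \<in> judges (rs l x). ph l (fst a) (snd a) y = 2}"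
        by auto
      then show ?thesis using rs_props(2)[of l x] False by (simp add: passed_def)
    qed simp
    then show "rs l y \<le> rs l x" unfolding rs_def[of l y] by (rule Least_le)
  qed (rule rm, rule le)
qed (auto simp: finite_classes gF_def counter_mono rs_props(1), simp add: counter_def)

definition F :: "(nat \<Rightarrow> nat \<Rightarrow> nat) \<Rightarrow> real" where
  "F x = (\<Sum>i<n. fr (\<lambda>j. x j i) powr p)"

lemma F_nonneg: "0 \<le> F x" by (simp add: F_def sum_nonneg)

lemma card_eq_sum_indicator:
  "finite A \<Longrightarrow> real (card {a \<in> A. f (\<omega> a) a}) = (\<Sum>a\<in>A. indicator {u. f u a} (\<omega> a))"
  by (simp add: indicator_def sum.If_cases Int_def)

lemma sum_judges: "(\<Sum>a\<in>judges r. h (snd a)) = 4 * real R * (\<Sum>i<n. h i)"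
proof -
  have "(\<Sum>a\<in>judges r. h (snd a)) = (\<Sum>c\<in>Pair r ` {1..4 * R}. \<Sum>i<n. h i)"
    unfolding judges_def sum.cartesian_product by (simp add: case_prod_unfold)
  also have "\<dots> = real (card (Pair r ` {1..4 * R})) * (\<Sum>i<n. h i)" by simp
  also have "card (Pair r ` {1..4 * R}) = 4 * R" by (subst card_image) (auto simp: inj_on_def)
  finally show ?thesis by simp
qed

lemma scale_judges: "a \<in> judges r \<Longrightarrow> scale (fst a) = 2 ^ r"
  by (auto simp: judges_def scale_def)

lemma judged_eq:
  "{a \<in> judges r. ph \<omega> (fst a) (snd a) x = 2} = {a \<in> judges r. cph (2 ^ r) (\<omega> a) (\<lambda>j. x j (snd a)) = 2}"
  by (intro Collect_cong conj_cong refl) (simp add: ph_eq scale_judges)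

lemma small': "real n / m \<le> e / 16" "real n * fail \<le> e / 32" "e / 16 \<le> 1 / 32"
proof -
  have "0 \<le> real n / m" "0 \<le> real n * fail" by (simp_all add: fail_nonneg)
  moreover have "real n / m + 2 * (real n * fail) \<le> e / 16" using small by (simp add: algebra_simps)
  ultimately show "real n / m \<le> e / 16" "real n * fail \<le> e / 32" by linarith+
  show "e / 16 \<le> 1 / 32" using e by simp
qed

text \<open>The factor \<open>2 powr p\<close> exceeds \<open>(1 + e) powr p\<close>, so the capped
  detection probabilities sum to at least 1 before the small errors; \<open>3 / 4\<close> remains,
  hence a mean of at least \<open>3 * R\<close>.\<close>

lemma prob_not_passed:
  assumes r: "r \<le> L" and F: "2 powr p * 2 ^ r \<le> F x"
  shows "measure_pmf.prob coins {\<omega>. \<not> passed \<omega> r x} \<le> fail"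
proof -
  define P where "P i = measure_pmf.prob unit_coin {u. cph (2 ^ r) u (\<lambda>j. x j i) = 2}" for i
  define v where "v i = fr (\<lambda>j. x j i) powr p / 2 ^ r" for i
  have "1 \<le> (\<Sum>i<n. v i / (1 + e) powr p)"
  proof -
    have "(1 + e) powr p \<le> 2 powr p" using e p by (intro powr_mono2) auto
    moreover have "2 powr p \<le> (\<Sum>i<n. v i)" using F by (simp add: F_def v_def sum_divide_distrib[symmetric] le_divide_eq)
    ultimately have "(1 + e) powr p \<le> (\<Sum>i<n. v i)" by linarith
    then show ?thesis using e by (simp add: sum_divide_distrib[symmetric] le_divide_eq)
  qed
  then have "1 \<le> (\<Sum>i<n. min 1 (v i / (1 + e) powr p))"
    using min_one_sum_le[of "{..<n}" "\<lambda>i. v i / (1 + e) powr p"] by (simp add: v_def)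
  moreover have "(\<Sum>i<n. min 1 (v i / (1 + e) powr p) - 1 / m - 2 * fail) \<le> (\<Sum>i<n. P i)"
    unfolding P_def v_def by (intro sum_mono prob_detected_ge) simp
  ultimately have P: "3 / 4 \<le> (\<Sum>i<n. P i)" using small' by (simp add: sum_subtractf)
  have "measure_pmf.prob coins {\<omega>. \<not> passed \<omega> r x}
    \<le> measure_pmf.prob coins {\<omega>. (\<Sum>a\<in>judges r. indicator {u. cph (2 ^ r) u (\<lambda>j. x j (snd a)) = 2} (\<omega> a)) \<le> real R}"
  proof (intro measure_pmf.finite_measure_mono subsetI CollectI)
    fix \<omega> assume "\<omega> \<in> {\<omega>. \<not> passed \<omega> r x}"
    then have "real (card {a \<in> judges r. ph \<omega> (fst a) (snd a) x = 2}) \<le> R" by (simp add: passed_def)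
    moreover have "{a \<in> judges r. ph \<omega> (fst a) (snd a) x = 2} = {a \<in> judges r. cph (2 ^ r) (\<omega> a) (\<lambda>j. x j (snd a)) = 2}"
      by (rule judged_eq)
    ultimately show "(\<Sum>a\<in>judges r. indicator {u. cph (2 ^ r) u (\<lambda>j. x j (snd a)) = 2} (\<omega> a)) \<le> real R"
      using card_eq_sum_indicator[OF finite_judges, of r "\<lambda>u a. cph (2 ^ r) u (\<lambda>j. x j (snd a)) = 2" \<omega>] by simp
  qed simp
  also have "\<dots> \<le> 2 powr R * exp (- (3 * real R) / 2)"
    unfolding coins_def
  proof (rule Pi_pmf_lower_tail)
    have "(\<Sum>a\<in>judges r. measure_pmf.expectation unit_coin (indicator {u. cph (2 ^ r) u (\<lambda>j. x j (snd a)) = 2}))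
       = 4 * real R * (\<Sum>i<n. P i)" using sum_judges[of P r] by (simp add: P_def)
    moreover have "4 * real R * (3 / 4) \<le> 4 * real R * (\<Sum>i<n. P i)" by (intro mult_left_mono P) simp
    ultimately show "3 * real R \<le> (\<Sum>a\<in>judges r. measure_pmf.expectation unit_coin (indicator {u. cph (2 ^ r) u (\<lambda>j. x j (snd a)) = 2}))"
      by simp
  qed (use finite_classes judges_subset[OF r] finite_set_unit_coin in auto)
  also have "\<dots> \<le> exp R * exp (- (3 * real R) / 2)" by (intro mult_right_mono two_powr_exp_le) auto
  also have "\<dots> \<le> exp (- real R / 3)" unfolding exp_add[symmetric] by simp
  also have "\<dots> \<le> fail" by (simp add: fail_def)
  finally show ?thesis .
qed

lemma detected_le_two_powr:
  assumes "M > 0"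
  shows "measure_pmf.prob unit_coin {u. cph M u x = 2} \<le> 2 powr p * (fr x powr p / M) + fail"
proof -
  have "(1 / 2) powr p \<le> (1 - e) powr p" using e p by (intro powr_mono2) auto
  then have "fr x powr p / M / (1 - e) powr p \<le> fr x powr p / M / (1 / 2) powr p"
    using assms e by (intro divide_left_mono) auto
  also have "\<dots> = 2 powr p * (fr x powr p / M)" by (simp add: powr_divide)
  finally show ?thesis using prob_detected_le[OF assms, of x] by linarith
qed

text \<open>One \<open>2 powr p\<close> in the assumption compensates the early detections of
  \<open>detected_le_two_powr\<close>; the remaining \<open>2 powr 5\<close> brings the mean below
  \<open>R / 4\<close>, errors included.\<close>

lemma prob_passed_early:
  assumes r: "r \<le> L" and F: "2 powr (p + 5) * F x \<le> 2 ^ r"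
  shows "measure_pmf.prob coins {\<omega>. passed \<omega> r x} \<le> fail"
proof -
  define P where "P i = measure_pmf.prob unit_coin {u. cph (2 ^ r) u (\<lambda>j. x j i) = 2}" for i
  have "(\<Sum>i<n. P i) \<le> (\<Sum>i<n. 2 powr p * (fr (\<lambda>j. x j i) powr p / 2 ^ r) + fail)"
    unfolding P_def by (intro sum_mono detected_le_two_powr) simp
  also have "\<dots> = 2 powr p * (F x / 2 ^ r) + n * fail"
    by (simp add: sum.distrib F_def sum_divide_distrib sum_distrib_left)
  also have "2 powr p * (F x / 2 ^ r) \<le> 1 / 32"
    using F by (simp add: powr_add field_simps)
  finally have P: "(\<Sum>i<n. P i) \<le> 1 / 16" using small' by linarith
  have "measure_pmf.prob coins {\<omega>. passed \<omega> r x}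
    \<le> measure_pmf.prob coins {\<omega>. real R \<le> (\<Sum>a\<in>judges r. indicator {u. cph (2 ^ r) u (\<lambda>j. x j (snd a)) = 2} (\<omega> a))}"
  proof (intro measure_pmf.finite_measure_mono subsetI CollectI)
    fix \<omega> assume "\<omega> \<in> {\<omega>. passed \<omega> r x}"
    then have "real R \<le> real (card {a \<in> judges r. ph \<omega> (fst a) (snd a) x = 2})" by (simp add: passed_def)
    moreover have "{a \<in> judges r. ph \<omega> (fst a) (snd a) x = 2} = {a \<in> judges r. cph (2 ^ r) (\<omega> a) (\<lambda>j. x j (snd a)) = 2}"
      by (rule judged_eq)
    ultimately show "real R \<le> (\<Sum>a\<in>judges r. indicator {u. cph (2 ^ r) u (\<lambda>j. x j (snd a)) = 2} (\<omega> a))"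
      using card_eq_sum_indicator[OF finite_judges, of r "\<lambda>u a. cph (2 ^ r) u (\<lambda>j. x j (snd a)) = 2" \<omega>] by simp
  qed simp
  also have "\<dots> \<le> 2 powr (- real R) * exp (real R / 4)"
    unfolding coins_def
  proof (rule Pi_pmf_upper_tail)
    have "(\<Sum>a\<in>judges r. measure_pmf.expectation unit_coin (indicator {u. cph (2 ^ r) u (\<lambda>j. x j (snd a)) = 2}))
       = 4 * real R * (\<Sum>i<n. P i)" using sum_judges[of P r] by (simp add: P_def)
    moreover have "4 * real R * (\<Sum>i<n. P i) \<le> 4 * real R * (1 / 16)" by (intro mult_left_mono P) simp
    ultimately show "(\<Sum>a\<in>judges r. measure_pmf.expectation unit_coin (indicator {u. cph (2 ^ r) u (\<lambda>j. x j (snd a)) = 2})) \<le> real R / 4"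
      by simp
  qed (use finite_classes judges_subset[OF r] finite_set_unit_coin in auto)
  also have "\<dots> \<le> exp (- real R * (2 / 3)) * exp (real R / 4)" by (intro mult_right_mono two_powr_neg_le) auto
  also have "\<dots> \<le> exp (- real R / 3)" unfolding exp_add[symmetric] by simp
  also have "\<dots> \<le> fail" by (simp add: fail_def)
  finally show ?thesis .
qed

text \<open>The additive \<open>R\<close> yields the same failure probability whatever the mean is,
  even if it is close to 0.\<close>

lemma upper_tail_two_mu:
  fixes X :: "nat \<Rightarrow> nat \<times> (nat \<Rightarrow> nat) \<Rightarrow> real"
  assumes c: "c \<in> classes" and X: "\<And>i u. 0 \<le> X i u \<and> X i u \<le> 1"
    and \<mu>: "(\<Sum>i<n. measure_pmf.expectation unit_coin (X i)) \<le> \<mu>" "0 \<le> \<mu>"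
  shows "measure_pmf.prob coins {\<omega>. 2 * \<mu> + R \<le> (\<Sum>i<n. X i (\<omega> (c, i)))} \<le> fail"
proof -
  have r: "(\<Sum>a\<in>Pair c ` {..<n}. h (snd a) a) = (\<Sum>i<n. h i (c, i))" for h :: "nat \<Rightarrow> _ \<Rightarrow> real"
    by (subst sum.reindex) (auto simp: inj_on_def)
  have "measure_pmf.prob coins {\<omega>. 2 * \<mu> + R \<le> (\<Sum>a\<in>Pair c ` {..<n}. X (snd a) (\<omega> a))} \<le> 2 powr (- (2 * \<mu> + R)) * exp \<mu>"
    unfolding coins_def
    by (rule Pi_pmf_upper_tail) (use finite_classes c finite_set_unit_coin X \<mu> r[of "\<lambda>i _. measure_pmf.expectation unit_coin (X i)"] in auto)
  also have "\<dots> \<le> exp (- (2 * \<mu> + R) * (2 / 3)) * exp \<mu>" by (intro mult_right_mono two_powr_neg_le) (use \<mu>(2) in auto)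
  also have "\<dots> \<le> exp (- real R / 3)"
  proof -
    have "- (2 * \<mu> + R) * (2 / 3) + \<mu> \<le> - real R / 3" using \<mu>(2) by (simp add: field_simps)
    then show ?thesis unfolding exp_add[symmetric] by simp
  qed
  also have "\<dots> \<le> fail" by (simp add: fail_def)
  finally show ?thesis using r[of "\<lambda>i a. X i (\<omega> a)" for \<omega>] by simp
qed

text \<open>Here and in \<open>mu_tracked\<close>, \<open>\<kappa>\<close> bounds the ratio of
  \<open>F x\<close> to \<open>2 ^ r\<close>.\<close>

definition mu_reports :: "real \<Rightarrow> real" where
  "mu_reports \<kappa> = 4 * (4 * k) powr (p - 1) * (\<Sum>z=1..m. 1 / real z) * \<kappa>"

definition mu_tracked :: "real \<Rightarrow> real" where
  "mu_tracked \<kappa> = 16 powr p * \<kappa> + 1"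

lemma prob_many_reports:
  assumes c: "c \<in> classes" and F: "F x \<le> \<kappa> * 2 ^ fst c"
  shows "measure_pmf.prob coins {\<omega>. R * (2 * mu_reports \<kappa> + R) \<le> (\<Sum>i<n. real (min (tot \<omega> c 0 i x) R))} \<le> fail"
proof -
  have sc: "2 ^ fst c \<le> scale c" using p ge_one_powr_ge_zero[of 2 p] by (auto simp: scale_def)
  have Fs: "F x / scale c \<le> \<kappa>"
  proof -
    have "F x / scale c \<le> F x / 2 ^ fst c" using sc F_nonneg scale_pos by (intro divide_left_mono) auto
    also have "\<dots> \<le> \<kappa>" using F by (simp add: divide_le_eq)
    finally show ?thesis .
  qed
  have \<kappa>: "0 \<le> \<kappa>" using Fs F_nonneg[of x] scale_pos[of c] by (smt (verit) divide_nonneg_pos)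
  have "measure_pmf.prob coins {\<omega>. 2 * mu_reports \<kappa> + R \<le> (\<Sum>i<n. real (min (ctot (scale c) (\<omega> (c, i)) 0 (\<lambda>j. x j i)) R) / R)} \<le> fail"
  proof (rule upper_tail_two_mu[OF c])
    have "(\<Sum>i<n. measure_pmf.expectation unit_coin (\<lambda>u. real (min (ctot (scale c) u 0 (\<lambda>j. x j i)) R) / R))
       \<le> (\<Sum>i<n. 4 * (4 * k) powr (p - 1) * (\<Sum>z=1..m. 1 / real z) * (fr (\<lambda>j. x j i) powr p / scale c))"
      by (intro sum_mono expectation_reports_le scale_pos)
    also have "\<dots> = 4 * (4 * k) powr (p - 1) * (\<Sum>z=1..m. 1 / real z) * (F x / scale c)"
      by (simp add: F_def sum_distrib_left sum_divide_distrib)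
    also have "\<dots> \<le> mu_reports \<kappa>" unfolding mu_reports_def by (intro mult_left_mono Fs) (auto intro!: mult_nonneg_nonneg sum_nonneg)
    finally show "(\<Sum>i<n. measure_pmf.expectation unit_coin (\<lambda>u. real (min (ctot (scale c) u 0 (\<lambda>j. x j i)) R) / R)) \<le> mu_reports \<kappa>" .
    show "0 \<le> mu_reports \<kappa>" unfolding mu_reports_def using \<kappa> by (auto intro!: mult_nonneg_nonneg sum_nonneg)
  qed (use R in \<open>auto simp: divide_le_eq\<close>)
  moreover have "2 * mu_reports \<kappa> + R \<le> (\<Sum>i<n. real (min (tot \<omega> c 0 i x) R) / R) \<longleftrightarrow> R * (2 * mu_reports \<kappa> + R) \<le> (\<Sum>i<n. real (min (tot \<omega> c 0 i x) R))" for \<omega>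
    unfolding sum_divide_distrib[symmetric] using R by (simp add: le_divide_eq mult.commute)
  ultimately show ?thesis by (simp only: tot_eq[symmetric])
qed

lemma prob_many_tracked:
  assumes c: "c \<in> classes" and F: "F x \<le> \<kappa> * 2 ^ fst c"
  shows "measure_pmf.prob coins {\<omega>. 2 * mu_tracked \<kappa> + R \<le> real (card {i. i < n \<and> ph \<omega> c i x \<noteq> 0})} \<le> fail"
proof -
  have sc: "2 ^ fst c \<le> scale c" using p ge_one_powr_ge_zero[of 2 p] by (auto simp: scale_def)
  have Fs: "F x / scale c \<le> \<kappa>"
  proof -
    have "F x / scale c \<le> F x / 2 ^ fst c" using sc F_nonneg scale_pos by (intro divide_left_mono) auto
    also have "\<dots> \<le> \<kappa>" using F by (simp add: divide_le_eq)
    finally show ?thesis .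
  qed
  have \<kappa>: "0 \<le> \<kappa>" using Fs F_nonneg[of x] scale_pos[of c] by (smt (verit) divide_nonneg_pos)
  have "measure_pmf.prob coins {\<omega>. 2 * mu_tracked \<kappa> + R \<le> (\<Sum>i<n. indicator {u. cph (scale c) u (\<lambda>j. x j i) \<noteq> 0} (\<omega> (c, i)))} \<le> fail"
  proof (rule upper_tail_two_mu[OF c])
    have "(\<Sum>i<n. measure_pmf.expectation unit_coin (indicator {u. cph (scale c) u (\<lambda>j. x j i) \<noteq> 0}))
       \<le> (\<Sum>i<n. 16 powr p * (fr (\<lambda>j. x j i) powr p / scale c) + fail)"
      by (intro sum_mono) (use prob_tracked_le[OF scale_pos] in simp)
    also have "\<dots> = 16 powr p * (F x / scale c) + n * fail"
      by (simp add: F_def sum_distrib_left sum_divide_distrib sum.distrib)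
    also have "\<dots> \<le> mu_tracked \<kappa>" unfolding mu_tracked_def using small' by (intro add_mono mult_left_mono Fs) auto
    finally show "(\<Sum>i<n. measure_pmf.expectation unit_coin (indicator {u. cph (scale c) u (\<lambda>j. x j i) \<noteq> 0})) \<le> mu_tracked \<kappa>" .
    show "0 \<le> mu_tracked \<kappa>" using \<kappa> by (simp add: mu_tracked_def)
  qed (auto simp: indicator_def)
  moreover have "real (card {i. i < n \<and> ph \<omega> c i x \<noteq> 0}) = (\<Sum>i<n. indicator {u. cph (scale c) u (\<lambda>j. x j i) \<noteq> 0} (\<omega> (c, i)))" for \<omega>
    by (simp add: ph_eq indicator_def sum.If_cases Int_def)
  ultimately show ?thesis by simp
qed

end

lemma expectation_pair_pmf_mult:
  fixes f :: "'a \<Rightarrow> real" and g :: "'b \<Rightarrow> real"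
  assumes "finite (set_pmf P)" "finite (set_pmf Q)"
  shows "measure_pmf.expectation (pair_pmf P Q) (\<lambda>(a, b). f a * g b) = measure_pmf.expectation P f * measure_pmf.expectation Q g"
proof -
  have "measure_pmf.expectation (pair_pmf P Q) (\<lambda>(a, b). f a * g b)
     = measure_pmf.expectation (P \<bind> (\<lambda>a. map_pmf (\<lambda>b. (a, b)) Q)) (\<lambda>(a, b). f a * g b)"
    by (simp add: pair_pmf_def map_pmf_def)
  also have "\<dots> = (\<Sum>a\<in>set_pmf P. pmf P a *\<^sub>R measure_pmf.expectation (map_pmf (\<lambda>b. (a, b)) Q) (\<lambda>(a, b). f a * g b))"
    by (rule pmf_expectation_bind) (use assms in auto)
  also have "\<dots> = (\<Sum>a\<in>set_pmf P. f a * pmf P a) * measure_pmf.expectation Q g"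
    unfolding sum_distrib_right by (intro sum.cong) (auto simp: mult_ac)
  also have "(\<Sum>a\<in>set_pmf P. f a * pmf P a) = measure_pmf.expectation P f"
    by (rule integral_measure_pmf_real[symmetric]) (use assms in auto)
  finally show ?thesis .
qed

lemma Pi_pmf_indep_mult:
  fixes f g :: "('i \<Rightarrow> 'a) \<Rightarrow> real"
  assumes fin: "finite A" "finite B" and AB: "A \<inter> B = {}" and fs: "\<And>i. finite (set_pmf (p i))"
    and f: "\<And>\<omega> \<omega>'. (\<And>a. a \<in> A \<Longrightarrow> \<omega> a = \<omega>' a) \<Longrightarrow> f \<omega> = f \<omega>'"
    and g: "\<And>\<omega> \<omega>'. (\<And>b. b \<in> B \<Longrightarrow> \<omega> b = \<omega>' b) \<Longrightarrow> g \<omega> = g \<omega>'"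
  shows "measure_pmf.expectation (Pi_pmf (A \<union> B) d p) (\<lambda>\<omega>. f \<omega> * g \<omega>)
    = measure_pmf.expectation (Pi_pmf (A \<union> B) d p) f * measure_pmf.expectation (Pi_pmf (A \<union> B) d p) g"
proof -
  let ?P = "Pi_pmf A d p" and ?Q = "Pi_pmf B d p"
  have fsP: "finite (set_pmf (Pi_pmf C d p))" if "finite C" for C
    by (rule finite_subset[OF set_Pi_pmf_subset'[OF that]]) (use that fs in auto)
  define mrg where "mrg = (\<lambda>(a, b) x. if x \<in> A then a x else b x :: 'a)"
  have u: "Pi_pmf (A \<union> B) d p = map_pmf mrg (pair_pmf ?P ?Q)"
    using Pi_pmf_union[OF fin AB, of d p] by (simp add: mrg_def)
  have fm: "f (mrg ab) = f (fst ab)" for ab by (rule f) (auto simp: mrg_def case_prod_unfold)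
  have gm: "g (mrg ab) = g (snd ab)" for ab by (rule g) (use AB in \<open>auto simp: mrg_def case_prod_unfold\<close>)
  have E: "measure_pmf.expectation (Pi_pmf (A \<union> B) d p) (\<lambda>\<omega>. h1 (f \<omega>) * h2 (g \<omega>))
     = measure_pmf.expectation ?P (\<lambda>a. h1 (f a)) * measure_pmf.expectation ?Q (\<lambda>b. h2 (g b))" for h1 h2 :: "real \<Rightarrow> real"
    using expectation_pair_pmf_mult[of ?P ?Q "\<lambda>a. h1 (f a)" "\<lambda>b. h2 (g b)"] fsP fin
    by (simp add: u fm gm case_prod_unfold)
  \<comment> \<open>Replacing one factor by the constant 1 yields the two marginal
    expectations.\<close>
  show ?thesis using E[of "\<lambda>x. x" "\<lambda>x. x"] E[of "\<lambda>x. x" "\<lambda>_. 1"] E[of "\<lambda>_. 1" "\<lambda>x. x"] by simp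
qed

text \<open>Reduces the second moment of the number of hits to an exponential moment, which
  factorizes over independent items.\<close>

lemma square_le_two_power: "real n ^ 2 \<le> 4 * 2 ^ n"
proof -
  have "n ^ 2 \<le> 4 * 2 ^ n"
  proof (induction n rule: less_induct)
    case (less n)
    show ?case
    proof (cases "n \<le> 2")
      case True
      then have "n = 0 \<or> n = 1 \<or> n = 2" by auto
      then show ?thesis by auto
    next
      case False
      then obtain q where q: "n = Suc q" "q \<ge> 2" by (cases n) auto
      have "q ^ 2 \<le> 4 * 2 ^ q" using less q by simp
      show ?thesis
      proof (cases "q = 2")
        case True
        then show ?thesis using q by simp
      next
        case False
        then have q3: "3 \<le> q" using q by simp
        have "(Suc q)\<^sup>2 = q\<^sup>2 + 2 * q + 1" by (simp add: power2_eq_square)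
        also have "\<dots> \<le> q\<^sup>2 + q\<^sup>2"
        proof -
          have "3 * q \<le> q * q" using q3 by (rule mult_right_mono) simp
          then show ?thesis unfolding power2_eq_square using q3 by linarith
        qed
        also have "\<dots> \<le> 4 * 2 ^ Suc q" using \<open>q ^ 2 \<le> 4 * 2 ^ q\<close> by simp
        finally show ?thesis by (simp add: q)
      qed
    qed
  qed
  then have "real (n ^ 2) \<le> real (4 * 2 ^ n)" by (simp only: of_nat_le_iff)
  then show ?thesis by simp
qed

section \<open>Cost of the ideal run\<close>

context sketch_levels
begin

lemma F_mono: "(\<And>j i. x j i \<le> x' j i) \<Longrightarrow> F x \<le> F x'"
  unfolding F_def using p by (intro sum_mono powr_mono2 fr_nonneg) (auto simp: fr_def intro!: sum_mono)

lemma F_counts_Nil: "F (counts []) = 0"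
  using p by (simp add: F_def fr_def)

text \<open>For a positive frequency, \<open>f + 1 <= 2 * f\<close>; the summand 1 is for a new
  item. Thus \<open>F\<close> cannot jump far beyond the value at which a level is first surely
  passed.\<close>

lemma F_snoc:
  assumes "j < k" "i < n"
  shows "F (counts (s @ [(j, i)])) \<le> 2 powr p * F (counts s) + 1"
proof -
  let ?f = "\<lambda>i. fr (\<lambda>j. counts s j i)" and ?f' = "\<lambda>i. fr (\<lambda>j. counts (s @ [(j, i)]) j i)"
  let ?g = "\<lambda>i'. fr (\<lambda>j'. counts (s @ [(j, i)]) j' i')"
  have p1: "1 \<le> 2 powr p" using p by (intro ge_one_powr_ge_zero) auto
  have other: "?g i' = ?f i'" if "i' \<noteq> i" for i' using that unfolding fr_def by (intro sum.cong) (auto simp: counts_snoc)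
  have at_i: "?g i = ?f i + 1"
  proof -
    have "?g i = (\<Sum>j'<k. real (counts s j' i) + (if j' = j then 1 else 0))"
      unfolding fr_def by (intro sum.cong) (auto simp: counts_snoc)
    then show ?thesis using assms by (simp add: sum.distrib fr_def)
  qed
  have "?g i powr p \<le> 2 powr p * ?f i powr p + 1"
  proof (cases "?f i = 0")
    case True
    then show ?thesis by (simp add: at_i)
  next
    case False
    have "?f i = real (\<Sum>j'<k. counts s j' i)" by (simp add: fr_def)
    with False have "1 \<le> ?f i" by (metis One_nat_def Suc_leI of_nat_0 of_nat_1 of_nat_le_iff neq0_conv)
    then have "?g i powr p \<le> (2 * ?f i) powr p" using p unfolding at_i by (intro powr_mono2) auto
    also have "\<dots> = 2 powr p * ?f i powr p" using fr_nonneg by (simp add: powr_mult)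
    finally show ?thesis by simp
  qed
  moreover have "(\<Sum>i'\<in>{..<n}-{i}. ?g i' powr p) \<le> (\<Sum>i'\<in>{..<n}-{i}. 2 powr p * ?f i' powr p)"
    using p1 by (intro sum_mono) (auto simp: other mult_le_cancel_right1)
  moreover have "F (counts (s @ [(j, i)])) = ?g i powr p + (\<Sum>i'\<in>{..<n}-{i}. ?g i' powr p)"
    unfolding F_def using assms by (subst sum.remove[of _ i]) auto
  moreover have "2 powr p * F (counts s) = 2 powr p * ?f i powr p + (\<Sum>i'\<in>{..<n}-{i}. 2 powr p * ?f i' powr p)"
    unfolding F_def sum_distrib_left using assms by (subst sum.remove[of _ i]) auto
  ultimately show ?thesis by linarith
qed

text \<open>\<open>4 powr p + 1\<close> bounds \<open>F / 2 ^ r\<close> at the time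
  \<open>T r\<close> of \<open>prob_expensive\<close>.\<close>

definition class_cost :: real where
  "class_cost = R * (2 * mu_reports (4 powr p + 1) + R) + (Lam + 4 * k) * (2 * mu_tracked (4 powr p + 1) + R)"

text \<open>Unless a judgement in \<open>B1\<close> fails, at some time and level, classes of level
  \<open>r\<close> are dead from \<open>T r\<close> on. Their reports and tracked items therefore
  need a bound at this single time, \<open>B2\<close> and \<open>B3\<close>, since the potential is
  monotone.\<close>

lemma prob_expensive:
  assumes s: "valid_stream n k s" and cap: "card classes * class_cost + 2 * k * Suc L < real cap"
  shows "measure_pmf.prob coins {\<omega>. cap \<le> ideal_cost \<omega> s} \<le> (Suc (length s) * Suc L + 2 * card classes) * fail"
proof -
  define x where "x t = counts (take t s)" for t
  define T where "T r = (LEAST t. length s \<le> t \<or> 2 powr p * 2 ^ r \<le> F (x t))" for r :: nat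
  have T: "length s \<le> T r \<or> 2 powr p * 2 ^ r \<le> F (x (T r))" for r
    unfolding T_def by (rule LeastI[of _ "length s"]) simp
  \<comment> \<open>One step before \<open>T r\<close> the moment was below
    \<open>2 powr p * 2 ^ r\<close>, and one update gives at most another factor
    \<open>2 powr p\<close> and 1.\<close>
  have FT: "F (x (T r)) \<le> (4 powr p + 1) * 2 ^ r" for r
  proof (cases "T r")
    case 0
    then show ?thesis using F_counts_Nil by (simp add: x_def)
  next
    case (Suc t)
    then have "\<not> (length s \<le> t \<or> 2 powr p * 2 ^ r \<le> F (x t))" unfolding T_def using not_less_Least by (metis lessI)
    then have t: "t < length s" "F (x t) \<le> 2 powr p * 2 ^ r" by auto
    obtain j i where u: "s ! t = (j, i)" by force
    have "(j, i) \<in> set s" using t u by (metis nth_mem)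
    then have ji: "j < k" "i < n" using s by (auto simp: valid_stream_def)
    have "F (x (T r)) \<le> 2 powr p * F (x t) + 1"
      using F_snoc[OF ji, of "take t s"] t u by (simp add: Suc x_def take_Suc_conv_app_nth)
    also have "\<dots> \<le> 2 powr p * (2 powr p * 2 ^ r) + 1" using t by (intro add_mono mult_left_mono) auto
    also have "2 powr p * (2 powr p * 2 ^ r) = 4 powr p * 2 ^ r"
      by (simp add: powr_mult[symmetric] mult.assoc[symmetric])
    also have "(1::real) \<le> 2 ^ r" by simp
    finally show ?thesis by (simp add: algebra_simps)
  qed
  define B1 where "B1 q = (case q of (t, r) \<Rightarrow> if 2 powr p * 2 ^ r \<le> F (x t) then {\<omega>. \<not> passed \<omega> r (x t)} else {})" for q :: "nat \<times> nat"
  define B2 where "B2 c = {\<omega>. R * (2 * mu_reports (4 powr p + 1) + R) \<le> (\<Sum>i<n. real (min (tot \<omega> c 0 i (x (T (fst c)))) R))}" for c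
  define B3 where "B3 c = {\<omega>. 2 * mu_tracked (4 powr p + 1) + R \<le> real (card {i. i < n \<and> ph \<omega> c i (x (T (fst c))) \<noteq> 0})}" for c
  let ?Q = "{..length s} \<times> {..L}"
  have "{\<omega>. cap \<le> ideal_cost \<omega> s} \<subseteq> \<Union>(B1 ` ?Q) \<union> (\<Union>(B2 ` classes) \<union> \<Union>(B3 ` classes))"
  proof (rule ccontr)
    assume "\<not> ?thesis"
    then obtain \<omega> where \<omega>: "cap \<le> ideal_cost \<omega> s" "\<omega> \<notin> \<Union>(B1 ` ?Q)" "\<omega> \<notin> \<Union>(B2 ` classes)" "\<omega> \<notin> \<Union>(B3 ` classes)" by blast
    have "ideal_cost \<omega> s \<le> (\<Sum>c\<in>classes. \<Sum>i<n. pot \<omega> c i (counts (take (T (fst c)) s))) + 2 * k * Suc L"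
    proof (rule ideal_cost_le[OF s])
      fix c t assume c: "c \<in> classes" and t: "t < length s" and r: "rs \<omega> (counts (take t s)) \<le> fst c"
      show "t < T (fst c)"
      proof (rule ccontr)
        assume nt: "\<not> t < T (fst c)"
        then have "2 powr p * 2 ^ fst c \<le> F (x (T (fst c)))" using T[of "fst c"] t by auto
        also have "\<dots> \<le> F (x t)" unfolding x_def using nt by (intro F_mono counts_take_le) auto
        finally have Ft: "2 powr p * 2 ^ fst c \<le> F (x t)" .
        \<comment> \<open>Outside \<open>B1\<close> all levels up to that of \<open>c\<close> are
          passed at time \<open>t\<close>, so the first level not passed lies above, contrary to
          \<open>c\<close> being monitored.\<close>
        have pass: "passed \<omega> r' (x t)" if "r' \<le> fst c" for r'
        proof -
          have "2 powr p * 2 ^ r' \<le> 2 powr p * 2 ^ fst c" using that by (intro mult_left_mono power_increasing) auto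
          then have "2 powr p * 2 ^ r' \<le> F (x t)" using Ft by linarith
          moreover have "(t, r') \<in> ?Q" using t c that by (auto simp: classes_def)
          ultimately show ?thesis using \<omega>(2) by (force simp: B1_def)
        qed
        have "rs \<omega> (x t) \<le> fst c" using r by (simp add: x_def)
        moreover then have "\<not> L < rs \<omega> (x t)" using c by (auto simp: classes_def)
        ultimately show False using rs_props(2)[of \<omega> "x t"] pass by blast
      qed
    qed
    then have "real (ideal_cost \<omega> s) \<le> real ((\<Sum>c\<in>classes. \<Sum>i<n. pot \<omega> c i (x (T (fst c)))) + 2 * k * Suc L)"
      by (simp only: x_def of_nat_le_iff)
    also have "\<dots> = (\<Sum>c\<in>classes. real (\<Sum>i<n. pot \<omega> c i (x (T (fst c))))) + real (2 * k * Suc L)"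
      by (simp only: of_nat_add of_nat_sum)
    also have "\<dots> \<le> (\<Sum>c\<in>classes. class_cost) + real (2 * k * Suc L)"
    proof (intro add_mono sum_mono order_refl)
      fix c assume c: "c \<in> classes"
      let ?x = "x (T (fst c))"
      have "real (\<Sum>i<n. pot \<omega> c i ?x) \<le> real ((\<Sum>i<n. min (tot \<omega> c 0 i ?x) (thr 0)) + (thr 1 + 4 * k) * card {i. i < n \<and> ph \<omega> c i ?x \<noteq> 0})"
        by (simp only: of_nat_le_iff sum_pot_le)
      also have "\<dots> = (\<Sum>i<n. real (min (tot \<omega> c 0 i ?x) R)) + (Lam + 4 * k) * real (card {i. i < n \<and> ph \<omega> c i ?x \<noteq> 0})"
        by (simp add: thr_def)
      also have "\<dots> \<le> R * (2 * mu_reports (4 powr p + 1) + R) + (Lam + 4 * k) * (2 * mu_tracked (4 powr p + 1) + R)"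
        using \<omega>(3,4) c by (intro add_mono mult_left_mono) (auto simp: B2_def B3_def not_le less_imp_le)
      finally show "real (\<Sum>i<n. pot \<omega> c i ?x) \<le> class_cost" by (simp only: class_cost_def)
    qed
    also have "\<dots> < real cap" using cap by simp
    finally have "ideal_cost \<omega> s < cap" by simp
    with \<omega>(1) show False by simp
  qed
  then have "measure_pmf.prob coins {\<omega>. cap \<le> ideal_cost \<omega> s} \<le> measure_pmf.prob coins (\<Union>(B1 ` ?Q) \<union> (\<Union>(B2 ` classes) \<union> \<Union>(B3 ` classes)))"
    by (intro measure_pmf.finite_measure_mono) auto
  also have "\<dots> \<le> measure_pmf.prob coins (\<Union>(B1 ` ?Q)) + (measure_pmf.prob coins (\<Union>(B2 ` classes)) + measure_pmf.prob coins (\<Union>(B3 ` classes)))"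
    by (intro order_trans[OF measure_Un_le] add_mono order_refl) auto
  also have "\<dots> \<le> (\<Sum>q\<in>?Q. fail) + ((\<Sum>c\<in>classes. fail) + (\<Sum>c\<in>classes. fail))"
  proof (intro add_mono order_trans[OF measure_pmf.finite_measure_subadditive_finite] sum_mono)
    show "measure_pmf.prob coins (B1 q) \<le> fail" if "q \<in> ?Q" for q
      using that prob_not_passed[of "snd q" "x (fst q)"] fail_nonneg by (auto simp: B1_def split: prod.splits)
    show "measure_pmf.prob coins (B2 c) \<le> fail" if "c \<in> classes" for c
      unfolding B2_def by (rule prob_many_reports[OF that FT])
    show "measure_pmf.prob coins (B3 c) \<le> fail" if "c \<in> classes" for c
      unfolding B3_def by (rule prob_many_tracked[OF that FT])
  qed (auto simp: finite_classes)
  also have "\<dots> = (Suc (length s) * Suc L + 2 * card classes) * fail"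
    by (simp add: card_cartesian_product algebra_simps)
  finally show ?thesis .
qed

end

section \<open>Bias and second moment of the estimate\<close>

context sketch_levels
begin

text \<open>From \<open>(1 - e) powr (- p) <= exp (2 * p * e)\<close> and
  \<open>exp t <= 1 + t * exp t\<close> at \<open>t = 2 * p * e <= p\<close>.\<close>

definition bias_const :: real where "bias_const = 2 * p * exp p"

text \<open>The assumption on \<open>M\<close> keeps the lower bound of
  \<open>prob_detected_ge\<close> away from its cap at 1, where proportionality to
  \<open>fr x powr p\<close> would break down.\<close>

lemma prob_detected_close:
  assumes M: "M > 0" and v: "fr x powr p \<le> M"
  shows "\<bar>M * measure_pmf.prob unit_coin {u. cph M u x = 2} - fr x powr p\<bar> \<le> bias_const * e * fr x powr p + M * (1 / m + 2 * fail)"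
proof -
  let ?v = "fr x powr p / M" and ?P = "measure_pmf.prob unit_coin {u. cph M u x = 2}"
  have v0: "0 \<le> ?v" "?v \<le> 1" using M v by (simp_all add: divide_le_eq)
  have p0: "0 < p" using p by simp
  have up: "?P \<le> ?v + bias_const * e * ?v + fail"
  proof -
    have "e * e \<le> 1 / 2 * e" using e by (intro mult_right_mono) auto
    then have l: "- (2 * e) \<le> ln (1 - e)" using ln_one_minus_pos_lower_bound[of e] e
      unfolding power2_eq_square by linarith
    have "1 / (1 - e) powr p = exp (- (p * ln (1 - e)))" using e by (simp add: powr_def exp_minus field_simps)
    also have "\<dots> \<le> exp (2 * p * e)" using mult_left_mono[OF l, of p] p0 by (simp add: algebra_simps)
    also have "\<dots> \<le> 1 + 2 * p * e * exp p"
    proof -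
      have t: "0 \<le> 2 * p * e" "2 * p * e \<le> p" using p0 e by (auto simp: mult_le_cancel_left1)
      have "1 - 2 * p * e \<le> exp (- (2 * p * e))" using exp_ge_add_one_self[of "- (2 * p * e)"] by simp
      then have "(1 - 2 * p * e) * exp (2 * p * e) \<le> exp (- (2 * p * e)) * exp (2 * p * e)" by (intro mult_right_mono) auto
      then have "exp (2 * p * e) \<le> 1 + 2 * p * e * exp (2 * p * e)" by (simp add: exp_minus algebra_simps)
      also have "\<dots> \<le> 1 + 2 * p * e * exp p" using t by (intro add_left_mono mult_left_mono) auto
      finally show ?thesis .
    qed
    finally have "?v * (1 / (1 - e) powr p) \<le> ?v * (1 + 2 * p * e * exp p)" by (rule mult_left_mono) (rule v0)
    then show ?thesis using prob_detected_le[OF M, of x] by (simp add: bias_const_def algebra_simps)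
  qed
  have lo: "?v - bias_const * e * ?v - 1 / m - 2 * fail \<le> ?P"
  proof -
    have "ln (1 + e) \<le> e" using e by (simp add: ln_add_one_self_le_self)
    then have "exp (- (p * e)) \<le> 1 / (1 + e) powr p" using e p0 by (simp add: powr_def exp_minus divide_simps)
    then have "1 - p * e \<le> 1 / (1 + e) powr p" using exp_ge_add_one_self[of "- (p * e)"] by linarith
    then have "?v * (1 - p * e) \<le> ?v * (1 / (1 + e) powr p)" by (rule mult_left_mono) (rule v0)
    moreover have "?v * (1 / (1 + e) powr p) \<le> 1 * 1"
      using v0 e p0 by (intro mult_mono) (auto intro!: ge_one_powr_ge_zero)
    ultimately have "?v * (1 - p * e) \<le> min 1 (?v / (1 + e) powr p)" by simp
    moreover have "p * e * ?v \<le> bias_const * e * ?v"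
    proof -
      have "1 \<le> exp p" using p0 by simp
      then have "1 \<le> 2 * exp p" by linarith
      then have "p * 1 \<le> p * (2 * exp p)" using p0 by (intro mult_left_mono) auto
      then show ?thesis using e v0 unfolding bias_const_def by (intro mult_right_mono) auto
    qed
    moreover have "v * (1 - d) = v - d * v" for v d :: real by (simp add: algebra_simps)
    from this[of ?v "p * e"] have "?v * (1 - p * e) = ?v - p * e * ?v" .
    ultimately show ?thesis using prob_detected_ge[OF M, of x] by linarith
  qed
  have "0 \<le> 1 / real m" by simp
  then have "\<bar>?P - ?v\<bar> \<le> bias_const * e * ?v + (1 / m + 2 * fail)" using up lo fail_nonneg by linarith
  then have "M * \<bar>?P - ?v\<bar> \<le> M * (bias_const * e * ?v + (1 / m + 2 * fail))" using M by (intro mult_left_mono) auto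
  moreover have "M * \<bar>?P - ?v\<bar> = \<bar>M * ?P - fr x powr p\<bar>"
  proof -
    have "M * \<bar>?P - ?v\<bar> = \<bar>M * (?P - ?v)\<bar>" using M by (simp add: abs_mult)
    also have "M * (?P - ?v) = M * ?P - fr x powr p" using M by (simp add: field_simps)
    finally show ?thesis .
  qed
  moreover have "M * (bias_const * e * ?v + (1 / m + 2 * fail)) = bias_const * e * fr x powr p + M * (1 / m + 2 * fail)"
    using M by (simp add: distrib_left)
  ultimately show ?thesis by linarith
qed

lemma finite_set_coins: "finite (set_pmf coins)"
  unfolding coins_def
  by (rule finite_subset[OF set_Pi_pmf_subset']) (use finite_classes finite_set_unit_coin in auto)

lemma integrable_coins [simp, intro]: "integrable (measure_pmf coins) (f :: _ \<Rightarrow> real)"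
  by (rule integrable_measure_pmf_finite) (rule finite_set_coins)

lemma expectation_coins_component:
  fixes f :: "_ \<Rightarrow> real"
  assumes "c \<in> classes" "i < n"
  shows "measure_pmf.expectation coins (\<lambda>\<omega>. f (\<omega> (c, i))) = measure_pmf.expectation unit_coin f"
proof -
  have "map_pmf (\<lambda>\<omega>. \<omega> (c, i)) coins = unit_coin"
    unfolding coins_def using assms finite_classes by (subst Pi_pmf_component) auto
  then show ?thesis by (metis integral_map_pmf)
qed

lemma hits_eq: "real (hits \<omega> r x) = (\<Sum>i<n. indicator {u. cph (scale (r, 0)) u (\<lambda>j. x j i) = 2} (\<omega> ((r, 0), i)))"
  by (simp add: hits_def ph_eq indicator_def sum.If_cases Int_def)

lemma hits_le: "hits \<omega> r x \<le> n"
  unfolding hits_def by (rule order_trans[OF card_mono[of "{..<n}"]]) auto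

lemma expectation_hits:
  assumes "r \<le> L"
  shows "measure_pmf.expectation coins (\<lambda>\<omega>. real (hits \<omega> r x))
    = (\<Sum>i<n. measure_pmf.prob unit_coin {u. cph (scale (r, 0)) u (\<lambda>j. x j i) = 2})"
proof -
  have c: "(r, 0) \<in> classes" using assms by (simp add: classes_def)
  have "measure_pmf.expectation coins (\<lambda>\<omega>. real (hits \<omega> r x))
    = (\<Sum>i<n. measure_pmf.expectation coins (\<lambda>\<omega>. indicator {u. cph (scale (r, 0)) u (\<lambda>j. x j i) = 2} (\<omega> ((r, 0), i))))"
    unfolding hits_eq by (rule Bochner_Integration.integral_sum) simp
  also have "\<dots> = (\<Sum>i<n. measure_pmf.prob unit_coin {u. cph (scale (r, 0)) u (\<lambda>j. x j i) = 2})"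
    by (intro sum.cong refl) (simp add: expectation_coins_component[OF c])
  finally show ?thesis .
qed

lemma fr_le_F: "i < n \<Longrightarrow> fr (\<lambda>j. x j i) powr p \<le> F x"
  unfolding F_def by (rule member_le_sum) auto

lemma expectation_hits_close:
  assumes r: "r \<le> L" and F: "F x \<le> scale (r, 0)"
  shows "\<bar>scale (r, 0) * measure_pmf.expectation coins (\<lambda>\<omega>. real (hits \<omega> r x)) - F x\<bar>
    \<le> bias_const * e * F x + scale (r, 0) * (e / 16)"
proof -
  let ?M = "scale (r, 0)"
  have "\<bar>?M * measure_pmf.expectation coins (\<lambda>\<omega>. real (hits \<omega> r x)) - F x\<bar>
    = \<bar>\<Sum>i<n. ?M * measure_pmf.prob unit_coin {u. cph ?M u (\<lambda>j. x j i) = 2} - fr (\<lambda>j. x j i) powr p\<bar>"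
    by (simp add: expectation_hits[OF r] F_def sum_subtractf sum_distrib_left)
  also have "\<dots> \<le> (\<Sum>i<n. bias_const * e * fr (\<lambda>j. x j i) powr p + ?M * (1 / m + 2 * fail))"
    using fr_le_F[of _ x] F by (intro order_trans[OF sum_abs] sum_mono prob_detected_close scale_pos) fastforce
  also have "\<dots> = bias_const * e * F x + ?M * (n * (1 / m + 2 * fail))"
    by (simp add: sum.distrib F_def sum_distrib_left)
  also have "\<dots> \<le> bias_const * e * F x + ?M * (e / 16)"
    using scale_pos[of "(r, 0)"] by (intro add_left_mono mult_left_mono small) auto
  finally show ?thesis .
qed

text \<open>The hits are independent with total mean at most \<open>2 powr p + 1\<close>, and their
  exponential moment is at most the exponential of this mean.\<close>

lemma expectation_hits_square:
  assumes r: "r \<le> L" and F: "F x \<le> scale (r, 0)"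
  shows "measure_pmf.expectation coins (\<lambda>\<omega>. (real (hits \<omega> r x))\<^sup>2) \<le> 4 * exp (2 powr p + 1)"
proof -
  let ?M = "scale (r, 0)"
  have c: "(r, 0) \<in> classes" using r by (simp add: classes_def)
  let ?X = "\<lambda>i. indicator {u. cph ?M u (\<lambda>j. x j i) = 2} :: _ \<Rightarrow> real"
  have fc: "finite (classes \<times> {..<n})" using finite_classes by simp
  have "measure_pmf.expectation coins (\<lambda>\<omega>. (real (hits \<omega> r x))\<^sup>2) \<le> measure_pmf.expectation coins (\<lambda>\<omega>. 4 * 2 powr real (hits \<omega> r x))"
    by (intro integral_mono) (auto simp: powr_realpow square_le_two_power)
  \<comment> \<open>The product is extended by factors 1 to all classes, to match the index set of
    \<open>coins\<close>.\<close>
  also have "\<dots> = 4 * measure_pmf.expectation coins (\<lambda>\<omega>. \<Prod>a\<in>classes \<times> {..<n}. if fst a = (r, 0) then 2 powr ?X (snd a) (\<omega> a) else 1)"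
  proof -
    have "2 powr real (hits \<omega> r x) = (\<Prod>a\<in>classes \<times> {..<n}. if fst a = (r, 0) then 2 powr ?X (snd a) (\<omega> a) else 1)" for \<omega>
    proof -
      have "(\<Prod>a\<in>classes \<times> {..<n}. if fst a = (r, 0) then 2 powr ?X (snd a) (\<omega> a) else 1)
        = (\<Prod>a\<in>Pair (r, 0 :: nat) ` {..<n}. 2 powr ?X (snd a) (\<omega> a))"
        using fc c by (subst prod.inter_filter[symmetric]) (auto intro!: prod.cong)
      also have "\<dots> = (\<Prod>i<n. 2 powr ?X i (\<omega> ((r, 0), i)))" by (subst prod.reindex) (auto simp: inj_on_def)
      also have "\<dots> = 2 powr (\<Sum>i<n. ?X i (\<omega> ((r, 0), i)))" by (simp add: powr_sum)
      finally show ?thesis by (simp add: hits_eq)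
    qed
    then show ?thesis by simp
  qed
  also have "measure_pmf.expectation coins (\<lambda>\<omega>. \<Prod>a\<in>classes \<times> {..<n}. if fst a = (r, 0) then 2 powr ?X (snd a) (\<omega> a) else 1)
    = (\<Prod>a\<in>classes \<times> {..<n}. measure_pmf.expectation unit_coin (\<lambda>u. if fst a = (r, 0) then 2 powr ?X (snd a) u else 1))"
    unfolding coins_def
    by (rule expectation_prod_Pi_pmf[OF fc, of "\<lambda>_. unit_coin" "\<lambda>a u. if fst a = (r, 0) then 2 powr ?X (snd a) u else 1"])
       (auto intro!: integrable_measure_pmf_finite finite_set_unit_coin)
  also have "\<dots> \<le> (\<Prod>a\<in>classes \<times> {..<n}. if fst a = (r, 0) then exp (measure_pmf.expectation unit_coin (?X (snd a))) else 1)"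
  proof (intro prod_mono conjI)
    fix a assume "a \<in> classes \<times> {..<n}"
    show "0 \<le> measure_pmf.expectation unit_coin (\<lambda>u. if fst a = (r, 0) then 2 powr ?X (snd a) u else 1)"
      by (intro Bochner_Integration.integral_nonneg) auto
    show "measure_pmf.expectation unit_coin (\<lambda>u. if fst a = (r, 0) then 2 powr ?X (snd a) u else 1)
      \<le> (if fst a = (r, 0) then exp (measure_pmf.expectation unit_coin (?X (snd a))) else 1)"
    proof (cases "fst a = (r, 0)")
      case True
      show ?thesis unfolding if_P[OF True]
        by (rule mgf_unit_interval(1)[OF finite_set_unit_coin]) (auto simp: indicator_def)
    qed simp
  qed
  also have "\<dots> = (\<Prod>a\<in>Pair (r, 0 :: nat) ` {..<n}. exp (measure_pmf.expectation unit_coin (?X (snd a))))"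
  proof -
    have "{a \<in> classes \<times> {..<n}. fst a = (r, 0)} = Pair (r, 0 :: nat) ` {..<n}" using c by auto
    then show ?thesis using fc by (subst prod.inter_filter[symmetric]) simp_all
  qed
  also have "\<dots> = (\<Prod>i<n. exp (measure_pmf.expectation unit_coin (?X i)))" by (subst prod.reindex) (auto simp: inj_on_def)
  also have "\<dots> = exp (\<Sum>i<n. measure_pmf.prob unit_coin {u. cph ?M u (\<lambda>j. x j i) = 2})" by (simp add: exp_sum)
  also have "\<dots> \<le> exp (2 powr p + 1)"
  proof -
    have "(\<Sum>i<n. measure_pmf.prob unit_coin {u. cph ?M u (\<lambda>j. x j i) = 2}) \<le> (\<Sum>i<n. 2 powr p * (fr (\<lambda>j. x j i) powr p / ?M) + fail)"
      by (intro sum_mono detected_le_two_powr scale_pos)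
    also have "\<dots> = 2 powr p * (F x / ?M) + n * fail" by (simp add: sum.distrib F_def sum_divide_distrib sum_distrib_left)
    also have "\<dots> \<le> 2 powr p * 1 + 1"
    proof (intro add_mono mult_left_mono)
      show "F x / ?M \<le> 1" using F scale_pos[of "(r, 0)"] by (simp add: divide_le_eq)
      show "n * fail \<le> 1" using small' by linarith
    qed simp
    finally show ?thesis by simp
  qed
  finally show ?thesis by simp
qed

text \<open>The level depends on the coins of classes with nonzero second component only, the hits
  on the others.\<close>

lemma judge_level_indep:
  assumes "r \<le> L"
  shows "measure_pmf.expectation coins (\<lambda>\<omega>. of_bool (rs \<omega> x = r) * h (hits \<omega> r x))
    = measure_pmf.prob coins {\<omega>. rs \<omega> x = r} * measure_pmf.expectation coins (\<lambda>\<omega>. h (hits \<omega> r x) :: real)"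
proof -
  define A where "A = {a \<in> classes \<times> {..<n}. snd (fst a) \<noteq> 0}"
  define B where "B = {a \<in> classes \<times> {..<n}. snd (fst a) = 0}"
  have fin: "finite A" "finite B" using finite_classes by (auto simp: A_def B_def)
  have AB: "A \<inter> B = {}" by (auto simp: A_def B_def)
  have un: "classes \<times> {..<n} = A \<union> B" by (auto simp: A_def B_def)
  have pass: "passed \<omega> r' x = passed \<omega>' r' x" if "\<And>a. a \<in> A \<Longrightarrow> \<omega> a = \<omega>' a" "r' \<le> L" for \<omega> \<omega>' r'
  proof -
    have "\<omega> a = \<omega>' a" if "a \<in> judges r'" for a
      using judges_subset[OF \<open>r' \<le> L\<close>] that by (intro \<open>\<And>a. a \<in> A \<Longrightarrow> \<omega> a = \<omega>' a\<close>) (auto simp: A_def judges_def)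
    then have "{a \<in> judges r'. cph (2 ^ r') (\<omega> a) (\<lambda>j. x j (snd a)) = 2} = {a \<in> judges r'. cph (2 ^ r') (\<omega>' a) (\<lambda>j. x j (snd a)) = 2}" by auto
    then show ?thesis by (simp only: passed_def judged_eq)
  qed
  have rsA: "rs \<omega> x = rs \<omega>' x" if "\<And>a. a \<in> A \<Longrightarrow> \<omega> a = \<omega>' a" for \<omega> \<omega>'
  proof -
    have "L < r' \<or> \<not> passed \<omega> r' x \<longleftrightarrow> L < r' \<or> \<not> passed \<omega>' r' x" for r'
      using pass[of \<omega> \<omega>' r', OF that] by (cases "r' \<le> L") auto
    then show ?thesis unfolding rs_def by presburger
  qed
  have hB: "hits \<omega> r x = hits \<omega>' r x" if "\<And>a. a \<in> B \<Longrightarrow> \<omega> a = \<omega>' a" for \<omega> \<omega>'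
  proof -
    have "\<omega> ((r, 0), i) = \<omega>' ((r, 0), i)" if "i < n" for i
      by (rule \<open>\<And>a. a \<in> B \<Longrightarrow> \<omega> a = \<omega>' a\<close>) (use that assms in \<open>auto simp: B_def classes_def\<close>)
    then have "{i. i < n \<and> ph \<omega> (r, 0) i x = 2} = {i. i < n \<and> ph \<omega>' (r, 0) i x = 2}" by (auto simp: ph_eq)
    then show ?thesis by (simp add: hits_def)
  qed
  have "measure_pmf.expectation coins (\<lambda>\<omega>. of_bool (rs \<omega> x = r) * h (hits \<omega> r x))
    = measure_pmf.expectation coins (\<lambda>\<omega>. of_bool (rs \<omega> x = r)) * measure_pmf.expectation coins (\<lambda>\<omega>. h (hits \<omega> r x))"
    unfolding coins_def un
  proof (rule Pi_pmf_indep_mult[OF fin AB])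
    show "of_bool (rs \<omega> x = r) = (of_bool (rs \<omega>' x = r) :: real)" if "\<And>a. a \<in> A \<Longrightarrow> \<omega> a = \<omega>' a" for \<omega> \<omega>'
      using rsA[OF that] by simp
    show "h (hits \<omega> r x) = h (hits \<omega>' r x)" if "\<And>a. a \<in> B \<Longrightarrow> \<omega> a = \<omega>' a" for \<omega> \<omega>'
      using hB[OF that] by simp
  qed (rule finite_set_unit_coin)
  moreover have "(\<lambda>\<omega>. of_bool (rs \<omega> x = r)) = (indicator {\<omega>. rs \<omega> x = r} :: _ \<Rightarrow> real)" by (auto simp: indicator_def)
  ultimately show ?thesis by simp
qed

text \<open>The levels left over by \<open>prob_not_passed\<close> and
  \<open>prob_passed_early\<close>; their scales are within a constant factor of
  \<open>F x\<close>.\<close>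

definition fitting :: "(nat \<Rightarrow> nat \<Rightarrow> nat) \<Rightarrow> nat set" where
  "fitting x = {r. r \<le> L \<and> F x < 2 powr p * 2 ^ r \<and> 2 ^ r < 2 powr (p + 6) * F x}"

text \<open>A level that is too low was wrongly not passed. If it is too high, it is not 0 because
  \<open>F x >= 1\<close>, and the level before it was passed too early; the assumption on
  \<open>L\<close> puts \<open>Suc L\<close> into this case.\<close>

lemma prob_unfitting:
  assumes F: "1 \<le> F x" "2 powr (p + 5) * F x \<le> 2 ^ L" and r: "r \<le> Suc L" "r \<notin> fitting x"
  shows "measure_pmf.prob coins {\<omega>. rs \<omega> x = r} \<le> fail"
proof (cases "r \<le> L \<and> 2 powr p * 2 ^ r \<le> F x")
  case True
  have "measure_pmf.prob coins {\<omega>. rs \<omega> x = r} \<le> measure_pmf.prob coins {\<omega>. \<not> passed \<omega> r x}"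
  proof (intro measure_pmf.finite_measure_mono subsetI CollectI)
    fix \<omega> assume "\<omega> \<in> {\<omega>. rs \<omega> x = r}"
    then show "\<not> passed \<omega> r x" using rs_props(2)[of \<omega> x] True by auto
  qed simp
  also have "\<dots> \<le> fail" using True by (intro prob_not_passed) auto
  finally show ?thesis .
next
  case False
  have six: "2 powr (p + 6) = 2 * 2 powr (p + 5)" by (simp add: powr_add)
  have big: "2 powr (p + 6) * F x \<le> 2 ^ r"
  proof (cases "r \<le> L")
    case True
    then show ?thesis using False r(2) by (auto simp: fitting_def not_less)
  next
    case False
    then have "r = Suc L" using r by simp
    then show ?thesis using F(2) by (simp add: six)
  qed
  have "r \<noteq> 0"
  proof
    assume "r = 0"
    then have "2 powr (p + 6) * F x \<le> 1" using big by simp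
    moreover have "2 powr (p + 6) * 1 \<le> 2 powr (p + 6) * F x" using F by (intro mult_left_mono) auto
    moreover have "1 < 2 powr (p + 6)" using p by (intro gr_one_powr) auto
    ultimately show False by linarith
  qed
  then obtain q where q: "r = Suc q" by (cases r) auto
  have "measure_pmf.prob coins {\<omega>. rs \<omega> x = r} \<le> measure_pmf.prob coins {\<omega>. passed \<omega> q x}"
    using rs_props(3)[of q _ x] q by (intro measure_pmf.finite_measure_mono) auto
  also have "\<dots> \<le> fail" by (rule prob_passed_early) (use q r big in \<open>auto simp: six\<close>)
  finally show ?thesis .
qed

lemma fitting_scale: "r \<in> fitting x \<Longrightarrow> r \<le> L \<and> F x \<le> scale (r, 0) \<and> scale (r, 0) \<le> 2 powr (2 * p + 6) * F x"
proof -
  assume r: "r \<in> fitting x"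
  then have "2 powr p * 2 ^ r \<le> 2 powr p * (2 powr (p + 6) * F x)" by (intro mult_left_mono) (auto simp: fitting_def)
  also have "\<dots> = 2 powr (2 * p + 6) * F x" by (simp add: powr_add[symmetric] mult.assoc[symmetric])
  finally show ?thesis using r by (auto simp: fitting_def scale_def)
qed

lemma sum_prob_rs: "(\<Sum>r\<le>Suc L. measure_pmf.prob coins {\<omega>. rs \<omega> x = r}) = 1"
proof -
  have "(\<Sum>r\<le>Suc L. measure_pmf.prob coins {\<omega>. rs \<omega> x = r}) = measure_pmf.prob coins (\<Union>r\<le>Suc L. {\<omega>. rs \<omega> x = r})"
    by (rule measure_pmf.finite_measure_finite_Union[symmetric]) (auto simp: disjoint_family_on_def)
  also have "(\<Union>r\<le>Suc L. {\<omega>. rs \<omega> x = r}) = UNIV" using rs_props(1)[of _ x] by auto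
  finally show ?thesis by simp
qed

definition max_est :: real where "max_est = 2 powr p * 2 ^ L * n"

lemma level_est_le: "r \<le> L \<Longrightarrow> scale (r, 0) * hits \<omega> r x \<le> max_est"
  unfolding max_est_def scale_def by (intro mult_mono) (auto simp: hits_le power_increasing)

lemma max_est_nonneg: "0 \<le> max_est" by (simp add: max_est_def)

lemma est_bounds: "0 \<le> est \<omega> x" "est \<omega> x \<le> max_est"
  using level_est_le[of "rs \<omega> x" \<omega> x] scale_pos[of "(rs \<omega> x, 0)"] max_est_nonneg
  by (auto simp: est_def)

text \<open>Beyond level \<open>L\<close> the estimate is 0, so \<open>h 0 = 0\<close> removes that
  term; independence splits each of the others.\<close>

lemma expectation_est_function:
  assumes h: "h 0 = (0 :: real)"
  shows "measure_pmf.expectation coins (\<lambda>\<omega>. h (est \<omega> x))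
    = (\<Sum>r\<le>L. measure_pmf.prob coins {\<omega>. rs \<omega> x = r} * measure_pmf.expectation coins (\<lambda>\<omega>. h (scale (r, 0) * hits \<omega> r x)))"
proof -
  have eq: "h (est \<omega> x) = (\<Sum>r\<le>L. of_bool (rs \<omega> x = r) * h (scale (r, 0) * hits \<omega> r x))" for \<omega>
  proof (cases "rs \<omega> x \<le> L")
    case True
    then show ?thesis by (subst sum.remove[of _ "rs \<omega> x"]) (auto simp: est_def intro!: sum.neutral)
  next
    case False
    then show ?thesis using h by (auto simp: est_def intro!: sum.neutral[symmetric])
  qed
  then have "measure_pmf.expectation coins (\<lambda>\<omega>. h (est \<omega> x))
    = (\<Sum>r\<le>L. measure_pmf.expectation coins (\<lambda>\<omega>. of_bool (rs \<omega> x = r) * h (scale (r, 0) * hits \<omega> r x)))"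
    unfolding eq by (intro Bochner_Integration.integral_sum) simp
  also have "\<dots> = (\<Sum>r\<le>L. measure_pmf.prob coins {\<omega>. rs \<omega> x = r} * measure_pmf.expectation coins (\<lambda>\<omega>. h (scale (r, 0) * hits \<omega> r x)))"
    by (intro sum.cong refl) (use judge_level_indep in auto)
  finally show ?thesis .
qed

text \<open>The mean is an average over levels of nearly unbiased values at fitting levels; each of
  the at most \<open>L + 2\<close> other levels contributes no more than \<open>fail\<close> times
  the largest possible error.\<close>

lemma expectation_est:
  assumes F: "1 \<le> F x" "2 powr (p + 5) * F x \<le> 2 ^ L" and q: "(real L + 2) * fail * (max_est + 2 ^ L) \<le> e"
  shows "\<bar>measure_pmf.expectation coins (\<lambda>\<omega>. est \<omega> x) - F x\<bar> \<le> (bias_const + 2 powr (2 * p + 6) + 1) * e * F x"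
proof -
  define P where "P r = measure_pmf.prob coins {\<omega>. rs \<omega> x = r}" for r
  define H where "H r = (if r \<le> L then scale (r, 0) * measure_pmf.expectation coins (\<lambda>\<omega>. real (hits \<omega> r x)) else 0)" for r
  have P0: "0 \<le> P r" for r by (simp add: P_def)
  have P1: "(\<Sum>r\<le>Suc L. P r) = 1" unfolding P_def by (rule sum_prob_rs)
  have "1 * F x \<le> 2 powr (p + 5) * F x" using p F by (intro mult_right_mono ge_one_powr_ge_zero) auto
  then have FL: "F x \<le> 2 ^ L" using F by linarith
  have E: "measure_pmf.expectation coins (\<lambda>\<omega>. est \<omega> x) = (\<Sum>r\<le>Suc L. P r * H r)"
    using expectation_est_function[of "\<lambda>y. y" x] by (simp add: P_def H_def)
  have H: "0 \<le> H r" "H r \<le> max_est" for r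
  proof -
    have "measure_pmf.expectation coins (\<lambda>\<omega>. scale (r, 0) * real (hits \<omega> r x)) \<le> max_est" if "r \<le> L"
      using measure_pmf.integral_le_const[of coins "\<lambda>\<omega>. scale (r, 0) * real (hits \<omega> r x)" max_est] level_est_le[OF that] by auto
    then show "H r \<le> max_est" using max_est_nonneg by (auto simp: H_def)
    show "0 \<le> H r" using scale_pos[of "(r, 0)"] by (auto simp: H_def intro!: mult_nonneg_nonneg Bochner_Integration.integral_nonneg)
  qed
  have fit: "\<bar>H r - F x\<bar> \<le> (bias_const + 2 powr (2 * p + 6)) * e * F x" if "r \<in> fitting x" for r
  proof -
    note fs = fitting_scale[OF that]
    have "\<bar>H r - F x\<bar> \<le> bias_const * e * F x + scale (r, 0) * (e / 16)"
      using expectation_hits_close[of r x] fs by (simp add: H_def)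
    \<comment> \<open>The discretization error is relative to the scale, which a fitting level keeps
      comparable to \<open>F x\<close>.\<close>
    also have "scale (r, 0) * (e / 16) \<le> 2 powr (2 * p + 6) * F x * e"
      using fs e F by (intro mult_mono) auto
    finally show ?thesis by (simp add: algebra_simps)
  qed
  have unfit: "P r * \<bar>H r - F x\<bar> \<le> fail * (max_est + 2 ^ L)" if "r \<le> Suc L" "r \<notin> fitting x" for r
  proof (rule mult_mono)
    show "P r \<le> fail" unfolding P_def by (rule prob_unfitting[OF F that])
    show "\<bar>H r - F x\<bar> \<le> max_est + 2 ^ L" using H[of r] FL F by linarith
  qed (auto simp: fail_nonneg)
  have C0: "0 \<le> (bias_const + 2 powr (2 * p + 6)) * e * F x"
    using e F p by (auto intro!: mult_nonneg_nonneg add_nonneg_nonneg simp: bias_const_def)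
  have f0: "0 \<le> fail * (max_est + 2 ^ L)" using fail_nonneg max_est_nonneg by simp
  have "measure_pmf.expectation coins (\<lambda>\<omega>. est \<omega> x) - F x = (\<Sum>r\<le>Suc L. P r * (H r - F x))"
    unfolding E right_diff_distrib sum_subtractf sum_distrib_right[symmetric] P1 by simp
  also have "\<bar>\<dots>\<bar> \<le> (\<Sum>r\<le>Suc L. P r * \<bar>H r - F x\<bar>)"
    by (rule order_trans[OF sum_abs]) (simp only: abs_mult abs_of_nonneg[OF P0] order_refl)
  also have "\<dots> \<le> (\<Sum>r\<le>Suc L. P r * ((bias_const + 2 powr (2 * p + 6)) * e * F x) + fail * (max_est + 2 ^ L))"
  proof (rule sum_mono)
    fix r assume r: "r \<in> {..Suc L}"
    show "P r * \<bar>H r - F x\<bar> \<le> P r * ((bias_const + 2 powr (2 * p + 6)) * e * F x) + fail * (max_est + 2 ^ L)"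
    proof (cases "r \<in> fitting x")
      case True
      then show ?thesis using mult_left_mono[OF fit[OF True] P0, of r] f0 by linarith
    next
      case False
      then show ?thesis using unfit[of r] r mult_nonneg_nonneg[OF P0 C0, of r] by simp
    qed
  qed
  also have "\<dots> = (bias_const + 2 powr (2 * p + 6)) * e * F x + (real L + 2) * (fail * (max_est + 2 ^ L))"
    unfolding sum.distrib sum_distrib_right[symmetric] P1 by simp
  also have "(real L + 2) * (fail * (max_est + 2 ^ L)) \<le> e * F x"
  proof -
    have "e * 1 \<le> e * F x" using e F by (intro mult_left_mono) auto
    then show ?thesis using q by (simp add: mult.assoc)
  qed
  finally show ?thesis by (simp add: algebra_simps)
qed

definition square_const :: real where
  "square_const = (2 powr (2 * p + 6))\<^sup>2 * (4 * exp (2 powr p + 1)) + 1"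

lemma expectation_est_square:
  assumes F: "1 \<le> F x" "2 powr (p + 5) * F x \<le> 2 ^ L" and q: "(real L + 2) * fail * max_est\<^sup>2 \<le> 1"
  shows "measure_pmf.expectation coins (\<lambda>\<omega>. (est \<omega> x)\<^sup>2) \<le> square_const * (F x)\<^sup>2"
proof -
  define P where "P r = measure_pmf.prob coins {\<omega>. rs \<omega> x = r}" for r
  define H where "H r = measure_pmf.expectation coins (\<lambda>\<omega>. (scale (r, 0) * hits \<omega> r x)\<^sup>2)" for r
  define K where "K = (2 powr (2 * p + 6) * F x)\<^sup>2 * (4 * exp (2 powr p + 1))"
  have P0: "0 \<le> P r" for r by (simp add: P_def)
  have K0: "0 \<le> K" by (simp add: K_def)
  have f0: "0 \<le> fail * max_est\<^sup>2" using fail_nonneg by simp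
  have "measure_pmf.expectation coins (\<lambda>\<omega>. (est \<omega> x)\<^sup>2) = (\<Sum>r\<le>L. P r * H r)"
    using expectation_est_function[of "\<lambda>y. y\<^sup>2" x] by (simp add: P_def H_def)
  also have "\<dots> \<le> (\<Sum>r\<le>L. P r * K + fail * max_est\<^sup>2)"
  proof (rule sum_mono)
    fix r assume r: "r \<in> {..L}"
    show "P r * H r \<le> P r * K + fail * max_est\<^sup>2"
    proof (cases "r \<in> fitting x")
      case True
      note fs = fitting_scale[OF True]
      have "H r = (scale (r, 0))\<^sup>2 * measure_pmf.expectation coins (\<lambda>\<omega>. (real (hits \<omega> r x))\<^sup>2)"
        by (simp add: H_def power_mult_distrib)
      also have "\<dots> \<le> K" unfolding K_def
        using fs scale_pos[of "(r, 0)"] expectation_hits_square[of r x]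
        by (intro mult_mono power_mono) (auto intro!: Bochner_Integration.integral_nonneg)
      finally show ?thesis using mult_left_mono[OF _ P0, of "H r" K r] f0 by linarith
    next
      case False
      have "H r \<le> max_est\<^sup>2"
        unfolding H_def using r level_est_le[of r _ x] scale_pos[of "(r, 0)"]
        by (intro measure_pmf.integral_le_const integrable_coins AE_pmfI power_mono) auto
      moreover have "P r \<le> fail" unfolding P_def by (rule prob_unfitting[OF F]) (use r False in auto)
      moreover have "0 \<le> H r" unfolding H_def by (intro Bochner_Integration.integral_nonneg) auto
      ultimately have "P r * H r \<le> fail * max_est\<^sup>2" using fail_nonneg by (intro mult_mono) auto
      then show ?thesis using mult_nonneg_nonneg[OF P0 K0, of r] by linarith
    qed
  qed
  also have "\<dots> = (\<Sum>r\<le>L. P r) * K + (real L + 1) * (fail * max_est\<^sup>2)"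
    by (simp add: sum.distrib sum_distrib_right)
  also have "\<dots> \<le> 1 * K + 1"
  proof (intro add_mono mult_right_mono K0)
    have "(\<Sum>r\<le>L. P r) \<le> (\<Sum>r\<le>Suc L. P r)" using P0 by simp
    moreover have "(\<Sum>r\<le>Suc L. P r) = 1" unfolding P_def by (rule sum_prob_rs)
    ultimately show "(\<Sum>r\<le>L. P r) \<le> 1" by linarith
    have "(real L + 1) * (fail * max_est\<^sup>2) \<le> (real L + 2) * (fail * max_est\<^sup>2)" using f0 by (intro mult_right_mono) auto
    then show "(real L + 1) * (fail * max_est\<^sup>2) \<le> 1" using q by (simp add: mult.assoc)
  qed
  also have "\<dots> \<le> square_const * (F x)\<^sup>2"
  proof -
    have "1 \<le> (F x)\<^sup>2" using F by simp
    then show ?thesis by (simp add: K_def square_const_def power_mult_distrib algebra_simps)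
  qed
  finally show ?thesis .
qed

end

section \<open>Protocols with private coins\<close>

text \<open>Conditioning the seeds on an index in \<open>A\<close> makes the index uniform on
  \<open>A\<close>, so conditional expectations become averages over part of the table.\<close>

lemma cond_uniform_seed:
  fixes X :: "nat \<Rightarrow> real"
  assumes D: "map_pmf f D = pmf_of_set {..<S}" and A: "A \<subseteq> {..<S}" "A \<noteq> {}"
  shows "set_pmf D \<inter> f -` A \<noteq> {}"
    and "measure_pmf.prob D (f -` A) = card A / S"
    and "integrable (measure_pmf (cond_pmf D (f -` A))) (\<lambda>\<omega>. X (f \<omega>))"
    and "measure_pmf.expectation (cond_pmf D (f -` A)) (\<lambda>\<omega>. X (f \<omega>)) = (\<Sum>l\<in>A. X l) / card A"
proof -
  have S: "{..<S} \<noteq> {}" "finite {..<S}" using A by auto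
  have fA: "finite A" using A finite_subset by blast
  have set: "f ` set_pmf D = {..<S}" using arg_cong[OF D, of set_pmf] S by simp
  obtain l where l: "l \<in> A" using A by blast
  then have "l \<in> f ` set_pmf D" using set A by auto
  then show ne: "set_pmf D \<inter> f -` A \<noteq> {}" using l by blast
  have "measure_pmf.prob D (f -` A) = measure_pmf.prob (map_pmf f D) A" by simp
  then show "measure_pmf.prob D (f -` A) = card A / S" using A S by (simp add: D measure_pmf_of_set Int_absorb1)
  have ne2: "set_pmf (pmf_of_set {..<S}) \<inter> A \<noteq> {}" using A S by (simp add: set_pmf_of_set Int_absorb1)
  have "map_pmf f (cond_pmf D (f -` A)) = cond_pmf (pmf_of_set {..<S}) A"
    using cond_map_pmf[OF ne] by (simp add: D)
  also have "\<dots> = pmf_of_set A"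
  proof (rule pmf_eqI)
    fix l
    show "pmf (cond_pmf (pmf_of_set {..<S}) A) l = pmf (pmf_of_set A) l"
      using A fA S by (auto simp: pmf_cond[OF ne2] measure_pmf_of_set Int_absorb1 indicator_def subset_iff)
  qed
  finally have m: "map_pmf f (cond_pmf D (f -` A)) = pmf_of_set A" .
  have "integrable (measure_pmf (map_pmf f (cond_pmf D (f -` A)))) X"
    unfolding m by (rule integrable_measure_pmf_finite) (use A fA in simp)
  then show "integrable (measure_pmf (cond_pmf D (f -` A))) (\<lambda>\<omega>. X (f \<omega>))"
    by (simp add: integrable_map_pmf_eq)
  have "measure_pmf.expectation (cond_pmf D (f -` A)) (\<lambda>\<omega>. X (f \<omega>)) = measure_pmf.expectation (map_pmf f (cond_pmf D (f -` A))) X" by simp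
  also have "\<dots> = (\<Sum>l\<in>A. X l) / card A" unfolding m using A fA by (simp add: integral_pmf_of_set)
  finally show "measure_pmf.expectation (cond_pmf D (f -` A)) (\<lambda>\<omega>. X (f \<omega>)) = (\<Sum>l\<in>A. X l) / card A" .
qed

text \<open>The effect of conditioning on success: the discarded fraction \<open>\<beta>\<close>
  shifts the sum by at most \<open>\<beta> * V\<close> per entry, and normalizing by
  \<open>card A >= S / 2\<close> costs the factor 2.\<close>

lemma average_on_subset:
  fixes X :: "nat \<Rightarrow> real"
  assumes S: "S > 0" and A: "A \<subseteq> {..<S}" and card: "real (card A) \<ge> (1 - \<beta>) * S" and \<beta>: "\<beta> \<le> 1 / 2"
    and X: "\<And>l. l < S \<Longrightarrow> 0 \<le> X l \<and> X l \<le> V"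
  shows "(\<Sum>l\<in>A. X l) / card A \<le> 2 * ((\<Sum>l<S. X l) / S)"
    and "\<lbrakk>\<bar>(\<Sum>l<S. X l) / S - F\<bar> \<le> d; 0 \<le> F; F \<le> V\<rbrakk> \<Longrightarrow> \<bar>(\<Sum>l\<in>A. X l) / card A - F\<bar> \<le> 2 * (d + \<beta> * V)"
proof -
  have fA: "finite A" using A finite_subset by blast
  have half: "real S / 2 \<le> card A"
  proof -
    have "1 / 2 * real S \<le> (1 - \<beta>) * S" using \<beta> by (intro mult_right_mono) auto
    then show ?thesis using card by linarith
  qed
  then have c0: "0 < real (card A)" using S by (smt (verit) half_gt_zero of_nat_0_less_iff)
  have split: "(\<Sum>l<S. X l) = (\<Sum>l\<in>A. X l) + (\<Sum>l\<in>{..<S} - A. X l)"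
    using A by (simp add: sum.subset_diff add.commute)
  have r0: "0 \<le> (\<Sum>l\<in>{..<S} - A. X l)" by (rule sum_nonneg) (use X in auto)
  have V0: "0 \<le> V" using X[of 0] S by linarith
  have cd: "real (card ({..<S} - A)) = real S - card A"
    using A fA card_mono[OF _ A] by (simp add: card_Diff_subset of_nat_diff)
  have cdS: "real S - card A \<le> \<beta> * S" using card by (simp add: algebra_simps)
  have rV: "(\<Sum>l\<in>{..<S} - A. X l) \<le> (real S - card A) * V"
  proof -
    have "(\<Sum>l\<in>{..<S} - A. X l) \<le> real (card ({..<S} - A)) * V" by (rule sum_bounded_above) (use X in auto)
    then show ?thesis by (simp add: cd)
  qed
  have sA: "0 \<le> (\<Sum>l\<in>A. X l)" by (rule sum_nonneg) (use X A in auto)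
  have "(\<Sum>l\<in>A. X l) / card A \<le> (\<Sum>l<S. X l) / (S / 2)"
    using split r0 sA half S by (intro frac_le) auto
  then show "(\<Sum>l\<in>A. X l) / card A \<le> 2 * ((\<Sum>l<S. X l) / S)" by (simp add: mult.commute)
  assume d: "\<bar>(\<Sum>l<S. X l) / S - F\<bar> \<le> d" and F: "0 \<le> F" "F \<le> V"
  have "(\<Sum>l<S. X l) / S - F = ((\<Sum>l<S. X l) - S * F) / S" using S by (simp add: field_simps)
  then have d': "\<bar>(\<Sum>l<S. X l) - S * F\<bar> \<le> d * S" using d S by (simp add: abs_divide divide_le_eq)
  have diff: "(\<Sum>l\<in>A. X l) - card A * F = ((\<Sum>l<S. X l) - S * F) - ((\<Sum>l\<in>{..<S} - A. X l) - (real S - card A) * F)"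
    by (simp add: split algebra_simps)
  have "0 \<le> real S - card A" unfolding cd[symmetric] by simp
  then have "0 \<le> (real S - card A) * F" "(real S - card A) * F \<le> (real S - card A) * V" using F by (auto intro: mult_left_mono)
  then have "\<bar>(\<Sum>l\<in>{..<S} - A. X l) - (real S - card A) * F\<bar> \<le> (real S - card A) * V" using r0 rV by linarith
  also have "\<dots> \<le> \<beta> * S * V" using cdS V0 by (rule mult_right_mono)
  finally have "\<bar>(\<Sum>l\<in>A. X l) - card A * F\<bar> \<le> d * S + \<beta> * S * V" unfolding diff using d' by linarith
  then have num: "\<bar>(\<Sum>l\<in>A. X l) - card A * F\<bar> \<le> (d + \<beta> * V) * S" by (simp add: algebra_simps)
  have "(\<Sum>l\<in>A. X l) / card A - F = ((\<Sum>l\<in>A. X l) - card A * F) / card A" using c0 by (simp add: field_simps)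
  then have "\<bar>(\<Sum>l\<in>A. X l) / card A - F\<bar> = \<bar>(\<Sum>l\<in>A. X l) - card A * F\<bar> / card A" by (simp add: abs_divide)
  also have "\<dots> \<le> (d + \<beta> * V) * S / (S / 2)" using num half S by (intro frac_le) (auto intro: order_trans[OF abs_ge_zero num])
  also have "\<dots> = 2 * (d + \<beta> * V)" using S by simp
  finally show "\<bar>(\<Sum>l\<in>A. X l) / card A - F\<bar> \<le> 2 * (d + \<beta> * V)" .
qed

definition streams :: "nat \<Rightarrow> nat \<Rightarrow> nat \<Rightarrow> (nat \<times> nat) list set" where
  "streams n k N = {s. valid_stream n k s \<and> length s \<le> N}"

lemma streams_eq: "streams n k N = {s. set s \<subseteq> {..<k} \<times> {..<n} \<and> length s \<le> N}"
  by (auto simp: streams_def valid_stream_def)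

lemma finite_streams: "finite (streams n k N)"
  unfolding streams_eq by (rule finite_lists_length_le) simp

lemma card_streams_le:
  assumes "k \<ge> 1" "n \<ge> 1"
  shows "card (streams n k N) \<le> (N + 1) * (k * n) ^ N"
proof -
  have "card (streams n k N) = (\<Sum>i\<le>N. (k * n) ^ i)"
    unfolding streams_eq by (subst card_lists_length_le) (simp_all add: card_cartesian_product)
  also have "\<dots> \<le> (\<Sum>i\<le>N. (k * n) ^ N)" using assms by (intro sum_mono power_increasing) auto
  finally show ?thesis by simp
qed

lemma take_in_streams: "s \<in> streams n k N \<Longrightarrow> take t s \<in> streams n k N"
  by (auto simp: streams_def valid_stream_def dest: in_set_takeD)

text \<open>Allows one success event, chosen for the full stream, to serve all prefixes.\<close>

lemma (in monitor_levels) ideal_cost_take_le: "ideal_cost l (take t s) \<le> ideal_cost l s"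
proof (cases "t \<le> length s")
  case True
  then have "ideal_cost l (take t s) = (\<Sum>q<t. inc l (take q s) (s ! q))"
    by (auto simp: ideal_cost_def min_def intro!: sum.cong)
  also have "\<dots> \<le> ideal_cost l s" unfolding ideal_cost_def using True by (intro sum_mono2) auto
  finally show ?thesis .
qed simp

section \<open>From public coins to the coordinator's private index\<close>

context sketch_levels
begin

lemma moment_eq: "moment p n k s = F (counts s)"
  by (simp add: moment_def F_def freq_def fr_def counts_def)

text \<open>For \<open>F = 0\<close> a relative error leaves no slack, so the estimate must vanish
  exactly. It does because dithers are below \<open>m'\<close> and a zero count is never rounded
  up.\<close>

lemma est_zero:
  assumes "\<omega> \<in> set_pmf coins" and n: "n \<ge> 1"
  shows "est \<omega> (\<lambda>_ _. 0) = 0"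
proof -
  have ph0: "ph \<omega> c i (\<lambda>_ _. 0) = 0" if "c \<in> classes" "i < n" for c i
  proof -
    have "\<omega> \<in> PiE_dflt (classes \<times> {..<n}) (1, \<lambda>_. 0) (set_pmf \<circ> (\<lambda>_. unit_coin))"
      using assms(1) finite_classes by (simp add: coins_def set_Pi_pmf)
    then have "\<forall>a. a \<in> classes \<times> {..<n} \<longrightarrow> \<omega> a \<in> set_pmf unit_coin"
      unfolding PiE_dflt_def by (simp del: split_paired_All)
    then have "\<omega> (c, i) \<in> set_pmf unit_coin" using that by blast
    then show ?thesis using R by (simp add: ph_eq cph_def ctot_def counter_0)
  qed
  have "\<not> passed \<omega> 0 (\<lambda>_ _. 0)"
  proof -
    have none: "{a \<in> judges 0. ph \<omega> (fst a) (snd a) (\<lambda>_ _. 0) = 2} = {}"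
      using judges_subset[of 0] by (auto simp: ph0 subset_iff)
    show ?thesis using R unfolding passed_def none by simp
  qed
  then have "rs \<omega> (\<lambda>_ _. 0) = 0" unfolding rs_def by (intro Least_eq_0) simp
  moreover have "hits \<omega> 0 (\<lambda>_ _. 0) = 0" by (auto simp: hits_def ph0 classes_def)
  ultimately show ?thesis by (simp add: est_def)
qed

text \<open>The table must represent, for every stream, the event of high cost and the first two
  moments of the estimate. These three test functions per stream, scaled into the unit interval,
  form \<open>\<Phi>\<close>; the 6 in \<open>sample\<close> is \<open>2 * 3\<close>.\<close>

theorem private_coin_protocol:
  fixes N S W cap :: nat and \<beta> \<delta> :: real
  assumes n: "n \<ge> 1" and S: "S > 0" and W: "W > 0"
    and cap: "card classes * class_cost + 2 * k * Suc L < real cap"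
    and codes: "S \<le> 2 ^ W" "n * (N + 1) \<le> 2 ^ W" "1 + n * 3 ^ card classes * (L + 2) \<le> 2 ^ W"
    and \<delta>: "0 \<le> \<delta>" and \<beta>: "(Suc N * Suc L + 2 * card classes) * fail + \<delta> \<le> \<beta>" "\<beta> \<le> 1 / 2"
    and sample: "6 * real (card (streams n k N)) * exp (- 2 * real S * \<delta>\<^sup>2) < 1"
    and L: "\<And>s. s \<in> streams n k N \<Longrightarrow> 2 powr (p + 5) * F (counts s) \<le> 2 ^ L"
    and q1: "(real L + 2) * fail * (max_est + 2 ^ L) \<le> e" and q2: "(real L + 2) * fail * max_est\<^sup>2 \<le> 1"
    and d1: "(\<delta> + \<beta>) * (max_est + 2 ^ L) \<le> e" and d2: "\<delta> * max_est\<^sup>2 \<le> 1"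
  shows "\<exists>P. \<forall>s. valid_stream n k s \<and> length s \<le> N \<longrightarrow>
    uses_bits P k s (real (W * (2 * cap + 4 * k + 2))) \<and>
    (\<exists>G. measure_pmf.prob (seeds P k) G \<ge> 1 - \<beta> \<and>
      (\<forall>t\<le>length s. moment_estimate p n k P (take t s) G
         (2 * (bias_const + 2 powr (2 * p + 6) + 2) * e) (2 * (square_const + 1))))"
proof -
  define V where "V = max_est"
  have V: "V > 0" using n by (simp add: V_def max_est_def)
  define bad where "bad s \<omega> = (of_bool (cap \<le> ideal_cost \<omega> s) :: real)" for s \<omega>
  define \<Phi> where "\<Phi> = bad ` streams n k N \<union> ((\<lambda>s \<omega>. est \<omega> (counts s) / V) ` streams n k N
     \<union> (\<lambda>s \<omega>. (est \<omega> (counts s) / V)\<^sup>2) ` streams n k N)"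
  have fin: "finite \<Phi>" by (simp add: \<Phi>_def finite_streams)
  have card: "card \<Phi> \<le> 3 * card (streams n k N)"
  proof -
    have "card \<Phi> \<le> card (bad ` streams n k N) + (card ((\<lambda>s \<omega>. est \<omega> (counts s) / V) ` streams n k N)
       + card ((\<lambda>s \<omega>. (est \<omega> (counts s) / V)\<^sup>2) ` streams n k N))"
      unfolding \<Phi>_def by (intro order_trans[OF card_Un_le] add_mono order_refl card_Un_le)
    also have "\<dots> \<le> card (streams n k N) + (card (streams n k N) + card (streams n k N))"
      by (intro add_mono card_image_le finite_streams)
    finally show ?thesis by simp
  qed
  have unit: "0 \<le> est \<omega> x / V" "est \<omega> x / V \<le> 1" for \<omega> x
    using est_bounds[of \<omega> x] V by (simp_all add: V_def divide_le_eq)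
  have sm: "2 * real (card \<Phi>) * exp (- 2 * real S * \<delta>\<^sup>2) < 1"
  proof -
    have "2 * real (card \<Phi>) * exp (- 2 * real S * \<delta>\<^sup>2) \<le> 6 * real (card (streams n k N)) * exp (- 2 * real S * \<delta>\<^sup>2)"
      using card by (intro mult_right_mono) auto
    then show ?thesis using sample by linarith
  qed
  have bd: "0 \<le> \<phi> x \<and> \<phi> x \<le> 1" if "\<phi> \<in> \<Phi>" for \<phi> x
    using that unit by (auto simp: \<Phi>_def bad_def power_le_one)
  obtain \<tau> where \<tau>: "\<And>l. l < S \<Longrightarrow> \<tau> l \<in> set_pmf coins"
    "\<And>\<phi>. \<phi> \<in> \<Phi> \<Longrightarrow> \<bar>(\<Sum>l<S. \<phi> (\<tau> l)) / S - measure_pmf.expectation coins \<phi>\<bar> \<le> \<delta>"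
    by (rule representative_sample[OF fin _ S \<delta> sm, where D = coins]) (use bd in blast)+
  obtain encL :: "nat \<Rightarrow> bool list" where encL: "inj_on encL {..<S}" "\<And>l. length (encL l) = W"
    using fixed_length_code[of "{..<S}" W] codes by auto
  obtain encR :: "nat \<times> nat \<Rightarrow> bool list" where encR: "inj_on encR ({..<n} \<times> {..N})" "\<And>u. length (encR u) = W"
    using fixed_length_code[of "{..<n} \<times> {..N}" W] codes by (auto simp: card_cartesian_product)
  let ?w = "insert None (Some ` ({..<n} \<times> (classes \<rightarrow>\<^sub>E {..2::nat}) \<times> {..Suc L}))"
  have "card ?w \<le> 2 ^ W"
  proof -
    have "card ?w \<le> Suc (card ({..<n} \<times> (classes \<rightarrow>\<^sub>E {..2::nat}) \<times> {..Suc L}))"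
      by (intro order_trans[OF card_insert_le_m1] card_image_le) (auto simp: finite_classes finite_PiE card_image_le intro: le_trans[OF card_image_le])
    also have "\<dots> = 1 + n * 3 ^ card classes * (L + 2)"
      by (simp add: card_cartesian_product card_PiE finite_classes algebra_simps)
    finally show ?thesis using codes by simp
  qed
  moreover have "finite ?w" by (simp add: finite_classes finite_PiE)
  ultimately obtain encB :: "(nat \<times> nat) announcement \<Rightarrow> bool list" where encB: "inj_on encB ?w" "\<And>u. length (encB u) = W"
    using fixed_length_code[of ?w W] by auto
  have ph\<tau>: "monitor_base.ph k thr (\<lambda>l. gF (\<tau> l)) l c i x = ph (\<tau> l) c i x" for l c i x
    by (simp add: monitor_base.ph_def monitor_base.tot_def)
  interpret Q: monitor k thr "\<lambda>l. gF (\<tau> l)" n "Suc L" classes fst "\<lambda>l. rs (\<tau> l)" N S W cap "\<lambda>l. est (\<tau> l)" encL encR encB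
  proof unfold_locales
    show "est (\<tau> l) x = est (\<tau> l) (counts s)"
      if r: "rs (\<tau> l) x = rs (\<tau> l) (counts s)"
        and "\<And>c i. c \<in> classes \<Longrightarrow> i < n \<Longrightarrow> rs (\<tau> l) x \<le> fst c \<Longrightarrow>
          monitor_base.ph k thr (\<lambda>l. gF (\<tau> l)) l c i x = monitor_base.ph k thr (\<lambda>l. gF (\<tau> l)) l c i (counts s) \<and>
           (\<forall>j<k. gF (\<tau> l) c (monitor_base.ph k thr (\<lambda>l. gF (\<tau> l)) l c i x) j i (x j i)
              = gF (\<tau> l) c (monitor_base.ph k thr (\<lambda>l. gF (\<tau> l)) l c i x) j i (counts s j i))" for l x s
    proof (cases "rs (\<tau> l) (counts s) \<le> L")
      case True
      then have "{i. i < n \<and> ph (\<tau> l) (rs (\<tau> l) (counts s), 0) i x = 2} = {i. i < n \<and> ph (\<tau> l) (rs (\<tau> l) (counts s), 0) i (counts s) = 2}"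
        using that by (auto simp: ph\<tau> classes_def)
      then show ?thesis by (simp add: est_def r hits_def)
    qed (simp add: est_def r)
    show "rs (\<tau> l) y = rs (\<tau> l) x"
      if "\<And>j i. x j i \<le> y j i" "\<And>c i. c \<in> classes \<Longrightarrow> i < n \<Longrightarrow> rs (\<tau> l) x \<le> fst c \<Longrightarrow>
         monitor_base.ph k thr (\<lambda>l. gF (\<tau> l)) l c i x = monitor_base.ph k thr (\<lambda>l. gF (\<tau> l)) l c i y" for l x y
      by (rule rs_cong) (use that in \<open>auto simp: ph\<tau>\<close>)
  qed (use k S W encL encR encB g_mono g_two rs_mono rs_le finite_classes in auto)
  have ic: "Q.ideal_cost l s = ideal_cost (\<tau> l) s" for l s
    by (simp add: Q.ideal_cost_def ideal_cost_def Q.inc_def inc_def Q.rem_def rem_def ph\<tau>)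
  have sc: "map_pmf (\<lambda>\<omega>. \<omega> k) (seeds Q.proto k) = pmf_of_set {..<S}" by (rule Q.seeds_coord)
  show ?thesis
  proof (intro exI[of _ Q.proto] allI impI conjI)
    fix s assume s: "valid_stream n k s \<and> length s \<le> N"
    then have sS: "s \<in> streams n k N" by (simp add: streams_def)
    show "uses_bits Q.proto k s (real (W * (2 * cap + 4 * k + 2)))" using Q.run_uses_bits s by blast
    \<comment> \<open>Success is a property of the drawn index alone.\<close>
    define A where "A = {l. l < S \<and> ideal_cost (\<tau> l) s < cap}"
    have A: "A \<subseteq> {..<S}" by (auto simp: A_def)
    have fail_le: "(real (Suc (length s) * Suc L + 2 * card classes)) * fail \<le> real (Suc N * Suc L + 2 * card classes) * fail"
    proof (intro mult_right_mono fail_nonneg)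
      have "Suc (length s) * Suc L \<le> Suc N * Suc L" using s by (intro mult_le_mono) auto
      then show "real (Suc (length s) * Suc L + 2 * card classes) \<le> real (Suc N * Suc L + 2 * card classes)"
        by (simp only: of_nat_le_iff add_le_cancel_right)
    qed
    have cA: "(1 - \<beta>) * S \<le> real (card A)"
    proof -
      have "bad s \<in> \<Phi>" using sS by (simp add: \<Phi>_def)
      moreover have "bad s = indicator {\<omega>. cap \<le> ideal_cost \<omega> s}" by (auto simp: bad_def indicator_def)
      ultimately have "(\<Sum>l<S. bad s (\<tau> l)) / S \<le> measure_pmf.prob coins {\<omega>. cap \<le> ideal_cost \<omega> s} + \<delta>"
        using \<tau>(2)[of "bad s"] by simp
      also have "\<dots> \<le> \<beta>" using prob_expensive[of s cap] s cap fail_le \<beta>(1) by linarith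
      finally have "(\<Sum>l<S. bad s (\<tau> l)) \<le> \<beta> * S" using S by (simp add: divide_le_eq)
      moreover have "(\<Sum>l<S. bad s (\<tau> l)) = real S - card A"
      proof -
        have "(\<Sum>l<S. bad s (\<tau> l)) = (\<Sum>l<S. 1 - of_bool (ideal_cost (\<tau> l) s < cap))"
          by (intro sum.cong) (auto simp: bad_def)
        also have "\<dots> = real S - card A" by (simp add: sum_subtractf A_def Int_def)
        finally show ?thesis .
      qed
      ultimately show ?thesis by (simp add: algebra_simps)
    qed
    have "0 < (1 - \<beta>) * S" using \<beta> S by simp
    then have A0: "A \<noteq> {}" using cA by auto
    note cs = cond_uniform_seed[OF sc A A0]
    let ?G = "(\<lambda>\<omega>. \<omega> k) -` A"
    show "\<exists>G. measure_pmf.prob (seeds Q.proto k) G \<ge> 1 - \<beta> \<and>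
      (\<forall>t\<le>length s. moment_estimate p n k Q.proto (take t s) G
         (2 * (bias_const + 2 powr (2 * p + 6) + 2) * e) (2 * (square_const + 1)))"
    proof (intro exI[of _ ?G] conjI allI impI)
      show "1 - \<beta> \<le> measure_pmf.prob (seeds Q.proto k) ?G" using cA S by (simp add: cs(2) le_divide_eq)
      fix t assume t: "t \<le> length s"
      define x where "x = counts (take t s)"
      define X where "X l = est (\<tau> l) x" for l
      define D where "D = measure_pmf (cond_pmf (seeds Q.proto k) ?G)"
      have ts: "take t s \<in> streams n k N" by (rule take_in_streams[OF sS])
      have eX: "estimate Q.proto k (take t s) \<omega> = X (\<omega> k)" if "\<omega> \<in> ?G" for \<omega>
      proof -
        have "Q.ideal_cost (\<omega> k) (take t s) < cap"
          using that ideal_cost_take_le[of "\<tau> (\<omega> k)" t s] by (auto simp: A_def ic)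
        then show ?thesis unfolding X_def x_def using that ts
          by (intro Q.run_estimate) (auto simp: A_def streams_def)
      qed
      have AE: "AE \<omega> in D. estimate Q.proto k (take t s) \<omega> = X (\<omega> k)"
        unfolding D_def by (rule AE_pmfI) (use cs(1) eX in auto)
      have AE2: "AE \<omega> in D. (estimate Q.proto k (take t s) \<omega>)\<^sup>2 = (X (\<omega> k))\<^sup>2"
        using AE by eventually_elim simp
      have int: "integrable D (estimate Q.proto k (take t s))"
        by (subst integrable_cong_AE[OF _ _ AE]) (use cs(3)[of X] in \<open>auto simp: D_def\<close>)
      have int2: "integrable D (\<lambda>\<omega>. (estimate Q.proto k (take t s) \<omega>)\<^sup>2)"
        by (subst integrable_cong_AE[OF _ _ AE2]) (use cs(3)[of "\<lambda>l. (X l)\<^sup>2"] in \<open>auto simp: D_def\<close>)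
      have E1: "(\<integral>\<omega>. estimate Q.proto k (take t s) \<omega> \<partial>D) = (\<Sum>l\<in>A. X l) / card A"
        by (subst integral_cong_AE[OF _ _ AE]) (use cs(4)[of X] in \<open>auto simp: D_def\<close>)
      have E2: "(\<integral>\<omega>. (estimate Q.proto k (take t s) \<omega>)\<^sup>2 \<partial>D) = (\<Sum>l\<in>A. (X l)\<^sup>2) / card A"
        by (subst integral_cong_AE[OF _ _ AE2]) (use cs(4)[of "\<lambda>l. (X l)\<^sup>2"] in \<open>auto simp: D_def\<close>)
      have XV: "0 \<le> X l \<and> X l \<le> V" for l using est_bounds by (simp add: X_def V_def)
      \<comment> \<open>The empty prefix needs exactness. In all other cases \<open>F x >= 1\<close>
        converts the additive errors of the table and of the conditioning into relative
        ones.\<close>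
      have main: "\<bar>(\<Sum>l\<in>A. X l) / card A - F x\<bar> \<le> 2 * (bias_const + 2 powr (2 * p + 6) + 2) * e * F x \<and>
        (\<Sum>l\<in>A. (X l)\<^sup>2) / card A \<le> 2 * (square_const + 1) * (F x)\<^sup>2"
      proof (cases "take t s = []")
        case True
        have x0: "x = (\<lambda>_ _. 0)" unfolding x_def True by simp
        have "X l = 0" if "l \<in> A" for l
          unfolding X_def x0 using \<tau>(1) that n by (intro est_zero) (auto simp: A_def)
        moreover have "F x = 0" using F_counts_Nil by (simp add: x0)
        ultimately show ?thesis by simp
      next
        case False
        have F1: "1 \<le> F x"
        proof -
          obtain j i s' where u: "take t s = (j, i) # s'" using False by (cases "take t s") auto
          have ji: "j < k" "i < n" using ts u by (auto simp: streams_def valid_stream_def)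
          have "1 \<le> real (x j i)" by (simp add: x_def u counts_def)
          also have "\<dots> \<le> fr (\<lambda>j. x j i)" unfolding fr_def using ji by (intro member_le_sum) auto
          finally have "1 \<le> fr (\<lambda>j. x j i) powr p" using p by (intro ge_one_powr_ge_zero) auto
          then show ?thesis using fr_le_F[OF ji(2), of x] by linarith
        qed
        have FL: "2 powr (p + 5) * F x \<le> 2 ^ L" unfolding x_def by (rule L[OF ts])
        have FV: "F x \<le> V + 2 ^ L"
        proof -
          have "1 * F x \<le> 2 powr (p + 5) * F x" using p F1 by (intro mult_right_mono ge_one_powr_ge_zero) auto
          then show ?thesis using FL V by linarith
        qed
        let ?b = "bias_const + 2 powr (2 * p + 6) + 1"
        have EX: "\<bar>measure_pmf.expectation coins (\<lambda>\<omega>. est \<omega> x) - F x\<bar> \<le> ?b * e * F x"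
          by (rule expectation_est[OF F1 FL q1])
        have "(\<lambda>\<omega>. est \<omega> (counts (take t s)) / V) \<in> \<Phi>" "(\<lambda>\<omega>. (est \<omega> (counts (take t s)) / V)\<^sup>2) \<in> \<Phi>"
          using ts by (auto simp: \<Phi>_def)
        note tt = \<tau>(2)[OF this(1)] \<tau>(2)[OF this(2)]
        have a1: "\<bar>(\<Sum>l<S. X l) / S - measure_pmf.expectation coins (\<lambda>\<omega>. est \<omega> x)\<bar> \<le> \<delta> * V"
        proof -
          have "(\<Sum>l<S. X l / V) / S - measure_pmf.expectation coins (\<lambda>\<omega>. est \<omega> x / V)
            = ((\<Sum>l<S. X l) / S - measure_pmf.expectation coins (\<lambda>\<omega>. est \<omega> x)) / V"
            by (simp add: sum_divide_distrib[symmetric] diff_divide_distrib mult.commute)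
          then show ?thesis using tt(1) V by (simp add: x_def[symmetric] X_def[symmetric] abs_divide divide_le_eq)
        qed
        have a2: "(\<Sum>l<S. (X l)\<^sup>2) / S \<le> measure_pmf.expectation coins (\<lambda>\<omega>. (est \<omega> x)\<^sup>2) + \<delta> * V\<^sup>2"
        proof -
          have "(\<Sum>l<S. (X l / V)\<^sup>2) / S - measure_pmf.expectation coins (\<lambda>\<omega>. (est \<omega> x / V)\<^sup>2)
            = ((\<Sum>l<S. (X l)\<^sup>2) / S - measure_pmf.expectation coins (\<lambda>\<omega>. (est \<omega> x)\<^sup>2)) / V\<^sup>2"
            by (simp add: power_divide sum_divide_distrib[symmetric] diff_divide_distrib mult.commute)
          then have "((\<Sum>l<S. (X l)\<^sup>2) / S - measure_pmf.expectation coins (\<lambda>\<omega>. (est \<omega> x)\<^sup>2)) / V\<^sup>2 \<le> \<delta>"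
            using abs_le_D1[OF tt(2)] by (simp add: x_def[symmetric] X_def[symmetric])
          then have "(\<Sum>l<S. (X l)\<^sup>2) / S - measure_pmf.expectation coins (\<lambda>\<omega>. (est \<omega> x)\<^sup>2) \<le> \<delta> * V\<^sup>2"
            using V by (subst (asm) pos_divide_le_eq) auto
          then show ?thesis by linarith
        qed
        have "\<bar>(\<Sum>l<S. X l) / S - F x\<bar> \<le> ?b * e * F x + \<delta> * V" using a1 EX by linarith
        moreover have "0 \<le> X l \<and> X l \<le> V + 2 ^ L" if "l < S" for l using XV[of l] by (smt (verit) zero_le_power)
        ultimately have "\<bar>(\<Sum>l\<in>A. X l) / card A - F x\<bar> \<le> 2 * (?b * e * F x + \<delta> * V + \<beta> * (V + 2 ^ L))"
          using F1 FV by (intro average_on_subset(2)[OF S A cA \<beta>(2)]) auto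
        moreover have "\<delta> * V + \<beta> * (V + 2 ^ L) \<le> e * F x"
        proof -
          have "\<delta> * V \<le> \<delta> * (V + 2 ^ L)" using \<delta> by (intro mult_left_mono) auto
          moreover have "e * 1 \<le> e * F x" using e F1 by (intro mult_left_mono) auto
          moreover have "\<delta> * (V + 2 ^ L) + \<beta> * (V + 2 ^ L) \<le> e" using d1 by (simp add: V_def distrib_right)
          ultimately show ?thesis by linarith
        qed
        ultimately have "\<bar>(\<Sum>l\<in>A. X l) / card A - F x\<bar> \<le> 2 * (?b * e * F x + e * F x)"
          by (elim order_trans) (simp only: add.assoc mult_le_cancel_left_pos zero_less_numeral add_le_cancel_left)
        then have b1: "\<bar>(\<Sum>l\<in>A. X l) / card A - F x\<bar> \<le> 2 * (bias_const + 2 powr (2 * p + 6) + 2) * e * F x"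
          by (simp add: algebra_simps)
        have "(\<Sum>l\<in>A. (X l)\<^sup>2) / card A \<le> 2 * ((\<Sum>l<S. (X l)\<^sup>2) / S)"
          by (rule average_on_subset(1)[OF S A cA \<beta>(2), of _ "V\<^sup>2"]) (use XV in \<open>auto intro: power_mono\<close>)
        also have "\<dots> \<le> 2 * (square_const * (F x)\<^sup>2 + 1 * (F x)\<^sup>2)"
        proof -
          have "1 \<le> (F x)\<^sup>2" using F1 by simp
          moreover have "\<delta> * V\<^sup>2 \<le> 1" using d2 by (simp add: V_def)
          ultimately show ?thesis using a2 expectation_est_square[OF F1 FL q2] by simp
        qed
        finally have "(\<Sum>l\<in>A. (X l)\<^sup>2) / card A \<le> 2 * (square_const + 1) * (F x)\<^sup>2" by (simp add: algebra_simps)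
        with b1 show ?thesis by blast
      qed
      show "moment_estimate p n k Q.proto (take t s) ?G (2 * (bias_const + 2 powr (2 * p + 6) + 2) * e) (2 * (square_const + 1))"
        unfolding moment_estimate_def Let_def D_def[symmetric] moment_eq x_def[symmetric]
        using int int2 main by (simp only: E1 E2 simp_thms)
    qed
  qed
qed

end

lemma moment_estimate_mono:
  assumes "moment_estimate p n k P s G \<beta> v" "\<beta> \<le> \<beta>'" "v \<le> v'"
  shows "moment_estimate p n k P s G \<beta>' v'"
proof -
  have "0 \<le> moment p n k s" by (simp add: moment_def sum_nonneg)
  then have "\<beta> * moment p n k s \<le> \<beta>' * moment p n k s" "v * (moment p n k s)\<^sup>2 \<le> v' * (moment p n k s)\<^sup>2"
    using assms by (intro mult_right_mono; simp)+
  then show ?thesis using assms(1) unfolding moment_estimate_def Let_def by (auto intro: order_trans)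
qed

lemma sum_counts_le: "(\<Sum>i<n. \<Sum>j<k. counts s j i) \<le> length s"
proof (induction s rule: rev_induct)
  case (snoc u s)
  obtain j i where u: "u = (j, i)" by force
  have "(\<Sum>i'<n. \<Sum>j'<k. counts (s @ [u]) j' i')
     = (\<Sum>i'<n. \<Sum>j'<k. counts s j' i' + (if i' = i \<and> j' = j then 1 else 0))"
    by (intro sum.cong refl) (simp add: u counts_snoc)
  also have "\<dots> = (\<Sum>i'<n. \<Sum>j'<k. counts s j' i') + (\<Sum>i'<n. \<Sum>j'<k. if i' = i \<and> j' = j then 1 else 0)"
    by (simp add: sum.distrib)
  also have "(\<Sum>i'<n. \<Sum>j'<k. if i' = i \<and> j' = j then 1 else 0) \<le> (\<Sum>i'<n. if i' = i then 1 else (0::nat))"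
  proof (rule sum_mono)
    fix i'
    show "(\<Sum>j'<k. if i' = i \<and> j' = j then 1 else 0) \<le> (if i' = i then 1 else (0::nat))" by (cases "i' = i") auto
  qed
  also have "\<dots> \<le> 1" by simp
  finally show ?case using snoc by simp
qed simp

text \<open>Used when \<open>k\<close> or \<open>1 / \<epsilon>\<close> exceeds the length of the stream, and so need not be polynomial in \<open>n\<close>.\<close>

lemma forwarding_protocol:
  fixes n k N W :: nat
  assumes n: "n \<ge> 1" and k: "k \<ge> 1" and W: "W > 0" and codes: "n * (N + 1) \<le> 2 ^ W" "1 + n * 3 \<le> 2 ^ W"
  shows "\<exists>P. \<forall>s. valid_stream n k s \<and> length s \<le> N \<longrightarrow>
    uses_bits P k s (real (W * (2 * (N + 1) + 4 * k + 2))) \<and>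
    (\<forall>t\<le>length s. moment_estimate p n k P (take t s) UNIV 0 1)"
proof -
  define g :: "nat \<Rightarrow> unit \<Rightarrow> nat \<Rightarrow> nat \<Rightarrow> nat \<Rightarrow> nat \<Rightarrow> nat" where "g l c h j i v = (if h = 2 then 0 else v)" for l c h j i v
  \<comment> \<open>Never reached, so every item stays in phase 0, whose counter is the count
    itself: each update is reported.\<close>
  define thr where "thr h = k * N + 1" for h :: nat
  define est where "est l x = (\<Sum>i<n. (\<Sum>j<k. real (x j i)) powr p)" for l :: nat and x :: "nat \<Rightarrow> nat \<Rightarrow> nat"
  obtain encL :: "nat \<Rightarrow> bool list" where encL: "inj_on encL {..<1}" "\<And>l. length (encL l) = W"
    using fixed_length_code[of "{..<1::nat}" W] by auto
  obtain encR :: "nat \<times> nat \<Rightarrow> bool list" where encR: "inj_on encR ({..<n} \<times> {..N})" "\<And>u. length (encR u) = W"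
    using fixed_length_code[of "{..<n} \<times> {..N}" W] codes by (auto simp: card_cartesian_product)
  let ?w = "insert None (Some ` ({..<n} \<times> (({()} :: unit set) \<rightarrow>\<^sub>E {..2::nat}) \<times> {..0::nat}))"
  have "card ?w \<le> Suc (card ({..<n} \<times> (({()} :: unit set) \<rightarrow>\<^sub>E {..2::nat}) \<times> {..0::nat}))"
    by (rule order_trans[OF card_insert_le_m1]) (auto simp: finite_PiE intro: le_trans[OF card_image_le])
  also have "\<dots> = 1 + n * 3" by (simp add: card_cartesian_product card_PiE)
  finally have "card ?w \<le> 2 ^ W" using codes by simp
  moreover have "finite ?w" by (simp add: finite_PiE)
  ultimately obtain encB :: "unit announcement \<Rightarrow> bool list" where encB: "inj_on encB ?w" "\<And>u. length (encB u) = W"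
    using fixed_length_code[of ?w W] by auto
  have ph0: "monitor_base.ph k thr g l c i x = 0" if "\<And>j i. x j i \<le> N" for l c i x
  proof -
    have "(\<Sum>j<k. x j i) \<le> (\<Sum>j<k. N)" by (intro sum_mono that)
    then show ?thesis by (simp add: monitor_base.ph_def monitor_base.tot_def g_def thr_def)
  qed
  \<comment> \<open>A table with a single entry makes the protocol deterministic; at one report per
    update the cap \<open>N + 1\<close> is not reached.\<close>
  interpret Q: monitor k thr g n 0 "{()}" "\<lambda>_. 0" "\<lambda>_ _. 0" N 1 W "N + 1" est encL encR encB
  proof unfold_locales
    show "est l x = est l (counts s)"
      if s: "valid_stream n k s" "length s \<le> N" and x: "\<And>j i. x j i \<le> counts s j i"
        and eq: "\<And>c i. c \<in> {()} \<Longrightarrow> i < n \<Longrightarrow> 0 \<le> (0::nat) \<Longrightarrow>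
          monitor_base.ph k thr g l c i x = monitor_base.ph k thr g l c i (counts s) \<and>
           (\<forall>j<k. g l c (monitor_base.ph k thr g l c i x) j i (x j i)
              = g l c (monitor_base.ph k thr g l c i x) j i (counts s j i))" for l x s
    proof -
      have "x j i \<le> N" for j i using x[of j i] counts_le_length[of s j i] s by linarith
      then have "x j i = counts s j i" if "i < n" "j < k" for i j
        using eq[of "()" i] that by (simp add: ph0 g_def)
      then show ?thesis by (simp add: est_def)
    qed
  qed (use k W encL encR encB in \<open>auto simp: g_def\<close>)
  have cost: "Q.ideal_cost l s \<le> length s" if "length s \<le> N" for l s
  proof -
    have "Q.inc l (take t s) (s ! t) \<le> 1" if "t < length s" for t
    proof -
      have "counts s' j i \<le> N" if "length s' \<le> N" for s' j i using counts_le_length[of s' j i] that by linarith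
      then have "Q.ph l c i (counts s') = 0" if "length s' \<le> N" for s' c i using that by (intro ph0) auto
      then show ?thesis using \<open>t < length s\<close> \<open>length s \<le> N\<close> by (auto simp: Q.inc_def Q.rem_def Let_def split: prod.splits)
    qed
    then have "Q.ideal_cost l s \<le> (\<Sum>t<length s. 1)" unfolding Q.ideal_cost_def by (intro sum_mono) auto
    then show ?thesis by simp
  qed
  show ?thesis
  proof (intro exI[of _ Q.proto] allI impI conjI)
    fix s assume s: "valid_stream n k s \<and> length s \<le> N"
    then show "uses_bits Q.proto k s (real (W * (2 * (N + 1) + 4 * k + 2)))" using Q.run_uses_bits by blast
    fix t assume t: "t \<le> length s"
    have ts: "valid_stream n k (take t s)" "length (take t s) \<le> N"
      using s by (auto simp: valid_stream_def dest: in_set_takeD)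
    have sc: "map_pmf (\<lambda>\<omega>. \<omega> k) (seeds Q.proto k) = pmf_of_set {..<1}" by (rule Q.seeds_coord)
    let ?D = "measure_pmf (cond_pmf (seeds Q.proto k) ((\<lambda>\<omega>. \<omega> k) -` {0}))"
    have u: "cond_pmf (seeds Q.proto k) UNIV = seeds Q.proto k"
      by (rule pmf_eqI) (subst pmf_cond, auto simp: set_pmf_not_empty)
    have k0: "\<omega> k = 0" if "\<omega> \<in> set_pmf (seeds Q.proto k)" for \<omega>
      using arg_cong[OF sc, of set_pmf] that by (auto simp: set_pmf_of_set lessThan_empty_iff)
    define D where "D = measure_pmf (seeds Q.proto k)"
    have e: "estimate Q.proto k (take t s) \<omega> = moment p n k (take t s)" if "\<omega> \<in> set_pmf (seeds Q.proto k)" for \<omega>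
    proof -
      have "Q.ideal_cost 0 (take t s) < N + 1" using cost[OF ts(2), of 0] ts(2) by linarith
      then have "estimate Q.proto k (take t s) \<omega> = est 0 (counts (take t s))"
        using k0[OF that] ts by (intro Q.run_estimate) auto
      then show ?thesis by (simp add: est_def moment_def freq_def counts_def)
    qed
    have AE: "AE \<omega> in D. estimate Q.proto k (take t s) \<omega> = moment p n k (take t s)"
      unfolding D_def by (rule AE_pmfI) (rule e)
    then have AE2: "AE \<omega> in D. (estimate Q.proto k (take t s) \<omega>)\<^sup>2 = (moment p n k (take t s))\<^sup>2"
      by eventually_elim simp
    have "integrable D (estimate Q.proto k (take t s))"
      by (subst integrable_cong_AE[OF _ _ AE]) (auto simp: D_def)
    moreover have "integrable D (\<lambda>\<omega>. (estimate Q.proto k (take t s) \<omega>)\<^sup>2)"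
      by (subst integrable_cong_AE[OF _ _ AE2]) (auto simp: D_def)
    moreover have "(\<integral>\<omega>. estimate Q.proto k (take t s) \<omega> \<partial>D) = moment p n k (take t s)"
      by (subst integral_cong_AE[OF _ _ AE]) (auto simp: D_def)
    moreover have "(\<integral>\<omega>. (estimate Q.proto k (take t s) \<omega>)\<^sup>2 \<partial>D) = (moment p n k (take t s))\<^sup>2"
      by (subst integral_cong_AE[OF _ _ AE2]) (auto simp: D_def)
    ultimately show "moment_estimate p n k Q.proto (take t s) UNIV 0 1"
      unfolding moment_estimate_def Let_def u D_def[symmetric] by simp
  qed
qed

section \<open>Choice of the parameters\<close>

lemma harmonic_sum_le:
  assumes "m \<ge> 1"
  shows "(\<Sum>z=1..m. 1 / real z) \<le> 1 + ln m"
proof -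
  have "(\<Sum>z=1..m. 1 / real z) = harm m" by (simp add: harm_def inverse_eq_divide)
  moreover have "harm m - ln (of_nat m) \<le> harm 1 - ln (of_nat 1 :: real)"
    by (rule euler_mascheroni_sequence_decreasing) (use assms in auto)
  ultimately show ?thesis by (simp add: harm_def)
qed

text \<open>Absorbs numerical constants into powers of \<open>n\<close>, as
  \<open>n >= 2\<close>.\<close>

lemma const_le_powr:
  fixes c x y :: real
  assumes "n \<ge> (2::nat)" "c \<le> 2 powr x" "x \<le> y" "0 \<le> x"
  shows "c \<le> real n powr y"
proof -
  have "2 powr x \<le> real n powr x" using assms by (intro powr_mono2) auto
  also have "\<dots> \<le> real n powr y" using assms by (intro powr_mono) auto
  finally show ?thesis using assms by linarith
qed

lemma mult_le_mult_powr:
  fixes c d n x y :: real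
  assumes "0 \<le> d" "c \<le> n powr x" "d \<le> n powr y"
  shows "c * d \<le> n powr (x + y)"
  unfolding powr_add using assms by (intro mult_mono) auto

text \<open>The exponent is polynomial in \<open>n\<close>, hence so is the table size needed for a
  union bound over all streams.\<close>

lemma card_streams_exp:
  assumes "k \<ge> 1" "n \<ge> 1" "k \<le> N" "N \<ge> 1"
  shows "6 * real (card (streams n k N)) \<le> exp (4 * real N ^ 2 * n)"
proof -
  have Nn: "1 \<le> real N ^ 2 * n" "real N \<le> real N ^ 2 * n"
  proof -
    have "1 * 1 * 1 \<le> real N * real N * real n" using assms by (intro mult_mono) auto
    then show "1 \<le> real N ^ 2 * n" by (simp add: power2_eq_square)
    have "1 * real N * 1 \<le> real N * real N * real n" using assms by (intro mult_mono) auto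
    then show "real N \<le> real N ^ 2 * n" by (simp add: power2_eq_square)
  qed
  have "real (card (streams n k N)) \<le> real ((N + 1) * (k * n) ^ N)"
    using card_streams_le[OF assms(1,2)] by (simp only: of_nat_le_iff)
  also have "\<dots> = (real N + 1) * real (k * n) ^ N" by (simp only: of_nat_mult of_nat_add of_nat_power of_nat_1)
  also have "\<dots> \<le> exp (real N) * exp (real N * n) ^ N"
  proof (intro mult_mono power_mono)
    show "real N + 1 \<le> exp (real N)" using exp_ge_add_one_self[of "real N"] by linarith
    have "real (k * n) \<le> real (N * n)" using assms by (simp only: of_nat_le_iff mult_le_mono1)
    also have "\<dots> \<le> exp (real N * n)" using exp_ge_add_one_self[of "real N * n"] unfolding of_nat_mult by linarith
    finally show "real (k * n) \<le> exp (real N * n)" .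
  qed auto
  also have "\<dots> = exp (real N + real N ^ 2 * n)"
    by (simp add: exp_add exp_of_nat_mult[symmetric] power2_eq_square mult.assoc)
  finally have c: "real (card (streams n k N)) \<le> exp (real N + real N ^ 2 * n)" .
  have "(6::real) \<le> exp 2"
  proof -
    have "(2.7::real) \<le> exp 1" using e_approx_32 by (simp add: abs_if split: if_splits)
    then have "2.7 * 2.7 \<le> exp 1 * exp (1::real)" by (intro mult_mono) auto
    then show ?thesis by (simp add: exp_add[symmetric])
  qed
  then have "6 * real (card (streams n k N)) \<le> exp 2 * exp (real N + real N ^ 2 * n)"
    using c by (intro mult_mono) auto
  also have "\<dots> = exp (2 + (real N + real N ^ 2 * n))" by (simp add: exp_add)
  also have "\<dots> \<le> exp (4 * real N ^ 2 * n)" using Nn unfolding exp_le_cancel_iff by linarith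
  finally show ?thesis .
qed

text \<open>
  The estimates are at most \<open>n powr E1\<close>, and \<open>R = EB * log 2 n\<close> makes the failure probabilities at most
  \<open>n powr - ED\<close>. The remaining constants bound the parameters of the protocol relative to powers of
  \<open>log 2 n\<close>.
\<close>

context
  fixes p :: real and a b :: nat
  assumes p: "p \<ge> 2"
begin

definition "E1 = 2 * p + 8 + a * p"
text \<open>\<open>3 * E1\<close> pays for the number of levels times the square of the largest
  estimate, \<open>2 * a\<close> for the stream length and for \<open>1 / \<epsilon>\<close>, and
  \<open>b\<close> for the success probability.\<close>

definition "ED = 3 * E1 + 2 * a + b + 8"
definition "EB = 6 * (ED + 6)"
definition "cL = p + 8 + a * p"
definition "cR = EB + 1"
definition "cC = 5 * cL * cR"
definition "cW = 2 * a + 2 * ED + 5 + 2 * cC + cL"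
definition "kap = 4 powr p + (1::real)"
definition "c1 = cR * (2 * (4 * 4 powr (p - 1) * (a + 8) * kap) + cR)"
definition "c2 = (4 * cR + 5) * (2 * (16 powr p * kap + 1) + cR)"
definition "c3 = 2 * (cC * (c1 + c2) + 2 * cL + 1) + 6"
definition "C_bias = 2 * p * exp p + 2 powr (2 * p + 6) + (2::real)"
definition "C_square = 2 * ((2 powr (2 * p + 6))\<^sup>2 * (4 * exp (2 powr p + 1)) + (2::real))"

lemma const_pos: "0 < E1" "0 < ED" "0 < EB" "0 < cL" "0 < cR" "0 < cC" "0 < cW" "1 \<le> kap" "0 < c1" "0 < c2" "0 < c3"
proof -
  have ap: "0 \<le> real a * p" using p by simp
  show e1: "0 < E1" using p ap unfolding E1_def by linarith
  show ed: "0 < ED" using e1 by (simp add: ED_def)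
  show eb: "0 < EB" using ed by (simp add: EB_def)
  show cl: "0 < cL" using p ap unfolding cL_def by linarith
  show cr: "0 < cR" using eb by (simp add: cR_def)
  show cc: "0 < cC" using cl cr by (simp add: cC_def)
  show "0 < cW" using ed cc cl by (simp add: cW_def)
  show ka: "1 \<le> kap" by (simp add: kap_def)
  show c1: "0 < c1" unfolding c1_def using cr ka by (intro mult_pos_pos add_nonneg_pos mult_nonneg_nonneg) auto
  show c2: "0 < c2" unfolding c2_def using cr ka by (intro mult_pos_pos add_pos_pos mult_pos_pos) (auto intro!: add_pos_pos)
  show "0 < c3" unfolding c3_def using cc c1 c2 cl by (intro add_pos_pos mult_pos_pos) auto
qed

lemma sampling_protocol:
  fixes n k :: nat and \<epsilon> :: real
  assumes n: "n \<ge> 2" and k: "k \<ge> 1" and \<epsilon>: "0 < \<epsilon>" "\<epsilon> < 1" and kN: "k \<le> n ^ a" and eN: "1 / \<epsilon> \<le> n ^ a" and b: "b \<ge> 1"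
  shows "\<exists>P. \<forall>s. valid_stream n k s \<and> length s \<le> n ^ a \<longrightarrow>
     uses_bits P k s (cW * c3 * log 2 n ^ 6 * (real k powr (p - 1) + sqrt k / \<epsilon>)) \<and>
     (\<exists>G. measure_pmf.prob (seeds P k) G \<ge> 1 - 1 / real n ^ b \<and>
          (\<forall>t \<le> length s. moment_estimate p n k P (take t s) G (C_bias * \<epsilon>) C_square))"
proof -
  define lg where "lg = log 2 n"
  define N where "N = n ^ a"
  \<comment> \<open>Halving ensures \<open>e <= 1 / 2\<close> and cancels the factor 2 in the bias
    of \<open>private_coin_protocol\<close>.\<close>
  define e where "e = \<epsilon> / 2"
  \<comment> \<open>With \<open>1 / \<epsilon> <= N\<close> this gives
    \<open>n / m <= e / 32\<close>, half of what \<open>small\<close> allows.\<close>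
  define m where "m = 64 * n * N"
  \<comment> \<open>The moment is at most \<open>N powr p = n powr (a * p)\<close>, and a margin of
    \<open>2 powr (p + 5)\<close> is demanded.\<close>
  define L where "L = nat \<lceil>p + 5 + a * p * lg\<rceil>"
  define R where "R = nat \<lceil>EB * lg\<rceil>"
  define Lam where "Lam = nat \<lceil>2 * sqrt (real k * R) / e\<rceil>"
  have ap: "0 \<le> real a * p" using p by simp
  have lg: "1 \<le> lg" using n by (simp add: lg_def le_log_iff)
  have n0: "0 < real n" using n by simp
  have n_lg: "2 powr (x * lg) = real n powr x" for x
    using n0 by (simp add: lg_def powr_powr[symmetric] mult.commute[of x] powr_log_cancel)
  have lnlg: "ln n \<le> lg"
  proof -
    have "0 \<le> ln (real n)" using n by simp
    then have "ln (real n) * ln 2 \<le> ln (real n) * 1" using ln_2_less_1 by (intro mult_left_mono) auto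
    then show ?thesis by (simp add: lg_def log_def le_divide_eq)
  qed
  have N1: "N \<ge> 1" using n by (simp add: N_def)
  have Npow: "real N = real n powr a" using n0 by (simp add: N_def powr_realpow)
  have e: "0 < e" "e \<le> 1 / 2" using \<epsilon> by (auto simp: e_def)
  have R1: "R \<ge> 1" and RB: "EB * lg \<le> R" and Rle: "R \<le> cR * lg"
  proof -
    have "0 < EB * lg" using const_pos(3) lg by simp
    then have "0 < \<lceil>EB * lg\<rceil>" by simp
    then have eq: "real R = of_int \<lceil>EB * lg\<rceil>" unfolding R_def by simp
    show "R \<ge> 1" using \<open>0 < \<lceil>EB * lg\<rceil>\<close> by (simp add: R_def Suc_le_eq)
    show "EB * lg \<le> R" unfolding eq by simp
    have "real R \<le> EB * lg + 1" unfolding eq by linarith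
    then show "R \<le> cR * lg" using lg by (simp add: cR_def algebra_simps)
  qed
  have Leq: "real L = of_int \<lceil>p + 5 + a * p * lg\<rceil>"
  proof -
    have "0 \<le> p + 5 + a * p * lg" using p ap lg by (intro add_nonneg_nonneg mult_nonneg_nonneg) auto
    then show ?thesis unfolding L_def by (simp add: le_ceiling_iff)
  qed
  have Llo: "p + 5 + a * p * lg \<le> L" unfolding Leq by simp
  have Lhi: "real L \<le> p + 6 + a * p * lg" unfolding Leq by linarith
  have L2: "real L + 2 \<le> cL * lg"
  proof -
    have "(p + 8) * 1 \<le> (p + 8) * lg" using lg p by (intro mult_left_mono) auto
    then show ?thesis using Lhi by (simp add: cL_def algebra_simps)
  qed
  have pL: "2 ^ L \<le> 2 powr (p + 6) * real n powr (a * p)"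
  proof -
    have "(2::real) ^ L = 2 powr L" by (simp add: powr_realpow)
    also have "\<dots> \<le> 2 powr (p + 6 + a * p * lg)" using Lhi by (intro powr_mono) auto
    also have "\<dots> = 2 powr (p + 6) * real n powr (a * p)" by (simp only: powr_add[of 2 "p + 6"] n_lg)
    finally show ?thesis .
  qed
  have pL2: "2 powr (p + 5) * real n powr (a * p) \<le> 2 ^ L"
  proof -
    have "2 powr (p + 5) * real n powr (a * p) = 2 powr (p + 5 + a * p * lg)" by (simp only: powr_add[of 2 "p + 5"] n_lg)
    also have "\<dots> \<le> 2 powr L" using Llo by (intro powr_mono) auto
    also have "\<dots> = 2 ^ L" by (simp add: powr_realpow)
    finally show ?thesis .
  qed
  have kR: "1 \<le> real k * R" using mult_mono[of 1 "real k" 1 "real R"] k R1 by simp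
  have "0 < 2 * sqrt (real k * R) / e" using kR e by (intro divide_pos_pos mult_pos_pos) auto
  then have Lam1: "Lam \<ge> 1" unfolding Lam_def by (simp add: Suc_le_eq)
  have LamR: "2 * sqrt (real k * R) / e \<le> Lam" unfolding Lam_def by (rule real_nat_ceiling_ge)
  \<comment> \<open>Dither precision \<open>m' = k\<close> suffices: the floors then lose at most 1
    over all servers.\<close>
  interpret A: sketch_accuracy p k m k R Lam e
  proof
    show "m \<ge> 1" using n N1 by (simp add: m_def Suc_le_eq)
    show "2 * sqrt (real k * real R) \<le> e * real Lam" using LamR e by (simp add: divide_le_eq mult.commute)
  qed (use p k R1 Lam1 e in auto)
  \<comment> \<open>The number of classes contains \<open>4 * R + 1\<close>. Half of the exponent
    \<open>R / 3\<close> absorbs it, and \<open>n powr 6\<close> absorbs the constant 60; this fixes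
    \<open>EB\<close>.\<close>
  have failR: "(4 * real R + 1) * A.fail \<le> real n powr - ED"
  proof -
    have "real R / 6 \<le> exp (real R / 6)" using exp_ge_add_one_self[of "real R / 6"] by linarith
    then have "4 * real R + 1 \<le> 30 * exp (real R / 6)" using R1 by linarith
    then have "(4 * real R + 1) * A.fail \<le> 30 * exp (real R / 6) * A.fail" by (rule mult_right_mono) (rule A.fail_nonneg)
    also have "\<dots> = 60 * (exp (real R / 6) * exp (- real R / 3))" by (simp add: A.fail_def)
    also have "\<dots> = 60 * exp (- real R / 6)" by (simp add: exp_add[symmetric])
    also have "\<dots> \<le> real n powr 6 * real n powr (- (ED + 6))"
    proof (intro mult_mono)
      show "60 \<le> real n powr 6" by (rule const_le_powr[OF n, of _ 6]) auto
      have "(ED + 6) * ln n \<le> (ED + 6) * lg" using lnlg const_pos(2) by (intro mult_left_mono) auto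
      also have "\<dots> \<le> R / 6" using RB by (simp add: EB_def algebra_simps)
      finally have "exp (- real R / 6) \<le> exp (- ((ED + 6) * ln n))" by simp
      also have "\<dots> = real n powr (- (ED + 6))" using n0 by (simp add: powr_def algebra_simps)
      finally show "exp (- real R / 6) \<le> real n powr (- (ED + 6))" .
    qed auto
    also have "\<dots> = real n powr - ED" unfolding powr_add[symmetric] by simp
    finally show ?thesis .
  qed
  have fail: "A.fail \<le> real n powr - ED"
  proof -
    have "1 * A.fail \<le> (4 * real R + 1) * A.fail" by (intro mult_right_mono A.fail_nonneg) auto
    then show ?thesis using failR by linarith
  qed
  have eN': "1 \<le> \<epsilon> * N" using eN \<epsilon> by (simp add: N_def divide_le_eq mult.commute)
  have E1ge: "12 \<le> E1" using p ap unfolding E1_def by linarith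
  have inv: "real n powr - x \<le> e / 32" if "real a + 7 \<le> x" for x
  proof -
    have "64 * real N * real n powr - x \<le> real n powr 6 * real n powr a * real n powr - x"
      unfolding Npow using const_le_powr[OF n, of 64 6 6] by (intro mult_right_mono) auto
    also have "\<dots> = real n powr (6 + a - x)" unfolding powr_add[symmetric] by simp
    also have "\<dots> \<le> real n powr 0" using that n by (intro powr_mono) auto
    also have "\<dots> \<le> \<epsilon> * N" using eN' n0 by simp
    finally have "64 * real n powr - x * real N \<le> \<epsilon> * N" by (simp add: mult_ac)
    then have "64 * real n powr - x \<le> \<epsilon>" using N1 by simp
    then show ?thesis by (simp add: e_def)
  qed
  interpret S: sketch_levels p k m k R Lam e n L
  proof
    have "real n / m \<le> e / 32"
    proof -
      have "real n / m = 1 / (64 * N)" using n by (simp add: m_def)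
      also have "\<dots> \<le> \<epsilon> / 64" using eN' N1 by (simp add: divide_le_eq)
      finally show ?thesis by (simp add: e_def)
    qed
    moreover have "2 * (real n * A.fail) \<le> e / 32"
    proof -
      have "2 * (real n * A.fail) \<le> real n powr 1 * (real n powr 1 * real n powr - ED)"
        using fail A.fail_nonneg n by (intro mult_mono) auto
      also have "\<dots> = real n powr - (ED - 2)" unfolding powr_add[symmetric] by simp
      also have "\<dots> \<le> e / 32" by (rule inv) (use E1ge in \<open>simp add: ED_def\<close>)
      finally show ?thesis .
    qed
    moreover have "real n * (1 / m + 2 * A.fail) = real n / m + 2 * (real n * A.fail)" by (simp add: algebra_simps)
    ultimately show "real n * (1 / m + 2 * A.fail) \<le> e / 16" by linarith
  qed
  define cap where "cap = Suc (nat \<lfloor>card S.classes * S.class_cost + 2 * k * Suc L\<rfloor>)"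
  \<comment> \<open>The first summand codes table indices, reports and item names, two bits per
    class its phase, and the rest the level.\<close>
  define W where "W = nat \<lceil>(2 * a + 2 * ED + 4) * lg\<rceil> + 2 * card S.classes + L + 2"
  define \<delta> where "\<delta> = real n powr - ED"
  \<comment> \<open>Failures at \<open>N * L\<close> pairs of a time and a level, with
    \<open>L + 2 <= n powr E1\<close>; the 3 leaves room for constants.\<close>
  define \<beta> where "\<beta> = real n powr (a + 3 + E1 - ED)"
  \<comment> \<open>Hoeffding's exponent \<open>2 * Sz * \<delta>\<^sup>2\<close> must exceed the
    logarithm of the number of streams in \<open>card_streams_exp\<close>.\<close>
  define Sz where "Sz = nat \<lceil>4 * real N ^ 2 * n * real n powr (2 * ED)\<rceil>"
  have cardC: "card S.classes = (L + 1) * (4 * R + 1)" by (simp add: S.classes_def card_cartesian_product)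
  have max: "S.max_est + 2 ^ L \<le> real n powr E1"
  proof -
    have "1 \<le> 2 powr p * real n"
      using mult_mono[of 1 "2 powr p" 1 "real n"] p n by (simp add: ge_one_powr_ge_zero)
    then have "S.max_est + 2 ^ L \<le> 2 * (2 powr p * 2 ^ L * n)"
      using mult_right_mono[of 1 "2 powr p * real n" "2 ^ L"] by (simp add: S.max_est_def mult_ac)
    also have "\<dots> \<le> 2 * (2 powr p * (2 powr (p + 6) * real n powr (a * p)) * n)"
      by (intro mult_left_mono mult_right_mono pL) auto
    also have "\<dots> = 2 powr (2 * p + 7) * (real n powr (a * p) * real n powr 1)"
    proof -
      have "2 * (2 powr p * 2 powr (p + 6)) = 2 powr (2 * p + (7::real))"
        by (simp add: powr_add[symmetric] powr_mult_base add.commute)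
      then show ?thesis using n0 by (simp add: mult_ac)
    qed
    also have "\<dots> \<le> real n powr (2 * p + 7) * (real n powr (a * p) * real n powr 1)"
      using n p by (intro mult_right_mono powr_mono2) auto
    also have "\<dots> = real n powr E1" unfolding powr_add[symmetric] by (simp add: E1_def algebra_simps)
    finally show ?thesis .
  qed
  have max0: "0 \<le> S.max_est" by (rule S.max_est_nonneg)
  have maxE: "S.max_est \<le> real n powr E1" using max by (smt (verit) zero_le_power)
  have Ln: "real L + 2 \<le> real n powr E1"
  proof -
    have "real L + 2 \<le> 2 * 2 ^ L"
    proof -
      have "L + 2 \<le> 2 * 2 ^ L" by (induction L) auto
      then have "real (L + 2) \<le> real (2 * 2 ^ L)" by (simp only: of_nat_le_iff)
      then show ?thesis by simp
    qed
    also have "\<dots> \<le> S.max_est + 2 ^ L"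
    proof -
      have "1 * 2 ^ L * 1 \<le> 2 powr p * 2 ^ L * real n" using p n by (intro mult_mono ge_one_powr_ge_zero) auto
      then show ?thesis by (simp add: S.max_est_def)
    qed
    finally show ?thesis using max by linarith
  qed
  have pp: "real n powr x \<le> real n powr y" if "x \<le> y" for x y using that n by (intro powr_mono) auto
  have q1: "(real L + 2) * A.fail * (S.max_est + 2 ^ L) \<le> e"
  proof -
    have "(real L + 2) * A.fail * (S.max_est + 2 ^ L) \<le> real n powr ((E1 + - ED) + E1)"
      by (intro mult_le_mult_powr Ln fail max A.fail_nonneg) (use max0 in auto)
    also have "\<dots> \<le> real n powr - (real a + 7)" by (rule pp) (use E1ge in \<open>simp add: ED_def\<close>)
    also have "\<dots> \<le> e / 32" by (rule inv) simp
    finally show ?thesis using e by linarith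
  qed
  have q2: "(real L + 2) * A.fail * S.max_est\<^sup>2 \<le> 1"
  proof -
    have "(real L + 2) * A.fail * (S.max_est * S.max_est) \<le> real n powr ((E1 + - ED) + (E1 + E1))"
      by (intro mult_le_mult_powr Ln fail maxE A.fail_nonneg) (use max0 in auto)
    also have "\<dots> \<le> real n powr 0" by (rule pp) (simp add: ED_def)
    finally show ?thesis using n0 by (simp add: power2_eq_square)
  qed
  have \<beta>1: "(real (Suc N * Suc L + 2 * card S.classes)) * A.fail + \<delta> \<le> \<beta>"
  proof -
    have "real (Suc N * Suc L + 2 * card S.classes) * A.fail
      = (real N + 1) * (real L + 1) * A.fail + 2 * (real L + 1) * ((4 * real R + 1) * A.fail)"
      by (simp add: cardC algebra_simps)
    also have "\<dots> \<le> (real N + 1) * (real L + 1) * \<delta> + 2 * (real L + 1) * \<delta>"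
      unfolding \<delta>_def by (intro add_mono mult_left_mono fail failR) auto
    also have "\<dots> = (real N + 3) * (real L + 1) * \<delta>" by (simp add: algebra_simps)
    finally have "real (Suc N * Suc L + 2 * card S.classes) * A.fail + \<delta> \<le> (real N + 3) * (real L + 1) * \<delta> + 1 * 1 * \<delta>" by simp
    also have "\<dots> \<le> (real N + 3) * (real L + 1) * \<delta> + (real N + 3) * 1 * \<delta>"
      by (intro add_left_mono mult_right_mono) (auto simp: \<delta>_def)
    also have "\<dots> = (real N + 3) * (real L + 2) * \<delta>" by (simp add: algebra_simps)
    also have "\<dots> \<le> real n powr ((2 + real a) + E1 + - ED)"
    proof (intro mult_le_mult_powr Ln)
      have "real N + 3 \<le> 4 * real N" using N1 by simp
      also have "\<dots> \<le> real n powr (2 + real a)"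
        unfolding Npow powr_add using const_le_powr[OF n, of 4 2 2] by (intro mult_right_mono) auto
      finally show "real N + 3 \<le> real n powr (2 + real a)" by simp
    qed (auto simp: \<delta>_def)
    also have "\<dots> \<le> \<beta>" unfolding \<beta>_def by (rule pp) simp
    finally show ?thesis .
  qed
  have \<beta>n: "\<beta> \<le> 1 / real n ^ b"
  proof -
    have "\<beta> \<le> real n powr - real b" unfolding \<beta>_def by (rule pp) (use E1ge in \<open>simp add: ED_def\<close>)
    then show ?thesis using n0 by (simp add: powr_minus_divide powr_realpow)
  qed
  have "1 / real n ^ b \<le> 1 / 2"
  proof -
    have "real n ^ 1 \<le> real n ^ b" using b n by (intro power_increasing) auto
    moreover have "2 \<le> real n" using n by simp
    ultimately have "2 \<le> real n ^ b" unfolding power_one_right by linarith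
    then show ?thesis using n0 by (intro divide_left_mono) auto
  qed
  then have \<beta>2: "\<beta> \<le> 1 / 2" using \<beta>n by linarith
  have d1: "(\<delta> + \<beta>) * (S.max_est + 2 ^ L) \<le> e"
  proof -
    have "\<delta> \<le> \<beta>" unfolding \<delta>_def \<beta>_def by (rule pp) (use const_pos(1) in simp)
    then have "\<delta> + \<beta> \<le> 2 * \<beta>" by simp
    also have "\<dots> \<le> real n powr (1 + (a + 3 + E1 - ED))"
      unfolding powr_add \<beta>_def using n by (intro mult_right_mono) auto
    finally have "(\<delta> + \<beta>) * (S.max_est + 2 ^ L) \<le> real n powr (1 + (a + 3 + E1 - ED) + E1)"
      by (intro mult_le_mult_powr max) (use max0 in auto)
    also have "\<dots> \<le> real n powr - (real a + 7)" by (rule pp) (use E1ge in \<open>simp add: ED_def\<close>)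
    also have "\<dots> \<le> e / 32" by (rule inv) simp
    finally show ?thesis using e by linarith
  qed
  have d2: "\<delta> * S.max_est\<^sup>2 \<le> 1"
  proof -
    have "\<delta> * (S.max_est * S.max_est) \<le> real n powr (- ED + (E1 + E1))"
      by (intro mult_le_mult_powr maxE) (use max0 in \<open>auto simp: \<delta>_def\<close>)
    also have "\<dots> \<le> real n powr 0" by (rule pp) (use E1ge in \<open>simp add: ED_def\<close>)
    finally show ?thesis using n0 by (simp add: power2_eq_square)
  qed
  have N2n: "1 \<le> real N ^ 2 * n"
    using mult_mono[of 1 "real N ^ 2" 1 "real n"] N1 n by simp
  have ED1: "1 \<le> real n powr (2 * ED)" using n const_pos(2) by (intro ge_one_powr_ge_zero) auto
  have Szlo: "4 * real N ^ 2 * n * real n powr (2 * ED) \<le> Sz" unfolding Sz_def by (rule real_nat_ceiling_ge)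
  have Sz0: "Sz > 0"
  proof -
    have "0 < 4 * real N ^ 2 * n * real n powr (2 * ED)" using N1 n0 by simp
    then show ?thesis using Szlo by (metis less_le_trans of_nat_0_less_iff)
  qed
  have sample: "6 * real (card (streams n k N)) * exp (- 2 * real Sz * \<delta>\<^sup>2) < 1"
  proof -
    have dd: "\<delta>\<^sup>2 * real n powr (2 * ED) = 1" using n0 by (simp add: \<delta>_def power2_eq_square powr_add[symmetric])
    have "4 * real N ^ 2 * n = 4 * real N ^ 2 * n * real n powr (2 * ED) * \<delta>\<^sup>2" using dd by (simp add: mult_ac)
    also have "\<dots> \<le> Sz * \<delta>\<^sup>2" using Szlo by (intro mult_right_mono) auto
    finally have *: "4 * real N ^ 2 * n \<le> Sz * \<delta>\<^sup>2" .
    have "6 * real (card (streams n k N)) * exp (- 2 * real Sz * \<delta>\<^sup>2) \<le> exp (4 * real N ^ 2 * n) * exp (- 2 * real Sz * \<delta>\<^sup>2)"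
      by (intro mult_right_mono card_streams_exp) (use k n kN N1 in \<open>auto simp: N_def\<close>)
    also have "\<dots> = exp (4 * real N ^ 2 * n - 2 * (Sz * \<delta>\<^sup>2))" by (simp add: exp_add[symmetric])
    also have "\<dots> < 1"
    proof -
      have "4 * real N ^ 2 * n - 2 * (Sz * \<delta>\<^sup>2) < 0" using * N2n by linarith
      then show ?thesis by simp
    qed
    finally show ?thesis .
  qed
  have capl: "card S.classes * S.class_cost + 2 * k * Suc L < real cap" unfolding cap_def by linarith
  have Wpow: "(2::nat) ^ W = 2 ^ nat \<lceil>(2 * a + 2 * ED + 4) * lg\<rceil> * (4 ^ card S.classes * 2 ^ (L + 2))"
    by (simp add: W_def power_add power_mult)
  have Wn: "real n powr (2 * a + 2 * ED + 4) \<le> real (2 ^ nat \<lceil>(2 * a + 2 * ED + 4) * lg\<rceil>)"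
  proof -
    have "real n powr (2 * a + 2 * ED + 4) = 2 powr ((2 * a + 2 * ED + 4) * lg)" by (rule n_lg[symmetric])
    also have "\<dots> \<le> 2 powr (nat \<lceil>(2 * a + 2 * ED + 4) * lg\<rceil>)" by (intro powr_mono real_nat_ceiling_ge) auto
    finally show ?thesis by (simp add: powr_realpow)
  qed
  have Wle: "X \<le> 2 ^ W" if "real X \<le> real n powr (2 * a + 2 * ED + 4)" for X :: nat
  proof -
    have "real X \<le> real (2 ^ nat \<lceil>(2 * a + 2 * ED + 4) * lg\<rceil>)" using that Wn by (rule order_trans)
    then have "X \<le> 2 ^ nat \<lceil>(2 * a + 2 * ED + 4) * lg\<rceil>" by (simp only: of_nat_le_iff)
    moreover have "(1::nat) \<le> 4 ^ card S.classes * 2 ^ (L + 2)" by (simp add: Suc_le_eq)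
    ultimately have "X * 1 \<le> 2 ^ nat \<lceil>(2 * a + 2 * ED + 4) * lg\<rceil> * (4 ^ card S.classes * 2 ^ (L + 2))"
      by (rule mult_le_mono)
    then show ?thesis unfolding Wpow mult_1_right .
  qed
  have code1: "Sz \<le> 2 ^ W"
  proof (rule Wle)
    have "real Sz \<le> 4 * real N ^ 2 * n * real n powr (2 * ED) + 1"
      unfolding Sz_def using N1 n0 by (simp add: of_nat_ceiling)
    also have "\<dots> \<le> 5 * (real N ^ 2 * n * real n powr (2 * ED))"
      using mult_mono[OF N2n ED1] by (simp add: mult_ac)
    also have "\<dots> \<le> real n powr 3 * (real n powr (2 * real a) * real n powr 1 * real n powr (2 * ED))"
    proof (intro mult_mono)
      show "5 \<le> real n powr 3" by (rule const_le_powr[OF n, of _ 3]) auto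
      show "real N ^ 2 \<le> real n powr (2 * real a)" unfolding Npow by (simp add: power2_eq_square powr_add[symmetric])
    qed (use n0 in auto)
    also have "\<dots> = real n powr (2 * a + 2 * ED + 4)" unfolding powr_add[symmetric] by (simp add: algebra_simps)
    finally show "real Sz \<le> real n powr (2 * a + 2 * ED + 4)" .
  qed
  have code2: "n * (N + 1) \<le> 2 ^ W"
  proof (rule Wle)
    have "real (n * (N + 1)) = real n * (real N + 1)" by (simp only: of_nat_mult of_nat_add of_nat_1)
    also have "\<dots> \<le> real n * (2 * real N)" using N1 by (intro mult_left_mono) auto
    also have "\<dots> \<le> real n powr 1 * (real n powr 1 * real n powr a)" unfolding Npow using n by (intro mult_mono) auto
    also have "\<dots> = real n powr (2 + real a)" unfolding powr_add[symmetric] by simp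
    also have "\<dots> \<le> real n powr (2 * a + 2 * ED + 4)" by (rule pp) (use const_pos(2) in simp)
    finally show "real (n * (N + 1)) \<le> real n powr (2 * a + 2 * ED + 4)" .
  qed
  have code3: "1 + n * 3 ^ card S.classes * (L + 2) \<le> 2 ^ W"
  proof -
    have "n \<le> 2 ^ nat \<lceil>(2 * a + 2 * ED + 4) * lg\<rceil>"
    proof -
      have "real n = real n powr 1" using n0 by simp
      also have "\<dots> \<le> real n powr (2 * a + 2 * ED + 4)" by (rule pp) (use const_pos(2) in simp)
      also note Wn
      finally have "real n \<le> real (2 ^ nat \<lceil>(2 * a + 2 * ED + 4) * lg\<rceil>)" .
      then show ?thesis by (simp only: of_nat_le_iff)
    qed
    moreover have "L + 3 \<le> 2 ^ (L + 2)" by (induction L) auto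
    moreover have "(3::nat) ^ card S.classes \<le> 4 ^ card S.classes" by (intro power_mono) auto
    ultimately have "n * (3 ^ card S.classes * (L + 3)) \<le> 2 ^ W" unfolding Wpow by (intro mult_le_mono)
    moreover have "1 + n * 3 ^ card S.classes * (L + 2) \<le> n * (3 ^ card S.classes * (L + 3))"
    proof -
      have "1 \<le> n * 3 ^ card S.classes" using n by (simp add: Suc_le_eq)
      then show ?thesis by (simp add: algebra_simps)
    qed
    ultimately show ?thesis by linarith
  qed
  have FL: "2 powr (p + 5) * S.F (counts s) \<le> 2 ^ L" if "s \<in> streams n k N" for s
  proof -
    have "S.F (counts s) \<le> (\<Sum>i<n. A.fr (\<lambda>j. counts s j i)) powr p"
      unfolding S.F_def by (rule sum_powr_le_powr_sum) (use p A.fr_nonneg in auto)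
    also have "(\<Sum>i<n. A.fr (\<lambda>j. counts s j i)) = real (\<Sum>i<n. \<Sum>j<k. counts s j i)" by (simp add: A.fr_def)
    also have "real (\<Sum>i<n. \<Sum>j<k. counts s j i) powr p \<le> real N powr p"
    proof (intro powr_mono2)
      have "(\<Sum>i<n. \<Sum>j<k. counts s j i) \<le> N" using sum_counts_le[of s k n] that by (simp add: streams_def)
      then show "real (\<Sum>i<n. \<Sum>j<k. counts s j i) \<le> real N" by (simp only: of_nat_le_iff)
    qed (use p in \<open>auto intro!: sum_nonneg\<close>)
    also have "\<dots> = real n powr (a * p)" by (simp add: Npow powr_powr)
    finally have "2 powr (p + 5) * S.F (counts s) \<le> 2 powr (p + 5) * real n powr (a * p)" by (rule mult_left_mono) simp
    then show ?thesis using pL2 by linarith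
  qed
  have "W > 0" by (simp add: W_def)
  from S.private_coin_protocol[OF _ Sz0 this capl code1 code2 code3 _ \<beta>1 \<beta>2 sample FL q1 q2 d1 d2] n
  obtain P where P: "\<And>s. valid_stream n k s \<and> length s \<le> N \<Longrightarrow>
    uses_bits P k s (real (W * (2 * cap + 4 * k + 2))) \<and>
    (\<exists>G. measure_pmf.prob (seeds P k) G \<ge> 1 - \<beta> \<and>
      (\<forall>t\<le>length s. moment_estimate p n k P (take t s) G
         (2 * (S.bias_const + 2 powr (2 * p + 6) + 2) * e) (2 * (S.square_const + 1))))"
    by (auto simp: \<delta>_def)
  define Xi where "Xi = real k powr (p - 1) + sqrt k / \<epsilon>"
  have k1: "1 \<le> real k powr (p - 1)" using k p by (intro ge_one_powr_ge_zero) auto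
  \<comment> \<open>By \<open>p >= 2\<close>, the \<open>k\<close> messages of a broadcast fit into
    the first term of the budget.\<close>
  have kk: "real k \<le> real k powr (p - 1)" using k p powr_mono[of 1 "p - 1" "real k"] by simp
  have sq: "0 \<le> sqrt k / \<epsilon>" using \<epsilon> by simp
  have Xi: "1 \<le> Xi" "real k \<le> Xi" "real k powr (p - 1) \<le> Xi" "sqrt k / \<epsilon> \<le> Xi" using k1 kk sq by (auto simp: Xi_def)
  have lgp: "lg ^ i \<le> lg ^ j" if "i \<le> j" for i j using that lg by (intro power_increasing) auto
  have cost: "S.class_cost \<le> (c1 + c2) * lg ^ 2 * Xi"
  proof -
    have H: "(\<Sum>z=1..m. 1 / real z) \<le> (a + 8) * lg"
    proof -
      have "(\<Sum>z=1..m. 1 / real z) \<le> 1 + ln m" by (rule harmonic_sum_le) (use n N1 in \<open>simp add: m_def Suc_le_eq\<close>)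
      moreover have "ln (real m) \<le> (a + 7) * ln n"
      proof -
        have "real m \<le> real n powr (6 + (1 + real a))"
          unfolding m_def powr_add Npow[symmetric] using const_le_powr[OF n, of 64 6 6] n0 N1
          by (simp add: mult.assoc[symmetric])
        then have "ln (real m) \<le> ln (real n powr (6 + (1 + real a)))" using n N1 by (subst ln_le_cancel_iff) (auto simp: m_def)
        also have "\<dots> = (a + 7) * ln n" using n0 by (simp add: ln_powr)
        finally show ?thesis .
      qed
      moreover have "(a + 7) * ln n \<le> (a + 7) * lg" using lnlg by (intro mult_left_mono) auto
      ultimately show ?thesis using lg by (simp add: algebra_simps)
    qed
    have cRlg: "0 \<le> cR * lg" using const_pos(5) lg by simp
    have "S.mu_reports kap \<le> 4 * (4 powr (p - 1) * Xi) * ((a + 8) * lg) * kap"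
      unfolding S.mu_reports_def
    proof (intro mult_right_mono mult_mono H)
      show "real (4 * k) powr (p - 1) \<le> 4 powr (p - 1) * Xi" using Xi(3) by (simp add: powr_mult)
    qed (use const_pos(8) Xi lg in \<open>auto intro!: sum_nonneg mult_nonneg_nonneg\<close>)
    also have "\<dots> = 4 * 4 powr (p - 1) * (a + 8) * kap * (lg * Xi)" by (simp add: mult_ac)
    finally have mr: "S.mu_reports kap \<le> 4 * 4 powr (p - 1) * (a + 8) * kap * (lg * Xi)" .
    have mr0: "0 \<le> S.mu_reports kap"
      unfolding S.mu_reports_def using const_pos(8) by (intro mult_nonneg_nonneg sum_nonneg) auto
    have RX: "real R \<le> cR * (lg * Xi)"
      using mult_mono[OF Rle Xi(1)] cRlg by (simp add: mult.assoc)
    have "R * (2 * S.mu_reports kap + R) \<le> (cR * lg) * (2 * (4 * 4 powr (p - 1) * (a + 8) * kap * (lg * Xi)) + cR * (lg * Xi))"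
    proof (intro mult_mono add_mono mult_left_mono mr RX Rle)
      show "0 \<le> 2 * S.mu_reports kap + R" using mr0 by simp
    qed (use cRlg mr0 in auto)
    also have "\<dots> = c1 * lg ^ 2 * Xi" by (simp add: c1_def power2_eq_square algebra_simps)
    finally have t1: "R * (2 * S.mu_reports kap + R) \<le> c1 * lg ^ 2 * Xi" .
    have LamX: "Lam + 4 * k \<le> (4 * cR + 5) * lg * Xi"
    proof -
      have "sqrt (real k * R) = sqrt k * sqrt R" by (simp add: real_sqrt_mult)
      also have "\<dots> \<le> sqrt k * R"
      proof (intro mult_left_mono)
        have "sqrt R \<le> sqrt (real R * R)" using R1 by (intro real_sqrt_le_mono) (simp add: mult_le_cancel_left1)
        then show "sqrt R \<le> R" by simp
      qed simp
      finally have "2 * sqrt (real k * R) / e \<le> 2 * (sqrt k * R) / e" using e by (intro divide_right_mono) auto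
      also have "\<dots> = 4 * R * (sqrt k / \<epsilon>)" by (simp add: e_def field_simps)
      also have "\<dots> \<le> 4 * (cR * lg) * Xi" using Rle Xi(4) sq cRlg by (intro mult_mono) auto
      finally have "2 * sqrt (real k * R) / e \<le> 4 * (cR * lg) * Xi" .
      moreover have "real Lam \<le> 2 * sqrt (real k * R) / e + 1"
        unfolding Lam_def using e by (simp add: of_nat_ceiling)
      ultimately have "real Lam + 4 * k \<le> 4 * (cR * lg) * Xi + 5 * Xi" using Xi by linarith
      also have "\<dots> \<le> 4 * (cR * lg) * Xi + 5 * (lg * Xi)" using lg Xi by (intro add_left_mono mult_left_mono) auto
      finally show ?thesis by (simp add: algebra_simps)
    qed
    have "2 * S.mu_tracked kap + R \<le> 2 * (16 powr p * kap + 1) * lg + cR * lg"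
    proof (intro add_mono Rle)
      have "0 \<le> 2 * (16 powr p * kap + 1)" using const_pos(8) by simp
      from mult_left_mono[OF lg this] show "2 * S.mu_tracked kap \<le> 2 * (16 powr p * kap + 1) * lg"
        by (simp add: S.mu_tracked_def)
    qed
    then have "(Lam + 4 * k) * (2 * S.mu_tracked kap + R) \<le> ((4 * cR + 5) * lg * Xi) * (2 * (16 powr p * kap + 1) * lg + cR * lg)"
      using LamX const_pos(5,8) lg Xi by (intro mult_mono) (auto simp: S.mu_tracked_def)
    also have "\<dots> = c2 * lg ^ 2 * Xi" by (simp add: c2_def power2_eq_square algebra_simps)
    finally show ?thesis using t1 unfolding S.class_cost_def kap_def[symmetric] by (simp add: algebra_simps)
  qed
  have cC: "real (card S.classes) \<le> cC * lg ^ 2"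
  proof -
    have "real (card S.classes) = (real L + 1) * (4 * real R + 1)" by (simp add: cardC algebra_simps)
    also have "\<dots> \<le> (cL * lg) * (5 * (cR * lg))"
      using L2 Rle R1 const_pos(4) lg by (intro mult_mono) auto
    finally show ?thesis by (simp add: cC_def power2_eq_square algebra_simps)
  qed
  have Wb: "real W \<le> cW * lg ^ 2"
  proof -
    have "0 \<le> (2 * a + 2 * ED + 4) * lg" using const_pos(2) lg by simp
    then have "real (nat \<lceil>(2 * a + 2 * ED + 4) * lg\<rceil>) \<le> (2 * a + 2 * ED + 4) * lg + 1" by linarith
    then have "real W \<le> (2 * a + 2 * ED + 4) * lg + 1 + 2 * (cC * lg ^ 2) + cL * lg"
      using cC L2 by (simp add: W_def)
    also have "\<dots> \<le> (2 * a + 2 * ED + 4) * lg ^ 2 + lg ^ 2 + 2 * (cC * lg ^ 2) + cL * lg ^ 2"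
      using lgp[of 1 2] lgp[of 0 2] const_pos(2,4,6) by (intro add_mono mult_left_mono) auto
    finally show ?thesis by (simp add: cW_def algebra_simps)
  qed
  have Xl: "Xi \<le> lg ^ 4 * Xi" "lg * Xi \<le> lg ^ 4 * Xi" using lgp[of 0 4] lgp[of 1 4] Xi(1) by (auto intro!: mult_right_mono)
  have capb: "2 * real cap + 4 * k + 2 \<le> c3 * lg ^ 4 * Xi"
  proof -
    have cc0: "0 \<le> S.class_cost"
      unfolding S.class_cost_def S.mu_reports_def S.mu_tracked_def
      by (intro add_nonneg_nonneg mult_nonneg_nonneg sum_nonneg) auto
    have "real cap \<le> card S.classes * S.class_cost + 2 * k * Suc L + 1"
      unfolding cap_def using cc0 by (simp add: of_nat_floor)
    also have "\<dots> \<le> (cC * lg ^ 2) * ((c1 + c2) * lg ^ 2 * Xi) + 2 * Xi * (cL * lg) + Xi"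
    proof (intro add_mono mult_mono cC cost)
      have "real (2 * k * Suc L) = 2 * real k * (real L + 1)" by (simp add: algebra_simps)
      also have "\<dots> \<le> 2 * Xi * (cL * lg)" using Xi L2 by (intro mult_mono) auto
      finally show "real (2 * k * Suc L) \<le> 2 * Xi * (cL * lg)" .
    qed (use Xi cc0 const_pos(6) lg in auto)
    also have "\<dots> = cC * (c1 + c2) * (lg ^ 4 * Xi) + 2 * cL * (lg * Xi) + Xi"
    proof -
      have "lg ^ 4 = lg ^ 2 * lg ^ 2" by (simp add: power_add[symmetric])
      then show ?thesis by (simp add: mult_ac)
    qed
    also have "\<dots> \<le> cC * (c1 + c2) * (lg ^ 4 * Xi) + 2 * cL * (lg ^ 4 * Xi) + lg ^ 4 * Xi"
      using Xl const_pos(4,6,9,10) by (intro add_mono mult_left_mono mult_nonneg_nonneg) auto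
    finally have "real cap \<le> (cC * (c1 + c2) + 2 * cL + 1) * (lg ^ 4 * Xi)" by (simp add: algebra_simps)
    moreover have "4 * real k + 2 \<le> 6 * (lg ^ 4 * Xi)" using Xi Xl by linarith
    ultimately show ?thesis by (simp add: c3_def algebra_simps)
  qed
  \<comment> \<open>The power 6 is made up of three squares of the logarithm: the length
    \<open>W\<close>, the number of classes, and the cost per class.\<close>
  have bitsb: "real (W * (2 * cap + 4 * k + 2)) \<le> cW * c3 * log 2 n ^ 6 * (real k powr (p - 1) + sqrt k / \<epsilon>)"
  proof -
    have "real (W * (2 * cap + 4 * k + 2)) = real W * (2 * real cap + 4 * k + 2)" by (simp add: algebra_simps)
    also have "\<dots> \<le> (cW * lg ^ 2) * (c3 * lg ^ 4 * Xi)"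
      using Wb capb const_pos(7) lg by (intro mult_mono) auto
    also have "\<dots> = cW * c3 * lg ^ 6 * Xi"
    proof -
      have "lg ^ 6 = lg ^ 2 * lg ^ 4" by (simp add: power_add[symmetric])
      then show ?thesis by (simp add: mult_ac)
    qed
    finally show ?thesis by (simp add: lg_def Xi_def)
  qed
  show ?thesis
  proof (intro exI[of _ P] allI impI)
    fix s assume s: "valid_stream n k s \<and> length s \<le> n ^ a"
    then obtain G where G: "measure_pmf.prob (seeds P k) G \<ge> 1 - \<beta>"
      "\<forall>t\<le>length s. moment_estimate p n k P (take t s) G
         (2 * (S.bias_const + 2 powr (2 * p + 6) + 2) * e) (2 * (S.square_const + 1))"
      and u: "uses_bits P k s (real (W * (2 * cap + 4 * k + 2)))"
      using P[of s] unfolding N_def by blast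
    have "uses_bits P k s (cW * c3 * log 2 n ^ 6 * (real k powr (p - 1) + sqrt k / \<epsilon>))"
      using u bitsb unfolding uses_bits_def by (meson order_trans)
    moreover have "1 - 1 / real n ^ b \<le> measure_pmf.prob (seeds P k) G" using G(1) \<beta>n by linarith
    moreover have "2 * (S.bias_const + 2 powr (2 * p + 6) + 2) * e = C_bias * \<epsilon>"
      by (simp add: C_bias_def S.bias_const_def e_def)
    moreover have "2 * (S.square_const + 1) = C_square" by (simp add: C_square_def S.square_const_def)
    ultimately show "uses_bits P k s (cW * c3 * log 2 n ^ 6 * (real k powr (p - 1) + sqrt k / \<epsilon>)) \<and>
      (\<exists>G. measure_pmf.prob (seeds P k) G \<ge> 1 - 1 / real n ^ b \<and>
          (\<forall>t \<le> length s. moment_estimate p n k P (take t s) G (C_bias * \<epsilon>) C_square))"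
      using G(2) by (intro conjI exI[of _ G]) auto
  qed
qed

end

lemma uses_bits_mono: "uses_bits P k s B \<Longrightarrow> B \<le> B' \<Longrightarrow> uses_bits P k s B'"
  unfolding uses_bits_def by (meson order_trans)

theorem mainTheorem11:
  fixes p :: real and a b :: nat
  assumes "p \<ge> 2" and "b \<ge> 1"
  shows "\<exists>(C::real) (K::real) (d::nat).
    \<forall>(n::nat) (k::nat) (\<epsilon>::real). n \<ge> 2 \<and> k \<ge> 1 \<and> 0 < \<epsilon> \<and> \<epsilon> < 1 \<longrightarrow>
      (\<exists>P. \<forall>s. valid_stream n k s \<and> length s \<le> n ^ a \<longrightarrow>
         uses_bits P k s
           (real k powr (p - 1) * (K * log 2 n ^ d) + sqrt k / \<epsilon> * (K * log 2 n ^ d)) \<and>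
         (\<exists>G. measure_pmf.prob (seeds P k) G \<ge> 1 - 1 / real n ^ b \<and>
              (\<forall>t \<le> length s.
                 moment_estimate p n k P (take t s) G (C * \<epsilon>) (K * log 2 n ^ d))))"
proof -
  define K1 where "K1 = cW p a b * c3 p a b"
  define K where "K = K1 + 10 * (real a + 4) + C_square p + 1"
  have p: "p \<ge> 2" and b: "b \<ge> 1" by fact+
  have K1: "0 < K1" unfolding K1_def using const_pos(7,11)[OF p] by simp
  have Csq: "0 \<le> C_square p" by (simp add: C_square_def[OF p])
  have Cb: "0 \<le> C_bias p" using p by (simp add: C_bias_def[OF p])
  show ?thesis
  proof (rule exI[of _ "C_bias p"], rule exI[of _ K], rule exI[of _ "6::nat"], intro allI impI)
    fix n k :: nat and \<epsilon> :: real
    assume "n \<ge> 2 \<and> k \<ge> 1 \<and> 0 < \<epsilon> \<and> \<epsilon> < 1"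
    then have n: "n \<ge> 2" and k: "k \<ge> 1" and \<epsilon>: "0 < \<epsilon>" "\<epsilon> < 1" by auto
    define lg where "lg = log 2 n"
    define Xi where "Xi = real k powr (p - 1) + sqrt k / \<epsilon>"
    have lg: "1 \<le> lg" using n by (simp add: lg_def le_log_iff)
    have n0: "0 < real n" using n by simp
    have lg6: "1 \<le> lg ^ 6" "lg \<le> lg ^ 6" using lg power_increasing[of 1 6 lg] by auto
    have kk: "real k \<le> real k powr (p - 1)" using k p powr_mono[of 1 "p - 1" "real k"] by simp
    have sq: "0 \<le> sqrt k / \<epsilon>" using \<epsilon> by simp
    have Xi: "real k \<le> Xi" "sqrt k / \<epsilon> \<le> Xi" "0 \<le> Xi" using kk sq by (auto simp: Xi_def)
    have budget: "real k powr (p - 1) * (K * log 2 n ^ 6) + sqrt k / \<epsilon> * (K * log 2 n ^ 6) = K * lg ^ 6 * Xi"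
      by (simp add: lg_def Xi_def algebra_simps)
    have KK: "K1 \<le> K" "10 * (real a + 4) \<le> K" "C_square p \<le> K" "1 \<le> K" "0 \<le> K"
      using K1 Csq by (auto simp: K_def)
    have Klg: "K \<le> K * lg ^ 6" using mult_left_mono[OF lg6(1) KK(5)] by simp
    show "\<exists>P. \<forall>s. valid_stream n k s \<and> length s \<le> n ^ a \<longrightarrow>
         uses_bits P k s
           (real k powr (p - 1) * (K * log 2 n ^ 6) + sqrt k / \<epsilon> * (K * log 2 n ^ 6)) \<and>
         (\<exists>G. measure_pmf.prob (seeds P k) G \<ge> 1 - 1 / real n ^ b \<and>
              (\<forall>t \<le> length s.
                 moment_estimate p n k P (take t s) G (C_bias p * \<epsilon>) (K * log 2 n ^ 6)))"
    proof (cases "k \<le> n ^ a \<and> 1 / \<epsilon> \<le> n ^ a")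
      case True
      from sampling_protocol[where p = p and a = a and b = b, OF p n k \<epsilon> _ _ b] True
      obtain P where P: "\<And>s. valid_stream n k s \<and> length s \<le> n ^ a \<Longrightarrow>
         uses_bits P k s (K1 * lg ^ 6 * Xi) \<and>
         (\<exists>G. measure_pmf.prob (seeds P k) G \<ge> 1 - 1 / real n ^ b \<and>
          (\<forall>t \<le> length s. moment_estimate p n k P (take t s) G (C_bias p * \<epsilon>) (C_square p)))"
        by (auto simp: K1_def lg_def Xi_def)
      have le: "K1 * lg ^ 6 * Xi \<le> K * lg ^ 6 * Xi" using KK(1) Xi(3) lg by (intro mult_right_mono) auto
      have "C_square p \<le> K * log 2 n ^ 6" using KK(3) Klg unfolding lg_def by linarith
      then show ?thesis
        unfolding budget using P le by (intro exI[of _ P]) (meson uses_bits_mono moment_estimate_mono order_refl)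
    next
      case False
      define W where "W = nat \<lceil>(real a + 3) * lg\<rceil>"
      have x0: "0 < (real a + 3) * lg" using lg by simp
      then have W0: "W > 0" by (simp add: W_def)
      have nW: "real n ^ (a + 3) \<le> real (2 ^ W)"
      proof -
        have "real n ^ (a + 3) = real n powr (real a + 3)" using n0 by (simp add: powr_add powr_realpow power_add)
        also have "\<dots> = 2 powr ((real a + 3) * lg)"
          using n0 by (simp add: lg_def powr_powr[symmetric] mult.commute[of "real a + 3"] powr_log_cancel)
        also have "\<dots> \<le> 2 powr W" unfolding W_def by (intro powr_mono real_nat_ceiling_ge) auto
        finally show ?thesis by (simp add: powr_realpow)
      qed
      then have nW': "n ^ (a + 3) \<le> 2 ^ W" by (simp only: of_nat_power[symmetric] of_nat_le_iff)
      have na: "1 \<le> n ^ a" using n by simp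
      have codes: "n * (n ^ a + 1) \<le> 2 ^ W" "1 + n * 3 \<le> 2 ^ W"
      proof -
        have four: "4 \<le> n * n" using mult_le_mono[OF n n] by simp
        have "n * (n ^ a + 1) \<le> n * (n ^ a * (n * n))"
        proof (rule mult_le_mono2)
          have "n ^ a + 1 \<le> n ^ a * 4" using na by linarith
          also have "\<dots> \<le> n ^ a * (n * n)" using four by (rule mult_le_mono2)
          finally show "n ^ a + 1 \<le> n ^ a * (n * n)" .
        qed
        also have "\<dots> = n ^ (a + 3)" by (simp add: power_add numeral_3_eq_3 mult_ac)
        finally show "n * (n ^ a + 1) \<le> 2 ^ W" using nW' by linarith
        have "1 + n * 3 \<le> 1 * (n * 4)" using n by linarith
        also have "\<dots> \<le> n ^ a * (n * (n * n))" using four na by (intro mult_le_mono) auto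
        also have "\<dots> = n ^ (a + 3)" by (simp add: power_add numeral_3_eq_3 mult_ac)
        finally show "1 + n * 3 \<le> 2 ^ W" using nW' by linarith
      qed
      from forwarding_protocol[OF _ k W0 codes, of p] n
      obtain P where P: "\<And>s. valid_stream n k s \<and> length s \<le> n ^ a \<Longrightarrow>
         uses_bits P k s (real (W * (2 * (n ^ a + 1) + 4 * k + 2))) \<and>
         (\<forall>t \<le> length s. moment_estimate p n k P (take t s) UNIV 0 1)" by auto
      \<comment> \<open>One of the two bounds fails, and then \<open>k <= k powr (p - 1)\<close> or
        \<open>sqrt k / \<epsilon>\<close> exceeds the stream length: forwarding every update is
        within the budget.\<close>
      have NX: "real n ^ a \<le> Xi"
      proof (cases "k \<le> n ^ a")
        case True
        then have "real n ^ a \<le> 1 / \<epsilon>" using False by simp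
        also have "\<dots> \<le> sqrt k / \<epsilon>" using k \<epsilon> by (intro divide_right_mono) auto
        finally show ?thesis using Xi(2) by linarith
      next
        case False
        then have "real (n ^ a) \<le> real k" by (simp only: of_nat_le_iff)
        then show ?thesis using Xi(1) unfolding of_nat_power by linarith
      qed
      have "real (W * (2 * (n ^ a + 1) + 4 * k + 2)) = real W * (2 * real n ^ a + 4 * real k + 4)" by (simp add: algebra_simps)
      also have "\<dots> \<le> ((real a + 4) * lg) * (10 * Xi)"
      proof (rule mult_mono)
        have "real W \<le> (real a + 3) * lg + 1" unfolding W_def using x0 by linarith
        then show "real W \<le> (real a + 4) * lg" using lg by (simp add: algebra_simps)
        have "1 \<le> Xi" using Xi(1) k by linarith
        then show "2 * real n ^ a + 4 * real k + 4 \<le> 10 * Xi" using NX Xi(1) by linarith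
      qed (use lg in auto)
      also have "\<dots> = 10 * (real a + 4) * (lg * Xi)" by (simp add: mult_ac)
      also have "\<dots> \<le> K * (lg ^ 6 * Xi)" using KK lg6 Xi lg by (intro mult_mono mult_right_mono) auto
      finally have le: "real (W * (2 * (n ^ a + 1) + 4 * k + 2)) \<le> K * lg ^ 6 * Xi" by (simp only: mult.assoc)
      have "0 \<le> C_bias p * \<epsilon>" using Cb \<epsilon> by simp
      moreover have "1 \<le> K * log 2 n ^ 6" using KK(4) Klg unfolding lg_def by linarith
      moreover have "1 - 1 / real n ^ b \<le> measure_pmf.prob (seeds P k) UNIV" by simp
      ultimately show ?thesis
        unfolding budget using P le by (intro exI[of _ P]) (meson uses_bits_mono moment_estimate_mono)
    qed
  qed
qed

end
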